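(* The following estimates hold for Poisson integrals. (1) If $\mu=\mu_1\times\mu_2\in M(\mathbb{S}^{m-1}\times\mathbb{S}^{m-1},\mathcal{H}_k(\mathbb{C}))$ and $f=P[\mu]$, then $\|f_{r_1,r_2}\|_1\leq\frac{m+2k-2}{m-2}\|\mu\|$ for all $r_1,r_2\in[0,1)$. (2) If $1\leq p\leq\infty$, $g\in L^p(\mathbb{S}^{m-1}\times\mathbb{S}^{m-1},\mathcal{H}_k(\mathbb{C}))$ and $f=P[g]$, then $\|f_{r_1,r_2}\|_p\leq\frac{m+2k-2}{m-2}\|g\|_p$ for all $r_1,r_2\in[0,1)$.
   Context: Let $m\geq 3$, $k\geq 1$ be integers, $\mathbb{B}^m$ the open unit ball of $\mathbb{R}^m$, $\mathbb{S}^{m-1}$ the unit sphere with (unnormalized) surface measure $dS$ and total area $\omega_m$, $\mathcal{H}_k(\mathbb{C})$ the space of complex-valued homogeneous harmonic polynomials of degree $k$ on $\mathbb{R}^m$. Let $Z_k(u,v)$ be the reproducing kernel of $\mathcal{H}_k(\mathbb{C})$: $g(v)=\int_{\mathbb{S}^{m-1}}Z_k(u,v)g(u)dS(u)$ for all $g\in\mathcal{H}_k(\mathbb{C})$. The Poisson kernel is, for $x,v\in\mathbb{B}^m$, $\zeta,u\in\mathbb{S}^{m-1}$, $$P(\zeta,x,u,v)=\frac{c_{m,k}}{2}\,\frac{1-|x|^2}{|x-\zeta|^m}\,Z_k\Big(u-2\frac{\langle u,x-\zeta\rangle}{|x-\zeta|^2}(x-\zeta),\,v\Big),\qquad \frac{c_{m,k}}{2}=\frac{m+2k-2}{(m-2)\,\omega_m}.$$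 (The first argument of $Z_k$ is the reflection of $u$, written $\frac{(x-\zeta)u(x-\zeta)}{|x-\zeta|^2}$ in Clifford notation.) For a function $g$ on $\mathbb{S}^{m-1}\times\mathbb{S}^{m-1}$, $P[g](x,v)=\int_{\mathbb{S}^{m-1}}\int_{\mathbb{S}^{m-1}}P(\zeta,x,u,v)g(\zeta,u)dS(u)dS(\zeta)$, and for a product measure $\mu=\mu_1\times\mu_2$, $P[\mu](x,v)=\int_{\mathbb{S}^{m-1}}\int_{\mathbb{S}^{m-1}}P(\zeta,x,u,v)d\mu_2(u)d\mu_1(\zeta)$. The condition $\mu=\mu_1\times\mu_2\in M(\mathbb{S}^{m-1}\times\mathbb{S}^{m-1},\mathcal{H}_k(\mathbb{C}))$ means that $\mu_1,\mu_2$ are finite complex Borel measures on $\mathbb{S}^{m-1}$ and $d\mu_2=h\,dS$ with $h\in\mathcal{H}_k(\mathbb{C})$; $\|\mu\|$ is the total variation norm. $L^p(\mathbb{S}^{m-1}\times\mathbb{S}^{m-1},\mathcal{H}_k(\mathbb{C}))$ is the space of $f\in L^p(\mathbb{S}^{m-1}\times\mathbb{S}^{m-1},dS\times dS)$ such that for each fixed $x$, $f(x,\cdot)$ is (the restriction of) an element of $\mathcal{H}_k(\mathbb{C})$, and $\|\cdot\|_p$ is the $L^p(dS\times dS)$ norm. For $f$ on $\mathbb{B}^m\times\mathbb{B}^m$, $f_{r_1,r_2}(\xi,\eta)=f(r_1\xi,r_2\eta)$ for $\xi,\eta\in\mathbb{S}^{m-1}$. *)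

theory Defs
  imports "HOL-Probability.Essential_Supremum"
begin

section \<open>Surface measure on the unit sphere\<close>

text \<open>The cone description of the unnormalised surface measure on the unit sphere: the mass of a
  Borel set \<open>A\<close> is the dimension times the Lebesgue measure of the cone of all \<open>x\<close> in the punctured
  open unit ball whose direction \<open>sgn x = x /\<^sub>R norm x\<close> lies in \<open>A\<close>.\<close>

definition surface_measure :: "'a::euclidean_space measure" where
  "surface_measure =
     scale_measure (of_nat DIM('a))
       (distr (restrict_space lborel (ball 0 1 - {0})) (restrict_space borel (sphere 0 1)) sgn)"

section \<open>Complex measures\<close>

text \<open>A complex measure on the \<open>\<sigma>\<close>-algebra of \<open>M\<close> is a countably additive complex-valued set function
  on \<open>sets M\<close>; the measure carried by \<open>M\<close> itself plays no role. Convergence of the series forces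
  \<open>\<nu> {} = 0\<close>.\<close>

definition complex_measure :: "'a measure \<Rightarrow> ('a set \<Rightarrow> complex) \<Rightarrow> bool" where
  "complex_measure M \<nu> \<longleftrightarrow>
     (\<forall>A::nat \<Rightarrow> 'a set. range A \<subseteq> sets M \<longrightarrow> disjoint_family A \<longrightarrow> (\<lambda>i. \<nu> (A i)) sums \<nu> (\<Union>i. A i))"

definition total_variation_norm :: "'a measure \<Rightarrow> ('a set \<Rightarrow> complex) \<Rightarrow> ennreal" where
  "total_variation_norm M \<nu> =
     (SUP A\<in>{A::nat \<Rightarrow> 'a set. range A \<subseteq> sets M \<and> disjoint_family A \<and> (\<Union>i. A i) = space M}.
        \<Sum>i. ennreal (norm (\<nu> (A i))))"

text \<open>The positive part in the Jordan decomposition of a real signed measure \<open>\<nu>\<close>; the negative part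
  is the upper variation of \<open>-\<nu>\<close>.\<close>

definition upper_variation :: "'a measure \<Rightarrow> ('a set \<Rightarrow> real) \<Rightarrow> 'a measure" where
  "upper_variation M \<nu> =
     measure_of (space M) (sets M) (\<lambda>E. SUP A\<in>{A \<in> sets M. A \<subseteq> E}. ennreal (\<nu> A))"

definition complex_measure_integral ::
    "'a measure \<Rightarrow> ('a set \<Rightarrow> complex) \<Rightarrow> ('a \<Rightarrow> complex) \<Rightarrow> complex" where
  "complex_measure_integral M \<nu> f =
     ((LINT x|upper_variation M (\<lambda>A. Re (\<nu> A)). f x) -
      (LINT x|upper_variation M (\<lambda>A. - Re (\<nu> A)). f x)) +
     \<i> * ((LINT x|upper_variation M (\<lambda>A. Im (\<nu> A)). f x) -
          (LINT x|upper_variation M (\<lambda>A. - Im (\<nu> A)). f x))"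

text \<open>The product measure on the product \<open>\<sigma>\<close>-algebra, by integration of the measures of sections; its
  value on a measurable rectangle \<open>A \<times> B\<close> is \<open>\<mu>\<^sub>1 A * \<mu>\<^sub>2 B\<close>.\<close>

definition product_complex_measure ::
    "'a measure \<Rightarrow> ('a set \<Rightarrow> complex) \<Rightarrow> ('b set \<Rightarrow> complex) \<Rightarrow> ('a \<times> 'b) set \<Rightarrow> complex" where
  "product_complex_measure M \<mu>\<^sub>1 \<mu>\<^sub>2 E = complex_measure_integral M \<mu>\<^sub>1 (\<lambda>x. \<mu>\<^sub>2 (Pair x -` E))"

section \<open>Homogeneous harmonic polynomials and their reproducing kernel\<close>

definition laplacian :: "('a::euclidean_space \<Rightarrow> complex) \<Rightarrow> 'a \<Rightarrow> complex" where
  "laplacian p x =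
     (\<Sum>b\<in>Basis. frechet_derivative (\<lambda>y. frechet_derivative p (at y) b) (at x) b)"

definition harmonic_polys :: "nat \<Rightarrow> ('a::euclidean_space \<Rightarrow> complex) set" where
  "harmonic_polys k =
     {p. polynomial_function p \<and> (\<forall>(t::real) x. p (t *\<^sub>R x) = of_real (t ^ k) * p x) \<and>
         (\<forall>x. laplacian p x = 0)}"

text \<open>The two conditions determine \<open>Z\<close> uniquely. The kernel of this space is real-valued and
  symmetric, so no complex conjugation appears.\<close>

definition reproducing_kernel :: "nat \<Rightarrow> ('a::euclidean_space \<Rightarrow> 'a \<Rightarrow> complex) \<Rightarrow> bool" where
  "reproducing_kernel k Z \<longleftrightarrow>
     (\<forall>v. (\<lambda>u. Z u v) \<in> harmonic_polys k) \<and>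
     (\<forall>g\<in>harmonic_polys k. \<forall>v. g v = (LINT u|surface_measure. Z u v * g u))"

section \<open>Poisson kernel and Poisson integrals\<close>

definition reflection :: "'a::euclidean_space \<Rightarrow> 'a \<Rightarrow> 'a" where
  "reflection w u = u - (2 * (u \<bullet> w) / (norm w)\<^sup>2) *\<^sub>R w"

text \<open>The constant \<open>c\<^bsub>m,k\<^esub> / 2\<close> for \<open>m\<close> the dimension of the type \<open>'a\<close>.\<close>

definition half_c :: "'a::euclidean_space itself \<Rightarrow> nat \<Rightarrow> real" where
  "half_c _ k = (real DIM('a) + 2 * real k - 2) /
     ((real DIM('a) - 2) * measure (surface_measure :: 'a measure) (sphere 0 1))"

definition poisson_kernel ::
    "nat \<Rightarrow> ('a::euclidean_space \<Rightarrow> 'a \<Rightarrow> complex) \<Rightarrow> 'a \<Rightarrow> 'a \<Rightarrow> 'a \<Rightarrow> 'a \<Rightarrow> complex" where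
  "poisson_kernel k Z \<zeta> x u v =
     of_real (half_c TYPE('a) k * ((1 - (norm x)\<^sup>2) / norm (x - \<zeta>) ^ DIM('a))) *
     Z (reflection (x - \<zeta>) u) v"

definition poisson_integral ::
    "nat \<Rightarrow> ('a::euclidean_space \<Rightarrow> 'a \<Rightarrow> complex) \<Rightarrow> ('a \<times> 'a \<Rightarrow> complex) \<Rightarrow> 'a \<times> 'a \<Rightarrow> complex" where
  "poisson_integral k Z g = (\<lambda>(x, v).
     LINT \<zeta>|surface_measure. LINT u|surface_measure. poisson_kernel k Z \<zeta> x u v * g (\<zeta>, u))"

definition poisson_integral_measure ::
    "nat \<Rightarrow> ('a::euclidean_space \<Rightarrow> 'a \<Rightarrow> complex) \<Rightarrow> ('a set \<Rightarrow> complex) \<Rightarrow> ('a set \<Rightarrow> complex) \<Rightarrow>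
      'a \<times> 'a \<Rightarrow> complex" where
  "poisson_integral_measure k Z \<mu>\<^sub>1 \<mu>\<^sub>2 = (\<lambda>(x, v).
     complex_measure_integral surface_measure \<mu>\<^sub>1 (\<lambda>\<zeta>.
       complex_measure_integral surface_measure \<mu>\<^sub>2 (\<lambda>u. poisson_kernel k Z \<zeta> x u v)))"

definition dilate :: "real \<Rightarrow> real \<Rightarrow> ('a::real_vector \<times> 'a \<Rightarrow> complex) \<Rightarrow> 'a \<times> 'a \<Rightarrow> complex" where
  "dilate r\<^sub>1 r\<^sub>2 f = (\<lambda>(\<xi>, \<eta>). f (r\<^sub>1 *\<^sub>R \<xi>, r\<^sub>2 *\<^sub>R \<eta>))"

section \<open>Norms and function spaces on the product of two spheres\<close>

text \<open>For \<open>1 \<le> p \<le> \<infinity>\<close>. The norm is \<open>\<infinity>\<close> exactly for the functions outside \<open>L\<^sup>p\<close>, in particular for every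
  non-measurable function (the same convention as in \<^const>\<open>esssup\<close>), so a finite bound for the norm
  includes measurability.\<close>

definition Lp_norm :: "ennreal \<Rightarrow> 'a measure \<Rightarrow> ('a \<Rightarrow> complex) \<Rightarrow> ennreal" where
  "Lp_norm p M f =
     (if f \<notin> borel_measurable M then \<infinity>
      else if p = \<infinity> then esssup M (\<lambda>x. ennreal (norm (f x)))
      else (let I = (\<integral>\<^sup>+ x. ennreal (norm (f x) powr enn2real p) \<partial>M)
            in if I = \<infinity> then \<infinity> else ennreal (enn2real I powr (1 / enn2real p))))"

definition sphere_pair_measure :: "('a::euclidean_space \<times> 'a) measure" where
  "sphere_pair_measure = surface_measure \<Otimes>\<^sub>M surface_measure"

definition Lp_harmonic :: "ennreal \<Rightarrow> nat \<Rightarrow> ('a::euclidean_space \<times> 'a \<Rightarrow> complex) set" where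
  "Lp_harmonic p k =
     {f. Lp_norm p sphere_pair_measure f < \<infinity> \<and>
         (\<forall>\<xi>\<in>sphere 0 1. \<exists>h\<in>harmonic_polys k. \<forall>u\<in>sphere 0 1. f (\<xi>, u) = h u)}"

text \<open>The pairs of factors \<open>(\<mu>\<^sub>1, \<mu>\<^sub>2)\<close> of the product measures in \<open>M(S \<times> S, H\<^sub>k)\<close>.\<close>

definition harmonic_measures ::
    "nat \<Rightarrow> (('a::euclidean_space set \<Rightarrow> complex) \<times> ('a set \<Rightarrow> complex)) set" where
  "harmonic_measures k =
     {(\<mu>\<^sub>1, \<mu>\<^sub>2). complex_measure surface_measure \<mu>\<^sub>1 \<and> complex_measure surface_measure \<mu>\<^sub>2 \<and>
        (\<exists>h\<in>harmonic_polys k. \<forall>A\<in>sets surface_measure. \<mu>\<^sub>2 A = (LINT u:A|surface_measure. h u))}"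

end

theory Submission
  imports Defs "HOL-Probability.Probability_Measure"
begin

text \<open>
  Let \<open>\<xi>\<close>, \<open>\<eta>\<close>, \<open>\<zeta>\<close> be unit vectors, \<open>0 \<le> r < 1\<close>, and let \<open>R\<close> be the reflection in the hyperplane
  orthogonal to \<open>r \<xi> - \<zeta>\<close>. The Laplacian commutes with orthogonal maps, so \<open>h \<circ> R\<close> is again a
  homogeneous harmonic polynomial when \<open>h\<close> is, and \<open>R\<close> preserves the surface measure. The reproducing
  property therefore evaluates the inner integral of the Poisson kernel
  (\<open>dilated_poisson_kernel_integral\<close>):
  \<open>\<integral> P(\<zeta>, r \<xi>, u, s \<eta>) h(u) dS(u) = C s^k Q(\<xi>, \<zeta>) h(R \<eta>)\<close>, where \<open>C = (m + 2k - 2) / (m - 2)\<close> and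
  \<open>Q(\<xi>, \<zeta>) = (1 - r^2) / (\<omega> |r \<xi> - \<zeta>|^m)\<close> is the classical Poisson kernel of the ball, normalised by
  the area \<open>\<omega>\<close> of the sphere. Up to the factor \<open>C s^k \<le> C\<close>, the dilated Poisson integral of \<open>g\<close> is thus
  the average of \<open>g (\<zeta>, R \<eta>)\<close> over \<open>\<zeta>\<close> with the weight \<open>Q(\<xi>, \<zeta>)\<close>.

  Two properties of this averaging give all the bounds. The weight is a probability density in \<open>\<zeta>\<close>
  (\<open>nn_integral_poisson_density\<close>). And averaging preserves the integral over both spheres of a
  nonnegative function (\<open>nn_integral_reflected_poisson\<close>): \<open>Q\<close> is symmetric in its arguments, so after
  exchanging the integrals the \<open>\<eta>\<close>-integral is freed of \<open>R\<close> by rotation invariance and the \<open>\<xi>\<close>-integral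
  of \<open>Q\<close> is \<open>1\<close>. For \<open>p < \<infinity>\<close> the bound is Jensen's inequality followed by the second property for
  \<open>|g|^p\<close>. For \<open>p = \<infinity>\<close> the second property is applied to the indicator of the null set where \<open>|g|\<close>
  exceeds its essential supremum: almost every average ignores that set.

  For measures, \<open>\<mu>\<^sub>1\<close> has a density \<open>w\<close> with respect to a finite positive measure \<open>\<sigma>\<close>
  (\<open>complex_measure_density\<close>), so the product measure has the density \<open>w(\<zeta>) h(u)\<close> with respect to
  \<open>\<sigma> \<times> S\<close>. The averaging argument with \<open>\<sigma>\<close> in the place of \<open>S\<close> bounds the \<open>L^1\<close> norm of the Poisson
  integral by \<open>C\<close> times the \<open>L^1\<close> norm of this density, which is at most the total variation
  (\<open>nn_integral_le_total_variation_norm\<close>).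

  That \<open>Q\<close> has mass one is proved from rotation invariance alone. Differentiating the invariance under
  rotations of a coordinate plane gives an identity for integrals of functions of one coordinate
  (\<open>zonal_integral_identity\<close>). It shows that \<open>\<integral> (1 - r t) / |r e - x|^m dS(x)\<close>, \<open>t = x \<bullet> e\<close>, does not depend on
  \<open>r\<close>; a first order differential equation then gives the same constant \<open>\<omega>\<close> for the Newtonian potential
  \<open>\<integral> |r e - x|^(2 - m) dS(x)\<close>, and the Poisson kernel is twice the first integrand minus the second.
\<close>

section \<open>Orthogonal invariance of Lebesgue measure\<close>

lemma nn_integral_lborel_translate:
  fixes f :: "'a::euclidean_space \<Rightarrow> ennreal"
  assumes [measurable]: "f \<in> borel_measurable borel"
  shows "(\<integral>\<^sup>+x. f (a + x) \<partial>lborel) = (\<integral>\<^sup>+x. f x \<partial>lborel)"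
proof -
  have "(\<integral>\<^sup>+x. f x \<partial>lborel) = (\<integral>\<^sup>+x. f x \<partial>distr lborel borel ((+) a))"
    by (simp add: lborel_distr_plus)
  also have "\<dots> = (\<integral>\<^sup>+x. f (a + x) \<partial>lborel)"
    by (simp add: nn_integral_distr)
  finally show ?thesis ..
qed

lemma nn_integral_lborel_negate:
  fixes f :: "'a::euclidean_space \<Rightarrow> ennreal"
  assumes [measurable]: "f \<in> borel_measurable borel"
  shows "(\<integral>\<^sup>+x. f (a - x) \<partial>lborel) = (\<integral>\<^sup>+x. f x \<partial>lborel)"
proof -
  have "(\<integral>\<^sup>+x. f x \<partial>lborel)
      = (\<integral>\<^sup>+x. f x \<partial>density (distr lborel borel (\<lambda>x. a + (- 1) *\<^sub>R x)) (\<lambda>_. ennreal (\<bar>- 1\<bar>^DIM('a))))"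
    using arg_cong[OF lborel_affine[of "-1" a], of "\<lambda>M. integral\<^sup>N M f"] by simp
  also have "\<dots> = (\<integral>\<^sup>+x. f (a - x) \<partial>lborel)"
    by (simp add: nn_integral_density nn_integral_distr)
  finally show ?thesis ..
qed

lemma orthogonal_transformation_vimage_ball:
  "orthogonal_transformation T \<Longrightarrow> T -` ball 0 r = ball 0 r"
  by (auto simp: orthogonal_transformation_norm)

lemma borel_measurable_orthogonal [measurable_dest]:
  fixes T :: "'a::euclidean_space \<Rightarrow> 'a"
  shows "orthogonal_transformation T \<Longrightarrow> T \<in> borel_measurable borel"
  by (simp add: linear_continuous_on linear_linear orthogonal_transformation_linear
      borel_measurable_continuous_onI)

text \<open>A translation invariant measure is determined up to a factor. For \<open>\<mu>\<close> the image of
  \<open>\<lambda>\<close> under \<open>T\<close>, Tonelli and the substitutions \<open>y \<mapsto> T x + y\<close>, \<open>x \<mapsto> T\<inverse> y + x\<close> and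
  \<open>y \<mapsto> T x - y\<close> give \<open>\<mu> A * \<lambda> B = \<mu> B * \<lambda> A\<close>; for the unit ball \<open>B\<close>, which \<open>T\<close> preserves, the factor is \<open>1\<close>.\<close>
lemma lborel_distr_orthogonal:
  fixes T :: "'a::euclidean_space \<Rightarrow> 'a"
  assumes T: "orthogonal_transformation T"
  shows "distr lborel borel T = lborel"
proof (rule measure_eqI)
  fix A :: "'a set" assume "A \<in> sets (distr lborel borel T)"
  then have [measurable]: "A \<in> sets borel" by simp
  note [measurable] = borel_measurable_orthogonal[OF T]
  define B :: "'a set" where "B = ball 0 1"
  have [measurable]: "B \<in> sets borel" by (simp add: B_def)
  obtain T' where T': "\<And>y. T (T' y) = y"
    using orthogonal_transformation_surj[OF T] by (metis surjD)
  have add: "T (x + y) = T x + T y" for x y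
    using orthogonal_transformation_linear[OF T] by (simp add: linear_add)
  have ind: "(\<integral>\<^sup>+x. indicator E (T x) \<partial>lborel) = emeasure lborel (T -` E)" if [measurable]: "E \<in> sets borel" for E
    by (subst nn_integral_indicator[symmetric]) (auto simp: indicator_def intro!: nn_integral_cong measurable_sets_borel[OF borel_measurable_orthogonal[OF T]])
  have "emeasure lborel (T -` A) * emeasure lborel B
      = (\<integral>\<^sup>+x. \<integral>\<^sup>+y. indicator A (T x) * indicator B y \<partial>lborel \<partial>lborel)"
    by (simp add: nn_integral_cmult nn_integral_multc ind)
  also have "\<dots> = (\<integral>\<^sup>+x. \<integral>\<^sup>+y. indicator A (T x) * indicator B (T x + y) \<partial>lborel \<partial>lborel)"
    by (intro nn_integral_cong nn_integral_lborel_translate[symmetric]) measurable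
  also have "\<dots> = (\<integral>\<^sup>+y. \<integral>\<^sup>+x. indicator A (T x) * indicator B (T x + y) \<partial>lborel \<partial>lborel)"
    by (rule lborel_pair.Fubini') measurable
  also have "\<dots> = (\<integral>\<^sup>+y. \<integral>\<^sup>+x. indicator A (T x - y) * indicator B (T x) \<partial>lborel \<partial>lborel)"
  proof (rule nn_integral_cong)
    fix y
    have m: "(\<lambda>x. indicator A (T x - y) * indicator B (T x) :: ennreal) \<in> borel_measurable borel"
      by measurable
    show "(\<integral>\<^sup>+x. indicator A (T x) * indicator B (T x + y) \<partial>lborel)
      = (\<integral>\<^sup>+x. indicator A (T x - y) * indicator B (T x) \<partial>lborel)"
      using nn_integral_lborel_translate[OF m, of "T' y"] by (simp add: add T' add.commute)
  qed
  also have "\<dots> = (\<integral>\<^sup>+x. \<integral>\<^sup>+y. indicator A (T x - y) * indicator B (T x) \<partial>lborel \<partial>lborel)"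
    by (rule lborel_pair.Fubini') measurable
  also have "\<dots> = (\<integral>\<^sup>+x. \<integral>\<^sup>+y. indicator A y * indicator B (T x) \<partial>lborel \<partial>lborel)"
    by (intro nn_integral_cong nn_integral_lborel_negate) measurable
  also have "\<dots> = emeasure lborel A * emeasure lborel (T -` B)"
    by (simp add: nn_integral_cmult nn_integral_multc ind)
  also have "T -` B = B"
    unfolding B_def by (rule orthogonal_transformation_vimage_ball[OF T])
  finally have eq: "emeasure lborel (T -` A) * emeasure lborel B = emeasure lborel A * emeasure lborel B" .
  have "emeasure lborel B \<noteq> 0" "emeasure lborel B \<noteq> \<infinity>"
    using less_imp_neq[OF unit_ball_vol_pos[of "real DIM('a)"]] by (auto simp: B_def emeasure_ball)
  with eq have "emeasure lborel (T -` A) = emeasure lborel A"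
    by (simp add: ennreal_mult_cancel_left mult.commute[of _ "emeasure lborel B"])
  then show "emeasure (distr lborel borel T) A = emeasure lborel A"
    by (simp add: emeasure_distr)
qed simp

section \<open>The surface measure of the unit sphere\<close>

lemma sets_surface_measure [measurable_cong]:
  "sets (surface_measure :: 'a::euclidean_space measure) = sets (restrict_space borel (sphere 0 1))"
  by (simp add: surface_measure_def)

lemma space_surface_measure [simp]:
  "space (surface_measure :: 'a::euclidean_space measure) = sphere 0 1"
  by (simp add: surface_measure_def space_restrict_space space_scale_measure)

lemma measurable_sgn_punctured [measurable]:
  "sgn \<in> restrict_space lborel (ball 0 1 - {0}) \<rightarrow>\<^sub>M restrict_space borel (sphere (0::'a::euclidean_space) 1)"
  by (rule measurable_restrict_space2) 
     (auto simp: space_restrict_space norm_sgn sgn_div_norm[abs_def] intro!: measurable_restrict_space1)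

lemma measurable_surface_borel:
  fixes f :: "'a::euclidean_space \<Rightarrow> 'b"
  shows "f \<in> borel \<rightarrow>\<^sub>M N \<Longrightarrow> f \<in> surface_measure \<rightarrow>\<^sub>M N"
  by (subst measurable_cong_sets[OF sets_surface_measure refl]) (rule measurable_restrict_space1)

lemma emeasure_surface_measure:
  fixes A :: "'a::euclidean_space set"
  assumes "A \<in> sets surface_measure"
  shows "emeasure surface_measure A
    = of_nat DIM('a) * emeasure lborel {x \<in> ball 0 1 - {0}. sgn x \<in> A}"
proof -
  have A: "A \<in> sets (restrict_space borel (sphere 0 1))"
    using assms by (simp add: sets_surface_measure)
  have eq: "sgn -` A \<inter> space (restrict_space lborel (ball 0 1 - {0})) = {x \<in> ball 0 1 - {0::'a}. sgn x \<in> A}"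
    by (auto simp: space_restrict_space)
  show ?thesis
    unfolding surface_measure_def emeasure_scale_measure
    by (subst emeasure_distr[OF measurable_sgn_punctured A], subst eq, subst emeasure_restrict_space) auto
qed

lemma finite_measure_surface: "finite_measure (surface_measure :: 'a::euclidean_space measure)"
proof
  have "emeasure lborel {x \<in> ball 0 1 - {0::'a}. sgn x \<in> sphere 0 1} \<le> emeasure lborel (ball (0::'a) 1)"
    by (rule emeasure_mono) auto
  also have "\<dots> < \<infinity>" by (simp add: emeasure_ball)
  finally show "emeasure (surface_measure :: 'a measure) (space surface_measure) \<noteq> \<infinity>"
    using emeasure_surface_measure[OF sets.top[of "surface_measure :: 'a measure"]]
    by (simp add: ennreal_mult_eq_top_iff)
qed

interpretation surface: finite_measure "surface_measure :: 'a::euclidean_space measure"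
  by (rule finite_measure_surface)

lemma measure_sphere_pos: "measure surface_measure (sphere (0::'a::euclidean_space) 1) > 0"
proof -
  have "{x \<in> ball 0 1 - {0::'a}. sgn x \<in> sphere 0 1} = ball 0 1 - {0}"
    by (auto simp: norm_sgn)
  then have "emeasure (surface_measure :: 'a measure) (sphere 0 1)
    = of_nat DIM('a) * emeasure lborel (ball (0::'a) 1 - {0})"
    using emeasure_surface_measure[OF sets.top[of "surface_measure :: 'a measure"]] by simp
  also have "emeasure lborel (ball (0::'a) 1 - {0}) = emeasure lborel (ball (0::'a) 1)"
    by (rule emeasure_Diff_null_set) auto
  also have "of_nat DIM('a) * \<dots> > 0"
    by (simp add: emeasure_ball ennreal_zero_less_mult_iff unit_ball_vol_def)
  finally show ?thesis
    by (simp add: surface.emeasure_eq_measure)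
qed

lemma measurable_orthogonal_surface:
  fixes T :: "'a::euclidean_space \<Rightarrow> 'a"
  assumes T: "orthogonal_transformation T"
  shows "T \<in> surface_measure \<rightarrow>\<^sub>M surface_measure"
proof -
  have "T \<in> restrict_space borel (sphere 0 1) \<rightarrow>\<^sub>M restrict_space borel (sphere 0 1)"
    by (intro measurable_restrict_space3 borel_measurable_orthogonal[OF T])
       (auto simp: orthogonal_transformation_norm[OF T])
  then show ?thesis by (simp cong: measurable_cong_sets add: sets_surface_measure)
qed

text \<open>An orthogonal map commutes with \<^const>\<open>sgn\<close> and preserves the punctured ball, so it maps
  the cone over a set to the cone over its image.\<close>
lemma surface_measure_orthogonal:
  fixes T :: "'a::euclidean_space \<Rightarrow> 'a"
  assumes T: "orthogonal_transformation T"
  shows "distr surface_measure surface_measure T = surface_measure"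
proof (rule measure_eqI)
  note [measurable] = borel_measurable_orthogonal[OF T] measurable_orthogonal_surface[OF T]
  fix A :: "'a set" assume "A \<in> sets (distr surface_measure surface_measure T)"
  then have A [measurable]: "A \<in> sets surface_measure" by simp
  then obtain A' where A': "A = A' \<inter> sphere 0 1" and [measurable]: "A' \<in> sets borel"
    by (auto simp: sets_surface_measure sets_restrict_space)
  have sgnT: "T (sgn x) = sgn (T x)" for x
    using orthogonal_transformation_linear[OF T]
    by (simp add: sgn_div_norm linear_scale orthogonal_transformation_norm[OF T])
  have T0: "T x = 0 \<longleftrightarrow> x = 0" for x
    by (metis T norm_eq_zero orthogonal_transformation_norm)
  define C where "C = {x \<in> ball 0 1 - {0}. sgn x \<in> A}"
  have "C = (ball 0 1 - {0}) \<inter> {x. sgn x \<in> A'}"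
    by (auto simp: C_def A' norm_sgn)
  also have "\<dots> \<in> sets borel" 
    by (simp add: sgn_div_norm)
  finally have C: "C \<in> sets borel" .
  have "emeasure (distr surface_measure surface_measure T) A
      = emeasure surface_measure (T -` A \<inter> sphere 0 1)"
    by (simp add: emeasure_distr)
  also have "\<dots> = of_nat DIM('a) * emeasure lborel {x \<in> ball 0 1 - {0}. sgn x \<in> T -` A \<inter> sphere 0 1}"
    by (rule emeasure_surface_measure) (metis A measurable_orthogonal_surface[OF T] measurable_sets space_surface_measure)
  also have "{x \<in> ball 0 1 - {0}. sgn x \<in> T -` A \<inter> sphere 0 1} = T -` C"
    using T0 by (auto simp: C_def sgnT orthogonal_transformation_norm[OF T] norm_sgn)
  also have "emeasure lborel (T -` C) = emeasure (distr lborel borel T) C"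
    using C by (simp add: emeasure_distr)
  also have "\<dots> = emeasure lborel C"
    by (simp add: lborel_distr_orthogonal[OF T])
  also have "of_nat DIM('a) * \<dots> = emeasure surface_measure A"
    by (simp add: emeasure_surface_measure[OF A] C_def)
  finally show "emeasure (distr surface_measure surface_measure T) A = emeasure surface_measure A" .
qed simp

lemma nn_integral_surface_orthogonal:
  fixes T :: "'a::euclidean_space \<Rightarrow> 'a"
  assumes T: "orthogonal_transformation T" and f: "f \<in> borel_measurable surface_measure"
  shows "(\<integral>\<^sup>+x. f (T x) \<partial>surface_measure) = (\<integral>\<^sup>+x. f x \<partial>surface_measure)"
proof -
  have "(\<integral>\<^sup>+x. f x \<partial>surface_measure) = (\<integral>\<^sup>+x. f x \<partial>distr surface_measure surface_measure T)"
    by (simp add: surface_measure_orthogonal[OF T])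
  also have "\<dots> = (\<integral>\<^sup>+x. f (T x) \<partial>surface_measure)"
    using measurable_orthogonal_surface[OF T] f by (simp add: nn_integral_distr)
  finally show ?thesis ..
qed

lemma integral_surface_orthogonal:
  fixes T :: "'a::euclidean_space \<Rightarrow> 'a" and f :: "'a \<Rightarrow> 'b::{banach, second_countable_topology}"
  assumes T: "orthogonal_transformation T" and f: "f \<in> borel_measurable surface_measure"
  shows "(LINT x|surface_measure. f (T x)) = (LINT x|surface_measure. f x)"
proof -
  have "(LINT x|surface_measure. f x) = (LINT x|distr surface_measure surface_measure T. f x)"
    by (simp add: surface_measure_orthogonal[OF T])
  also have "\<dots> = (LINT x|surface_measure. f (T x))"
    using measurable_orthogonal_surface[OF T] f by (rule integral_distr)
  finally show ?thesis ..
qed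

lemma integrable_surface_continuous:
  fixes f :: "'a::euclidean_space \<Rightarrow> 'b::{banach, second_countable_topology}"
  assumes f: "continuous_on (sphere 0 1) f"
  shows "integrable surface_measure f"
proof -
  have "bounded (f ` sphere 0 1)"
    by (intro compact_imp_bounded compact_continuous_image f compact_sphere)
  then obtain B where "\<And>x. x \<in> sphere 0 1 \<Longrightarrow> norm (f x) \<le> B"
    unfolding bounded_iff by blast
  moreover have "f \<in> borel_measurable surface_measure"
    using borel_measurable_continuous_on_restrict[OF f]
    by (subst measurable_cong_sets[OF sets_surface_measure refl])
  ultimately show ?thesis
    by (intro surface.integrable_const_bound[of _ B]) auto
qed

section \<open>Integrals of functions of one coordinate over the sphere\<close>

text \<open>Dominated convergence of the difference quotients: by the mean value theorem they are
  bounded by the bound on the derivative.\<close>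
lemma (in finite_measure) has_real_derivative_integral:
  fixes f :: "real \<Rightarrow> 'a \<Rightarrow> real"
  assumes d: "d > 0"
    and deriv: "\<And>s y. \<bar>s - x\<bar> < d \<Longrightarrow> y \<in> space M \<Longrightarrow> ((\<lambda>s. f s y) has_real_derivative f' s y) (at s)"
    and bound: "\<And>s y. \<bar>s - x\<bar> < d \<Longrightarrow> y \<in> space M \<Longrightarrow> \<bar>f' s y\<bar> \<le> B"
    and int: "\<And>s. \<bar>s - x\<bar> < d \<Longrightarrow> integrable M (f s)"
    and meas: "f' x \<in> borel_measurable M"
  shows "((\<lambda>s. \<integral>y. f s y \<partial>M) has_real_derivative (\<integral>y. f' x y \<partial>M)) (at x)"
  unfolding has_field_derivative_iff tendsto_at_iff_sequentially
proof (intro allI impI)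
  fix X :: "nat \<Rightarrow> real"
  assume X: "\<forall>i. X i \<in> UNIV - {x}" "X \<longlonglongrightarrow> x"
  then obtain N where N: "\<And>i. i \<ge> N \<Longrightarrow> \<bar>X i - x\<bar> < d"
    using LIMSEQ_D[of X x d] d by auto
  define Y where "Y i = X (i + N)" for i
  have Y: "\<bar>Y i - x\<bar> < d" "Y i \<noteq> x" for i
    using N[of "i + N"] X by (auto simp: Y_def)
  have Y_lim: "Y \<longlonglongrightarrow> x"
    unfolding Y_def using X(2) by (rule LIMSEQ_ignore_initial_segment)
  have "(\<lambda>i. \<integral>y. (f (Y i) y - f x y) / (Y i - x) \<partial>M) \<longlonglongrightarrow> (\<integral>y. f' x y \<partial>M)"
  proof (rule integral_dominated_convergence[where w="\<lambda>_. B"])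
    show "f' x \<in> borel_measurable M" by (rule meas)
    have [measurable]: "f (Y i) \<in> borel_measurable M" "f x \<in> borel_measurable M" for i
      using int[OF Y(1)[of i]] int[of x] d by auto
    show "(\<lambda>y. (f (Y i) y - f x y) / (Y i - x)) \<in> borel_measurable M" for i
      by measurable
    show "AE y in M. (\<lambda>i. (f (Y i) y - f x y) / (Y i - x)) \<longlonglongrightarrow> f' x y"
    proof (rule AE_I2)
      fix y assume y: "y \<in> space M"
      have "((\<lambda>s. (f s y - f x y) / (s - x)) \<longlongrightarrow> f' x y) (at x)"
        using deriv[of x y] y d by (simp add: has_field_derivative_iff)
      then show "(\<lambda>i. (f (Y i) y - f x y) / (Y i - x)) \<longlonglongrightarrow> f' x y"
        using Y Y_lim unfolding tendsto_at_iff_sequentially by (auto simp: comp_def)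
    qed
    show "AE y in M. norm ((f (Y i) y - f x y) / (Y i - x)) \<le> B" for i
    proof (rule AE_I2)
      fix y assume y: "y \<in> space M"
      have "norm (f (Y i) y - f x y) \<le> B * norm (Y i - x)"
      proof (rule field_differentiable_bound[of "ball x d" "\<lambda>s. f s y" "\<lambda>s. f' s y"])
        fix s assume "s \<in> ball x d"
        then have s: "\<bar>s - x\<bar> < d" by (simp add: dist_real_def abs_minus_commute)
        show "((\<lambda>s. f s y) has_real_derivative f' s y) (at s within ball x d)"
          by (rule has_field_derivative_at_within[OF deriv[OF s y]])
        show "norm (f' s y) \<le> B"
          unfolding real_norm_def by (rule bound[OF s y])
      next
        show "convex (ball x d)" by (rule convex_ball)
        show "Y i \<in> ball x d" "x \<in> ball x d"
          using Y(1)[of i] d by (simp_all add: dist_real_def abs_minus_commute)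
      qed
      then show "norm ((f (Y i) y - f x y) / (Y i - x)) \<le> B"
        using Y(2)[of i] unfolding norm_divide by (subst pos_divide_le_eq) auto
    qed
  qed simp
  also have "(\<lambda>i. \<integral>y. (f (Y i) y - f x y) / (Y i - x) \<partial>M)
      = (\<lambda>i. ((\<integral>y. f (Y i) y \<partial>M) - (\<integral>y. f x y \<partial>M)) / (Y i - x))"
    using int[OF Y(1)] int[of x] d by (simp add: fun_eq_iff)
  finally show "((\<lambda>s. ((\<integral>y. f s y \<partial>M) - (\<integral>y. f x y \<partial>M)) / (s - x)) \<circ> X) \<longlonglongrightarrow> (\<integral>y. f' x y \<partial>M)"
    unfolding Y_def comp_def by (rule LIMSEQ_offset)
qed

lemma inner_sphere_bounded:
  fixes x e :: "'a::euclidean_space"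
  assumes "norm e = 1" "x \<in> sphere 0 1"
  shows "x \<bullet> e \<in> {-1..1}"
  using Cauchy_Schwarz_ineq2[of x e] assms by (auto simp: abs_le_iff)

lemma integrable_zonal:
  fixes e :: "'a::euclidean_space"
  assumes "continuous_on {-1..1} f" "norm e = 1"
  shows "integrable surface_measure (\<lambda>x. f (x \<bullet> e) :: real)"
  using assms(2) by (intro integrable_surface_continuous continuous_on_compose2[OF assms(1)] continuous_intros)
     (auto dest!: inner_sphere_bounded)

text \<open>The derivative \<open>F'\<close> is continuous on the product of \<open>[-1, 1]\<close> and a compact neighbourhood of \<open>x\<close>;
  this gives the uniform bound that differentiation under the integral needs.\<close>
lemma has_real_derivative_zonal_integral:
  fixes e :: "'a::euclidean_space" and F :: "real \<Rightarrow> real \<Rightarrow> real"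
  assumes e: "norm e = 1" and x: "x \<in> {a<..<b}"
    and deriv: "\<And>s t. s \<in> {a<..<b} \<Longrightarrow> t \<in> {-1..1} \<Longrightarrow> ((\<lambda>s. F s t) has_real_derivative F' s t) (at s)"
    and cont: "\<And>s. s \<in> {a<..<b} \<Longrightarrow> continuous_on {-1..1} (F s)"
    and cont': "continuous_on ({a<..<b} \<times> {-1..1}) (\<lambda>(s, t). F' s t)"
  shows "((\<lambda>s. LINT y|surface_measure. F s (y \<bullet> e)) has_real_derivative
      (LINT y|surface_measure. F' x (y \<bullet> e))) (at x)"
proof -
  define d where "d = min (x - a) (b - x) / 2"
  have d: "d > 0" "a < x - d" "x + d < b"
    using x by (auto simp: d_def min_def field_simps)
  then have sub: "{x - d..x + d} \<subseteq> {a<..<b}" by auto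
  have "compact ((\<lambda>(s, t). F' s t) ` ({x - d..x + d} \<times> {-1..1}))"
    by (intro compact_continuous_image continuous_on_subset[OF cont'] compact_Times) (use sub in auto)
  then obtain B where B: "\<And>s t. s \<in> {x - d..x + d} \<Longrightarrow> t \<in> {-1..1} \<Longrightarrow> \<bar>F' s t\<bar> \<le> B"
    by (fastforce dest!: compact_imp_bounded simp: bounded_iff)
  have in_ab: "s \<in> {a<..<b}" "s \<in> {x - d..x + d}" if "\<bar>s - x\<bar> < d" for s
    using that sub by (auto simp: abs_less_iff subset_iff)
  show ?thesis
  proof (rule surface.has_real_derivative_integral[where B=B, OF d(1)])
    have "continuous_on {-1..1} (\<lambda>t. (\<lambda>(s, t). F' s t) (x, t))"
      using x by (intro continuous_on_compose2[OF cont'] continuous_intros) auto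
    then show "(\<lambda>y. F' x (y \<bullet> e)) \<in> borel_measurable surface_measure"
      using integrable_zonal[of "F' x" e] e by (intro borel_measurable_integrable) simp
    show "integrable surface_measure (\<lambda>y. F s (y \<bullet> e))" if "\<bar>s - x\<bar> < d" for s
      using cont[OF in_ab(1)[OF that]] e by (rule integrable_zonal)
    fix s and y :: 'a assume s: "\<bar>s - x\<bar> < d" and y: "y \<in> space surface_measure"
    then have y: "y \<bullet> e \<in> {-1..1}" using e by (intro inner_sphere_bounded) auto
    show "((\<lambda>s. F s (y \<bullet> e)) has_real_derivative F' s (y \<bullet> e)) (at s)"
      using deriv in_ab(1)[OF s] y by blast
    show "\<bar>F' s (y \<bullet> e)\<bar> \<le> B" using B in_ab(2)[OF s] y by blast
  qed
qed

text \<open>The rotation by the angle \<open>s\<close> in the plane of the orthonormal vectors \<open>e\<close> and \<open>b\<close>, written as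
  the identity plus a map into this plane so that the other coordinates are visibly fixed.\<close>
definition plane_rotation :: "'a::euclidean_space \<Rightarrow> 'a \<Rightarrow> real \<Rightarrow> 'a \<Rightarrow> 'a" where
  "plane_rotation e b s x =
     x + ((cos s - 1) * (x \<bullet> e) + sin s * (x \<bullet> b)) *\<^sub>R e + ((cos s - 1) * (x \<bullet> b) - sin s * (x \<bullet> e)) *\<^sub>R b"

lemma
  assumes "e \<in> Basis" "b \<in> Basis" "e \<noteq> b"
  shows plane_rotation_inner_left: "plane_rotation e b s x \<bullet> e = cos s * (x \<bullet> e) + sin s * (x \<bullet> b)"
    and plane_rotation_inner_right: "plane_rotation e b s x \<bullet> b = cos s * (x \<bullet> b) - sin s * (x \<bullet> e)"
  using assms by (auto simp: plane_rotation_def inner_add_left inner_Basis algebra_simps)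

lemma rotation_norm_identity:
  fixes p q c d \<alpha> \<beta> n :: real
  assumes "\<alpha> = (c - 1) * p + d * q" "\<beta> = (c - 1) * q - d * p" "d\<^sup>2 + c\<^sup>2 = 1"
  shows "n + 2 * \<alpha> * p + 2 * \<beta> * q + \<alpha>\<^sup>2 + \<beta>\<^sup>2 = n"
proof -
  have 1: "\<alpha> * p + \<beta> * q = (c - 1) * (p\<^sup>2 + q\<^sup>2)"
    unfolding assms(1,2) power2_eq_square by (simp add: algebra_simps)
  have 2: "\<alpha>\<^sup>2 + \<beta>\<^sup>2 = ((c - 1)\<^sup>2 + d\<^sup>2) * (p\<^sup>2 + q\<^sup>2)"
    unfolding assms(1,2) power2_eq_square by (simp add: algebra_simps)
  have 3: "(c - 1)\<^sup>2 + d\<^sup>2 = 2 - 2 * c"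
    using assms(3) by (simp add: power2_diff)
  show ?thesis
    using 1 2 unfolding 3 by (simp add: algebra_simps)
qed

lemma orthogonal_plane_rotation:
  fixes e b :: "'a::euclidean_space"
  assumes "e \<in> Basis" "b \<in> Basis" "e \<noteq> b"
  shows "orthogonal_transformation (plane_rotation e b s)"
  unfolding orthogonal_transformation
proof (intro conjI allI)
  show "linear (plane_rotation e b s)"
    by (rule linearI) (simp_all add: plane_rotation_def inner_add_left algebra_simps)
  fix v :: 'a
  define p q \<alpha> \<beta> where "p = v \<bullet> e" and "q = v \<bullet> b"
    and "\<alpha> = (cos s - 1) * p + sin s * q" and "\<beta> = (cos s - 1) * q - sin s * p"
  have on: "e \<bullet> b = 0" "b \<bullet> e = 0" "e \<bullet> e = 1" "b \<bullet> b = 1" "e \<bullet> v = p" "b \<bullet> v = q" "v \<bullet> e = p" "v \<bullet> b = q"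
    using assms by (auto simp: inner_Basis p_def q_def inner_commute)
  have "(norm (plane_rotation e b s v))\<^sup>2 = (norm v)\<^sup>2 + 2 * \<alpha> * p + 2 * \<beta> * q + \<alpha>\<^sup>2 + \<beta>\<^sup>2"
    unfolding plane_rotation_def on \<alpha>_def[symmetric] \<beta>_def[symmetric] power2_norm_eq_inner
    by (simp add: inner_add_left inner_add_right on power2_eq_square algebra_simps)
  also have "\<dots> = (norm v)\<^sup>2"
    by (rule rotation_norm_identity[OF \<alpha>_def \<beta>_def]) simp
  finally show "norm (plane_rotation e b s v) = norm v" by simp
qed

text \<open>Rotate \<open>x\<close> by the angle \<open>s\<close> in the plane of \<open>e\<close> and \<open>b\<close>. The integral of \<open>(x \<bullet> b) * g (x \<bullet> e)\<close> does
  not change; the integrand of the claim is the derivative at \<open>s = 0\<close>.\<close>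
lemma zonal_integral_rotation:
  fixes e b :: "'a::euclidean_space" and g :: "real \<Rightarrow> real"
  assumes eb: "e \<in> Basis" "b \<in> Basis" "e \<noteq> b"
    and deriv: "\<And>t. t \<in> {-1..1} \<Longrightarrow> (g has_real_derivative g' t) (at t)"
    and cont: "continuous_on {-1..1} g'"
  shows "(LINT x|surface_measure. (x \<bullet> b)\<^sup>2 * g' (x \<bullet> e) - (x \<bullet> e) * g (x \<bullet> e)) = 0"
proof -
  have cont_g: "continuous_on {-1..1} g"
    using deriv by (intro continuous_at_imp_continuous_on ballI DERIV_isCont)
  define R where "R = plane_rotation e b"
  define h where "h s x = (R s x \<bullet> b) * g (R s x \<bullet> e)" for s x
  define h' where "h' s x = (R s x \<bullet> b)\<^sup>2 * g' (R s x \<bullet> e) - (R s x \<bullet> e) * g (R s x \<bullet> e)" for s x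
  note R_inner = plane_rotation_inner_left[OF eb] plane_rotation_inner_right[OF eb]
  have orth: "orthogonal_transformation (R s)" for s
    unfolding R_def by (rule orthogonal_plane_rotation[OF eb])
  have R_sphere: "R s x \<in> sphere 0 1" if "x \<in> sphere 0 1" for s x
    using that by (simp add: orthogonal_transformation_norm[OF orth])
  have e: "norm e = 1" and b: "norm b = 1" using eb by auto
  have R_bd: "R s x \<bullet> e \<in> {-1..1}" "R s x \<bullet> b \<in> {-1..1}" if "x \<in> sphere 0 1" for s x
    using inner_sphere_bounded[OF e R_sphere[OF that]] inner_sphere_bounded[OF b R_sphere[OF that]] by auto
  have R0: "R 0 x = x" for x by (simp add: R_def plane_rotation_def)
  have cont_h: "continuous_on (sphere 0 1) (h 0)" and cont_h': "continuous_on (sphere 0 1) (h' 0)"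
    unfolding h_def h'_def R0
    using inner_sphere_bounded[OF e]
    by (auto intro!: continuous_intros continuous_on_compose2[OF cont_g] continuous_on_compose2[OF cont])
  obtain B1 where B1: "\<And>t. t \<in> {-1..1} \<Longrightarrow> \<bar>g t\<bar> \<le> B1"
    using compact_imp_bounded[OF compact_continuous_image[OF cont_g compact_Icc]]
    by (fastforce simp: bounded_iff)
  obtain B2 where B2: "\<And>t. t \<in> {-1..1} \<Longrightarrow> \<bar>g' t\<bar> \<le> B2"
    using compact_imp_bounded[OF compact_continuous_image[OF cont compact_Icc]]
    by (fastforce simp: bounded_iff)
  have "(LINT x|surface_measure. h s x) = (LINT x|surface_measure. h 0 x)" for s
    using integral_surface_orthogonal[OF orth borel_measurable_integrable[OF integrable_surface_continuous[OF cont_h]], of s]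
    by (simp add: h_def R0)
  then have invariant: "(\<lambda>s. LINT x|surface_measure. h s x) = (\<lambda>s. LINT x|surface_measure. h 0 x)"
    by (intro ext)
  have int_h: "integrable surface_measure (h s)" for s
  proof (rule integrable_surface_continuous)
    have "continuous_on (sphere 0 1) (\<lambda>x. h 0 (R s x))"
      using R_sphere by (intro continuous_on_compose2[OF cont_h] linear_continuous_on
          linear_linear[THEN iffD2] orthogonal_transformation_linear[OF orth]) auto
    then show "continuous_on (sphere 0 1) (h s)"
      by (simp add: h_def R0)
  qed
  have "((\<lambda>s. LINT x|surface_measure. h s x) has_real_derivative (LINT x|surface_measure. h' 0 x)) (at 0)"
  proof (rule surface.has_real_derivative_integral[where d=1 and B="B2 + B1"])
    show "h' 0 \<in> borel_measurable surface_measure"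
      using cont_h' by (intro borel_measurable_integrable integrable_surface_continuous)
    fix s and x :: 'a assume "x \<in> space surface_measure"
    then have x: "x \<in> sphere 0 1" by simp
    show "((\<lambda>s. h s x) has_real_derivative h' s x) (at s)"
    proof -
      have "((\<lambda>s. g (R s x \<bullet> e)) has_real_derivative g' (R s x \<bullet> e) * (R s x \<bullet> b)) (at s)"
        by (rule DERIV_chain2[where f=g and g="\<lambda>s. R s x \<bullet> e", OF deriv[OF R_bd(1)[OF x]]])
           (unfold R_def R_inner, (rule derivative_eq_intros refl)+, simp)
      moreover have "((\<lambda>s. R s x \<bullet> b) has_real_derivative - (R s x \<bullet> e)) (at s)"
        unfolding R_def R_inner by (rule derivative_eq_intros refl)+ simp
      ultimately have "((\<lambda>s. h s x) has_real_derivative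
          (- (R s x \<bullet> e)) * g (R s x \<bullet> e) + g' (R s x \<bullet> e) * (R s x \<bullet> b) * (R s x \<bullet> b)) (at s)"
        unfolding h_def by (rule DERIV_mult[rotated])
      then show ?thesis
        unfolding h'_def by (simp add: power2_eq_square mult_ac)
    qed
    have "\<bar>h' s x\<bar> \<le> \<bar>R s x \<bullet> b\<bar>\<^sup>2 * \<bar>g' (R s x \<bullet> e)\<bar> + \<bar>R s x \<bullet> e\<bar> * \<bar>g (R s x \<bullet> e)\<bar>"
      unfolding h'_def by (metis abs_mult abs_triangle_ineq4 power_abs)
    also have "\<dots> \<le> 1\<^sup>2 * B2 + 1 * B1"
      using R_bd[OF x, of s] by (intro add_mono mult_mono power_mono B1 B2) (auto simp: abs_le_iff)
    finally show "\<bar>h' s x\<bar> \<le> B2 + B1" by simp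
  qed (simp_all add: int_h)
  moreover have "((\<lambda>s. LINT x|surface_measure. h s x) has_real_derivative 0) (at 0)"
    unfolding invariant by (rule DERIV_const)
  ultimately have "(LINT x|surface_measure. h' 0 x) = 0"
    by (rule DERIV_unique)
  then show ?thesis by (simp add: h'_def R0)
qed

text \<open>The previous identity summed over the coordinates \<open>b \<noteq> e\<close>, whose squares add up to
  \<open>1 - (x \<bullet> e)\<^sup>2\<close>. In other words, the spherical Laplacian of a function of \<open>x \<bullet> e\<close> has integral zero.\<close>
lemma zonal_integral_identity:
  fixes e :: "'a::euclidean_space" and g :: "real \<Rightarrow> real"
  assumes e: "e \<in> Basis"
    and deriv: "\<And>t. t \<in> {-1..1} \<Longrightarrow> (g has_real_derivative g' t) (at t)"
    and cont: "continuous_on {-1..1} g'"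
  shows "(LINT x|surface_measure. (1 - (x \<bullet> e)\<^sup>2) * g' (x \<bullet> e) - (real DIM('a) - 1) * (x \<bullet> e) * g (x \<bullet> e)) = 0"
proof -
  have cont_g: "continuous_on {-1..1} g"
    using deriv by (intro continuous_at_imp_continuous_on ballI DERIV_isCont)
  have e1: "norm e = 1" using e by simp
  have int: "integrable surface_measure (\<lambda>x. (x \<bullet> b)\<^sup>2 * g' (x \<bullet> e) - (x \<bullet> e) * g (x \<bullet> e))" for b
    using inner_sphere_bounded[OF e1]
    by (intro integrable_surface_continuous)
       (auto intro!: continuous_intros continuous_on_compose2[OF cont_g] continuous_on_compose2[OF cont])
  have "0 = (\<Sum>b\<in>Basis - {e}. LINT x|surface_measure. (x \<bullet> b)\<^sup>2 * g' (x \<bullet> e) - (x \<bullet> e) * g (x \<bullet> e))"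
    using e zonal_integral_rotation[OF e _ _ deriv cont] by (intro sum.neutral[symmetric]) auto
  also have "\<dots> = (LINT x|surface_measure. (\<Sum>b\<in>Basis - {e}. (x \<bullet> b)\<^sup>2 * g' (x \<bullet> e) - (x \<bullet> e) * g (x \<bullet> e)))"
    using int by (intro Bochner_Integration.integral_sum[symmetric]) auto
  also have "\<dots> = (LINT x|surface_measure. (1 - (x \<bullet> e)\<^sup>2) * g' (x \<bullet> e) - (real DIM('a) - 1) * (x \<bullet> e) * g (x \<bullet> e))"
  proof (rule Bochner_Integration.integral_cong[OF refl])
    fix x :: 'a assume "x \<in> space surface_measure"
    then have "x \<bullet> x = 1" by (simp add: dot_square_norm)
    then have "(\<Sum>b\<in>Basis. (x \<bullet> b)\<^sup>2) = 1"
      unfolding euclidean_inner[of x x] by (simp add: power2_eq_square)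
    then have "(\<Sum>b\<in>Basis - {e}. (x \<bullet> b)\<^sup>2) = 1 - (x \<bullet> e)\<^sup>2"
      using e by (simp add: sum_diff1)
    then show "(\<Sum>b\<in>Basis - {e}. (x \<bullet> b)\<^sup>2 * g' (x \<bullet> e) - (x \<bullet> e) * g (x \<bullet> e))
      = (1 - (x \<bullet> e)\<^sup>2) * g' (x \<bullet> e) - (real DIM('a) - 1) * (x \<bullet> e) * g (x \<bullet> e)"
      using e by (simp add: sum_subtractf sum_distrib_right[symmetric] card_Diff_singleton of_nat_diff)
  qed
  finally show ?thesis ..
qed

section \<open>The mass of the Poisson kernel of the ball\<close>

lemma poisson_denominator_pos:
  fixes r t :: real
  assumes "\<bar>r\<bar> < 1" "t \<in> {-1..1}"
  shows "1 - 2 * r * t + r\<^sup>2 > 0"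
proof -
  have "\<bar>r\<bar> * \<bar>t\<bar> \<le> \<bar>r\<bar> * 1"
    using assms by (intro mult_left_mono) (auto simp: abs_le_iff)
  then have "r * t \<le> \<bar>r\<bar>"
    using abs_ge_self[of "r * t"] by (simp add: abs_mult)
  then have "1 - 2 * r * t + r\<^sup>2 \<ge> (1 - \<bar>r\<bar>)\<^sup>2"
    by (simp add: power2_eq_square algebra_simps)
  moreover have "(1 - \<bar>r\<bar>)\<^sup>2 > 0" using assms by simp
  ultimately show ?thesis by linarith
qed

lemma DERIV_zonal_power:
  fixes r t a :: real
  assumes "\<bar>r\<bar> < 1" "t \<in> {-1..1}"
  shows "((\<lambda>t. (1 - 2 * r * t + r\<^sup>2) powr a) has_real_derivative
            - 2 * r * a * (1 - 2 * r * t + r\<^sup>2) powr (a - 1)) (at t)"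
    and "((\<lambda>r. (1 - 2 * r * t + r\<^sup>2) powr a) has_real_derivative
            2 * (r - t) * a * (1 - 2 * r * t + r\<^sup>2) powr (a - 1)) (at r)"
  using assms poisson_denominator_pos[OF assms] by (auto intro!: derivative_eq_intros DERIV_fun_powr[THEN DERIV_cong] poisson_denominator_pos simp: algebra_simps)

lemma continuous_on_zonal_power:
  fixes r t :: "'b::topological_space \<Rightarrow> real"
  assumes "\<And>x. x \<in> A \<Longrightarrow> \<bar>r x\<bar> < 1 \<and> t x \<in> {-1..1}" "continuous_on A r" "continuous_on A t"
  shows "continuous_on A (\<lambda>x. (1 - 2 * r x * t x + (r x)\<^sup>2) powr a)"
proof (intro continuous_on_powr continuous_intros assms(2,3) ballI)
  show "1 - 2 * r x * t x + (r x)\<^sup>2 \<noteq> 0" if "x \<in> A" for x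
    using assms(1)[OF that] poisson_denominator_pos[of "r x" "t x"] by auto
qed

lemma continuous_on_zonal_power_pair:
  "continuous_on ({-1<..<1} \<times> {-1..1}) (\<lambda>x. (1 - 2 * fst x * snd x + (fst x)\<^sup>2) powr (a :: real))"
  by (rule continuous_on_zonal_power) (auto intro!: continuous_intros)

lemma integral_zonal_cong:
  fixes e :: "'a::euclidean_space" and f g :: "real \<Rightarrow> real"
  assumes "norm e = 1" "\<And>t. t \<in> {-1..1} \<Longrightarrow> f t = g t"
  shows "(LINT x|surface_measure. f (x \<bullet> e)) = (LINT x|surface_measure. g (x \<bullet> e))"
  using assms(2)[OF inner_sphere_bounded[OF assms(1)]]
  by (intro Bochner_Integration.integral_cong) auto

text \<open>For \<open>a = r e\<close> the integrand is \<open>x \<bullet> (x - a) / |x - a|^m\<close>, the density of the solid angle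
  that a piece of the sphere fills when seen from \<open>a\<close>; so the integral does not depend on \<open>a\<close>. Here the
  \<open>r\<close>-derivative of the integrand is minus the integrand of the zonal identity for
  \<open>g t = (1 - 2 r t + r\<^sup>2) powr (- m / 2)\<close>, and at \<open>r = 0\<close> the integrand is \<open>1\<close>.\<close>
lemma solid_angle_integral:
  fixes e :: "'a::euclidean_space"
  assumes e: "e \<in> Basis" and r: "\<bar>r\<bar> < 1"
  defines "m \<equiv> real DIM('a)"
  shows "(LINT x|surface_measure. (1 - r * (x \<bullet> e)) * (1 - 2 * r * (x \<bullet> e) + r\<^sup>2) powr (- m / 2))
     = measure surface_measure (sphere (0::'a) 1)"
proof -
  define D where "D r t = 1 - 2 * r * t + r\<^sup>2" for r t :: real
  define F where "F r t = (1 - r * t) * D r t powr (- m / 2)" for r t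
  define F' where "F' r t = - t * D r t powr (- m / 2) - m * (1 - r * t) * (r - t) * D r t powr (- m / 2 - 1)" for r t
  have e1: "norm e = 1" using e by simp
  have "((\<lambda>s. LINT x|surface_measure. F s (x \<bullet> e)) has_real_derivative 0) (at s)" if s: "s \<in> {-1<..<1}" for s
  proof -
    have "((\<lambda>s. LINT x|surface_measure. F s (x \<bullet> e)) has_real_derivative (LINT x|surface_measure. F' s (x \<bullet> e))) (at s)"
    proof (rule has_real_derivative_zonal_integral[OF e1 s])
      show "((\<lambda>r. F r t) has_real_derivative F' r t) (at r)" if "r \<in> {-1<..<1}" "t \<in> {-1..1}" for r t
      proof -
        have "((\<lambda>r. 1 - r * t) has_real_derivative - t) (at r)"
          by (auto intro!: derivative_eq_intros)
        moreover have "((\<lambda>r. D r t powr (- m / 2)) has_real_derivative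
            2 * (r - t) * (- m / 2) * D r t powr (- m / 2 - 1)) (at r)"
          unfolding D_def using that by (intro DERIV_zonal_power(2)) auto
        ultimately show ?thesis
          unfolding F_def F'_def by (rule DERIV_cong[OF DERIV_mult]) (simp add: algebra_simps)
      qed
      show "continuous_on {-1..1} (F r)" if "r \<in> {-1<..<1}" for r
        unfolding F_def D_def using that by (intro continuous_intros continuous_on_zonal_power) auto
      show "continuous_on ({-1<..<1} \<times> {-1..1}) (\<lambda>(s, t). F' s t)"
        unfolding F'_def D_def case_prod_beta
        by (intro continuous_on_diff continuous_on_mult continuous_on_minus continuous_on_const
            continuous_on_fst continuous_on_snd continuous_on_id continuous_on_zonal_power_pair)
    qed
    moreover have "(LINT x|surface_measure. F' s (x \<bullet> e)) = 0"
    proof -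
      define g where "g t = D s t powr (- m / 2)" for t
      define g' where "g' t = m * s * D s t powr (- m / 2 - 1)" for t
      have zero: "(LINT x|surface_measure. (1 - (x \<bullet> e)\<^sup>2) * g' (x \<bullet> e) - (real DIM('a) - 1) * (x \<bullet> e) * g (x \<bullet> e)) = 0"
      proof (rule zonal_integral_identity[OF e])
        show "(g has_real_derivative g' t) (at t)" if "t \<in> {-1..1}" for t
          unfolding g_def g'_def D_def
          by (rule DERIV_cong, rule DERIV_zonal_power(1)) (use s that in auto)
        show "continuous_on {-1..1} g'"
          unfolding g'_def D_def using s by (intro continuous_intros continuous_on_zonal_power) auto
      qed
      have "- ((1 - t\<^sup>2) * g' t - (real DIM('a) - 1) * t * g t) = F' s t" if t: "t \<in> {-1..1}" for t
      proof -
        define d where "d = D s t powr (- m / 2 - 1)"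
        have "D s t > 0" unfolding D_def using s t by (intro poisson_denominator_pos) auto
        then have "D s t powr (- m / 2) = D s t * d"
          by (simp add: d_def powr_diff)
        then have power: "D s t powr (- m / 2) = (1 - 2 * s * t + s\<^sup>2) * d"
          by (simp only: D_def)
        show ?thesis
          unfolding g_def g'_def F'_def d_def[symmetric] power m_def[symmetric]
          by (simp add: algebra_simps power2_eq_square)
      qed
      from integral_zonal_cong[where f="\<lambda>t. - ((1 - t\<^sup>2) * g' t - (real DIM('a) - 1) * t * g t)" and g="F' s", OF e1 this]
      have "(LINT x|surface_measure. F' s (x \<bullet> e))
         = - (LINT x|surface_measure. (1 - (x \<bullet> e)\<^sup>2) * g' (x \<bullet> e) - (real DIM('a) - 1) * (x \<bullet> e) * g (x \<bullet> e))"
        by (simp only: integral_minus) 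
      with zero show ?thesis by simp
    qed
    ultimately show ?thesis by simp
  qed
  then have "(LINT x|surface_measure. F r (x \<bullet> e)) = (LINT x|surface_measure. F 0 (x \<bullet> e))"
    using r by (intro DERIV_isconst3[of "-1" 1]) auto
  then show ?thesis by (simp add: F_def D_def)
qed

text \<open>With \<open>N r\<close> the integral on the left, \<open>2 r\<^sup>2 - 2 r t = 2 (1 - 2 r t + r\<^sup>2) - 2 (1 - r t)\<close> and the
  solid angle turn \<open>r * N' r\<close> into \<open>(2 - m) * (N r - \<omega>)\<close>. Hence \<open>r ^ (m - 2) * (N r - \<omega>)\<close> is constant, and it
  vanishes at \<open>r = 0\<close>.\<close>
lemma newton_potential_integral:
  fixes e :: "'a::euclidean_space"
  assumes e: "e \<in> Basis" and r: "\<bar>r\<bar> < 1" and dim: "DIM('a) \<ge> 3"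
  defines "m \<equiv> real DIM('a)"
  shows "(LINT x|surface_measure. (1 - 2 * r * (x \<bullet> e) + r\<^sup>2) powr (1 - m / 2))
     = measure surface_measure (sphere (0::'a) 1)"
proof -
  define D where "D r t = 1 - 2 * r * t + r\<^sup>2" for r t :: real
  define N where "N r = (LINT x|surface_measure. D r (x \<bullet> e) powr (1 - m / 2))" for r
  define F' where "F' r t = (2 - m) * (r - t) * D r t powr (- m / 2)" for r t
  define \<omega> where "\<omega> = measure surface_measure (sphere (0::'a) 1)"
  define n where "n = DIM('a) - 3"
  have m: "m = real n + 3" using dim by (simp add: m_def n_def)
  have e1: "norm e = 1" using e by simp
  have deriv: "(N has_real_derivative (LINT x|surface_measure. F' s (x \<bullet> e))) (at s)" if s: "s \<in> {-1<..<1}" for s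
    unfolding N_def
  proof (rule has_real_derivative_zonal_integral[OF e1 s])
    show "((\<lambda>r. D r t powr (1 - m / 2)) has_real_derivative F' r t) (at r)" if "r \<in> {-1<..<1}" "t \<in> {-1..1}" for r t
      unfolding F'_def D_def
      by (rule DERIV_cong, rule DERIV_zonal_power(2)) (use that in \<open>auto simp: algebra_simps\<close>)
    show "continuous_on {-1..1} (\<lambda>t. D r t powr (1 - m / 2))" if "r \<in> {-1<..<1}" for r
      unfolding D_def using that by (intro continuous_intros continuous_on_zonal_power) auto
    show "continuous_on ({-1<..<1} \<times> {-1..1}) (\<lambda>(s, t). F' s t)"
      unfolding F'_def D_def case_prod_beta
      by (intro continuous_on_diff continuous_on_mult continuous_on_minus continuous_on_const
            continuous_on_fst continuous_on_snd continuous_on_id continuous_on_zonal_power_pair)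
  qed
  have ode: "s * (LINT x|surface_measure. F' s (x \<bullet> e)) = (2 - m) * (N s - \<omega>)" if s: "s \<in> {-1<..<1}" for s
  proof -
    have int: "integrable surface_measure (\<lambda>x. D s (x \<bullet> e) powr (1 - m / 2))"
      "integrable surface_measure (\<lambda>x. (1 - s * (x \<bullet> e)) * D s (x \<bullet> e) powr (- m / 2))"
      unfolding D_def using s
      by (intro integrable_zonal[OF _ e1] continuous_intros continuous_on_zonal_power; auto)+
    have "s * F' s t = (2 - m) * (D s t powr (1 - m / 2) - (1 - s * t) * D s t powr (- m / 2))"
      if t: "t \<in> {-1..1}" for t
    proof -
      have "D s t > 0" unfolding D_def using s t by (intro poisson_denominator_pos) auto
      then have "D s t powr (1 - m / 2) = D s t * D s t powr (- m / 2)"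
        using powr_add[of "D s t" 1 "- m / 2"] by simp
      moreover define q where "q = D s t powr (- m / 2)"
      ultimately have power: "D s t powr (1 - m / 2) = (1 - 2 * s * t + s\<^sup>2) * q"
        by (simp only: D_def)
      show ?thesis
        unfolding F'_def power q_def[symmetric] by (simp add: algebra_simps power2_eq_square)
    qed
    from integral_zonal_cong[where f="\<lambda>t. s * F' s t", OF e1 this]
    have "s * (LINT x|surface_measure. F' s (x \<bullet> e))
       = (LINT x|surface_measure. (2 - m) * (D s (x \<bullet> e) powr (1 - m / 2) - (1 - s * (x \<bullet> e)) * D s (x \<bullet> e) powr (- m / 2)))"
      by (simp only: integral_mult_right_zero)
    also have "\<dots> = (2 - m) * (N s - \<omega>)"
      using s int solid_angle_integral[OF e, of s] by (simp add: abs_less_iff N_def \<omega>_def D_def m_def)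
    finally show ?thesis .
  qed
  \<comment> \<open>The exponent \<open>Suc n\<close> is \<open>m - 2\<close>.\<close>
  define W where "W s = s ^ Suc n * (N s - \<omega>)" for s
  have "(W has_real_derivative 0) (at s)" if s: "s \<in> {-1<..<1}" for s
  proof -
    have "(W has_real_derivative s ^ n * ((real n + 1) * (N s - \<omega>) + s * (LINT x|surface_measure. F' s (x \<bullet> e)))) (at s)"
    proof -
      have "((\<lambda>s. s ^ Suc n) has_real_derivative (real n + 1) * s ^ n) (at s)"
        using DERIV_pow[of "Suc n" s] by (simp add: add.commute)
      moreover have "((\<lambda>s. N s - \<omega>) has_real_derivative (LINT x|surface_measure. F' s (x \<bullet> e)) - 0) (at s)"
        by (intro DERIV_diff deriv[OF s] DERIV_const)
      ultimately show ?thesis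
        unfolding W_def by (rule DERIV_cong[OF DERIV_mult]) (simp add: algebra_simps)
    qed
    then show ?thesis by (simp add: ode[OF s] m algebra_simps)
  qed
  then have "W r = W 0"
    using r by (intro DERIV_isconst3[of "-1" 1]) auto
  then have "N r = \<omega>"
    by (cases "r = 0") (auto simp: W_def N_def \<omega>_def D_def)
  then show ?thesis by (simp add: N_def \<omega>_def D_def)
qed

text \<open>The relation \<open>1 - r\<^sup>2 = 2 (1 - r t) - (1 - 2 r t + r\<^sup>2)\<close> writes the integrand as twice the solid angle density minus
  the Newtonian potential.\<close>
lemma poisson_kernel_integral_Basis:
  fixes e :: "'a::euclidean_space"
  assumes e: "e \<in> Basis" and r: "\<bar>r\<bar> < 1" and dim: "DIM('a) \<ge> 3"
  defines "m \<equiv> real DIM('a)"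
  shows "(LINT x|surface_measure. (1 - r\<^sup>2) * (1 - 2 * r * (x \<bullet> e) + r\<^sup>2) powr (- m / 2))
     = measure surface_measure (sphere (0::'a) 1)"
proof -
  define D where "D t = 1 - 2 * r * t + r\<^sup>2" for t :: real
  have e1: "norm e = 1" using e by simp
  have int: "integrable surface_measure (\<lambda>x. D (x \<bullet> e) powr (1 - m / 2))"
    "integrable surface_measure (\<lambda>x. (1 - r * (x \<bullet> e)) * D (x \<bullet> e) powr (- m / 2))"
    unfolding D_def using r
    by (intro integrable_zonal[OF _ e1] continuous_intros continuous_on_zonal_power; auto)+
  have "(1 - r\<^sup>2) * D t powr (- m / 2) = 2 * ((1 - r * t) * D t powr (- m / 2)) - D t powr (1 - m / 2)"
    if t: "t \<in> {-1..1}" for t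
  proof -
    have "D t > 0" unfolding D_def using r t by (rule poisson_denominator_pos)
    then have "D t powr (1 - m / 2) = D t * D t powr (- m / 2)"
      using powr_add[of "D t" 1 "- m / 2"] by simp
    moreover define q where "q = D t powr (- m / 2)"
    ultimately have power: "D t powr (1 - m / 2) = (1 - 2 * r * t + r\<^sup>2) * q"
      by (simp only: D_def)
    show ?thesis
      unfolding power q_def[symmetric] by (simp add: algebra_simps)
  qed
  from integral_zonal_cong[where f="\<lambda>t. (1 - r\<^sup>2) * D t powr (- m / 2)", OF e1 this]
  have "(LINT x|surface_measure. (1 - r\<^sup>2) * D (x \<bullet> e) powr (- m / 2))
     = (LINT x|surface_measure. 2 * ((1 - r * (x \<bullet> e)) * D (x \<bullet> e) powr (- m / 2)) - D (x \<bullet> e) powr (1 - m / 2))"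
    by simp
  also have "\<dots> = measure surface_measure (sphere (0::'a) 1)"
    using int solid_angle_integral[OF e r] newton_potential_integral[OF e r dim] by (simp add: D_def m_def)
  finally show ?thesis by (simp add: D_def)
qed

section \<open>Reflections\<close>

lemma linear_reflection: "linear (reflection w)"
  by (rule linearI) (simp_all add: reflection_def inner_add_left algebra_simps add_divide_distrib)

lemma orthogonal_reflection: "orthogonal_transformation (reflection w)"
  unfolding orthogonal_transformation
proof (intro conjI allI linear_reflection)
  fix v :: 'a
  have "(norm (reflection w v))\<^sup>2 = (norm v)\<^sup>2"
  proof (cases "w = 0")
    case False
    define c where "c = 2 * (v \<bullet> w) / (norm w)\<^sup>2"
    have c: "c * (w \<bullet> w) = 2 * (v \<bullet> w)"
      using False by (simp add: c_def power2_norm_eq_inner)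
    have "(norm (reflection w v))\<^sup>2 = (norm v)\<^sup>2 - 2 * c * (v \<bullet> w) + c * (c * (w \<bullet> w))"
      unfolding reflection_def c_def[symmetric] unfolding power2_norm_eq_inner
      by (simp add: inner_diff_left inner_diff_right inner_commute algebra_simps)
    then show ?thesis unfolding c by simp
  qed (simp add: reflection_def)
  then show "norm (reflection w v) = norm v" by simp
qed

lemma reflection_involutive: "reflection w (reflection w v) = v"
proof (cases "w = 0")
  case False
  then have "reflection w v \<bullet> w = - (v \<bullet> w)"
    by (simp add: reflection_def inner_diff_left power2_norm_eq_inner)
  then show ?thesis
    by (simp add: reflection_def[of w "reflection w v"]) (simp add: reflection_def)
qed (simp add: reflection_def)

lemma reflection_scaleR: "reflection w (r *\<^sub>R v) = r *\<^sub>R reflection w v"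
  by (rule linear_scale[OF linear_reflection])

lemma norm_reflection [simp]: "norm (reflection w v) = norm v"
  by (rule orthogonal_transformation_norm[OF orthogonal_reflection])

text \<open>This moves an arbitrary point of the sphere to a basis vector.\<close>
lemma reflection_swap:
  assumes "norm x = norm y"
  shows "reflection (x - y) x = y"
proof (cases "x = y")
  case False
  have "2 * (x \<bullet> (x - y)) = (norm (x - y))\<^sup>2"
    using assms by (simp add: power2_norm_eq_inner inner_diff_left inner_diff_right inner_commute norm_eq)
  then show ?thesis using False by (simp add: reflection_def)
qed (simp add: reflection_def)

section \<open>Orthogonal invariance of harmonic polynomials\<close>

lemma real_polynomial_function_has_derivative:
  fixes p :: "'a::euclidean_space \<Rightarrow> real"
  assumes "real_polynomial_function p"
  shows "\<exists>p'. (\<forall>x. (p has_derivative p' x) (at x)) \<and> (\<forall>w. real_polynomial_function (\<lambda>x. p' x w))"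
  using assms
proof (induction rule: real_polynomial_function.induct)
    case (linear f)
    then show ?case
      by (intro exI[of _ "\<lambda>_. f"]) (auto intro: bounded_linear_imp_has_derivative)
  next
    case (const c)
    then show ?case
      by (intro exI[of _ "\<lambda>_ _. 0"]) (auto intro:)
  next
    case (add f g)
    then obtain f' g' where
      "\<And>x. (f has_derivative f' x) (at x)" "\<And>w. real_polynomial_function (\<lambda>x. f' x w)"
      "\<And>x. (g has_derivative g' x) (at x)" "\<And>w. real_polynomial_function (\<lambda>x. g' x w)" by metis
    then show ?case
      by (intro exI[of _ "\<lambda>x w. f' x w + g' x w"]) (auto intro: has_derivative_add)
  next
    case (mult f g)
    then obtain f' g' where
      "\<And>x. (f has_derivative f' x) (at x)" "\<And>w. real_polynomial_function (\<lambda>x. f' x w)"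
      "\<And>x. (g has_derivative g' x) (at x)" "\<And>w. real_polynomial_function (\<lambda>x. g' x w)" by metis
    with mult.hyps show ?case
      by (intro exI[of _ "\<lambda>x w. f x * g' x w + f' x w * g x"])
         (auto intro!: has_derivative_mult real_polynomial_function.intros(3,4))
qed

lemma polynomial_function_complex_iff:
  "polynomial_function (p :: 'a::euclidean_space \<Rightarrow> complex) \<longleftrightarrow>
     real_polynomial_function (\<lambda>x. Re (p x)) \<and> real_polynomial_function (\<lambda>x. Im (p x))"
  unfolding polynomial_function_iff_Basis_inner[of p] by (simp add: Basis_complex_def inner_complex_def)

lemma polynomial_function_has_derivative:
  fixes p :: "'a::euclidean_space \<Rightarrow> complex"
  assumes "polynomial_function p"
  shows "\<exists>p'. (\<forall>x. (p has_derivative p' x) (at x)) \<and> (\<forall>w. polynomial_function (\<lambda>x. p' x w))"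
proof -
  have re_im: "real_polynomial_function (\<lambda>x. Re (p x))" "real_polynomial_function (\<lambda>x. Im (p x))"
    using assms unfolding polynomial_function_complex_iff by auto
  obtain a where a: "\<And>x. ((\<lambda>x. Re (p x)) has_derivative a x) (at x)" "\<And>w. real_polynomial_function (\<lambda>x. a x w)"
    using real_polynomial_function_has_derivative[of "\<lambda>x. Re (p x)"] re_im(1) by blast
  obtain b where b: "\<And>x. ((\<lambda>x. Im (p x)) has_derivative b x) (at x)" "\<And>w. real_polynomial_function (\<lambda>x. b x w)"
    using real_polynomial_function_has_derivative[of "\<lambda>x. Im (p x)"] re_im(2) by blast
  show ?thesis
  proof (intro exI conjI allI)
    show "polynomial_function (\<lambda>x. Complex (a x w) (b x w))" for w
      using a(2)[of w] b(2)[of w] by (simp add: polynomial_function_complex_iff)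
    have "((\<lambda>x. of_real (Re (p x)) + \<i> * of_real (Im (p x))) has_derivative
        (\<lambda>w. of_real (a x w) + \<i> * of_real (b x w))) (at x)" for x
      by (intro has_derivative_add has_derivative_of_real a has_derivative_mult_right b)
    then show "(p has_derivative (\<lambda>w. Complex (a x w) (b x w))) (at x)" for x
      unfolding Complex_eq complex_eq[symmetric] .
  qed
qed

text \<open>The Laplacian is the trace of the second derivative. That bilinear form is expanded over the
  basis, and the matrix of \<open>T\<close> cancels against its transpose.\<close>
lemma laplacian_orthogonal:
  fixes p :: "'a::euclidean_space \<Rightarrow> complex" and T :: "'a \<Rightarrow> 'a"
  assumes p: "polynomial_function p" and T: "orthogonal_transformation T"
  shows "laplacian (\<lambda>x. p (T x)) x = laplacian p (T x)"
proof -
  have linT: "linear T" by (rule orthogonal_transformation_linear[OF T])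
  then have dT: "(T has_derivative T) (at x)" for x
    by (simp add: linear_imp_has_derivative)
  obtain p' where p': "\<And>x. (p has_derivative p' x) (at x)" "\<And>w. polynomial_function (\<lambda>x. p' x w)"
    using polynomial_function_has_derivative[OF p] by blast
  have "\<exists>q. \<forall>x. ((\<lambda>x. p' x w) has_derivative q x) (at x)" for w
    using polynomial_function_has_derivative[OF p'(2)[of w]] by blast
  then obtain q where q: "\<And>w x. ((\<lambda>x. p' x w) has_derivative q w x) (at x)" by metis
  have fd: "frechet_derivative p (at x) = p' x" for x
    by (rule frechet_derivative_at[OF p'(1), symmetric])
  have fdT: "frechet_derivative (\<lambda>x. p (T x)) (at x) = (\<lambda>w. p' (T x) (T w))" for x
    using frechet_derivative_at[OF has_derivative_compose[OF dT p'(1)], symmetric] .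
  have fq: "frechet_derivative (\<lambda>x. p' x w) (at x) = q w x" for w x
    by (rule frechet_derivative_at[OF q, symmetric])
  have fqT: "frechet_derivative (\<lambda>x. p' (T x) w) (at x) = (\<lambda>v. q w (T x) (T v))" for w x
    using frechet_derivative_at[OF has_derivative_compose[OF dT q], symmetric] .
  have lin_p': "linear (p' x)" for x
    using p'(1) has_derivative_linear by blast
  have lin_q: "linear (q w x)" for w x
    using q has_derivative_linear by blast
  have q_expand: "q w x v = (\<Sum>c\<in>Basis. (w \<bullet> c) *\<^sub>R q c x v)" for w x v
  proof -
    have "p' y w = (\<Sum>c\<in>Basis. (w \<bullet> c) *\<^sub>R p' y c)" for y
      by (subst euclidean_representation[of w, symmetric]) (simp only: linear_sum[OF lin_p'] linear_scale[OF lin_p'])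
    moreover have "((\<lambda>y. \<Sum>c\<in>Basis. (w \<bullet> c) *\<^sub>R p' y c) has_derivative (\<lambda>v. \<Sum>c\<in>Basis. (w \<bullet> c) *\<^sub>R q c x v)) (at x)"
      by (intro has_derivative_sum has_derivative_scaleR_right q)
    ultimately have "((\<lambda>y. p' y w) has_derivative (\<lambda>v. \<Sum>c\<in>Basis. (w \<bullet> c) *\<^sub>R q c x v)) (at x)"
      by simp
    from has_derivative_unique[OF q this] show ?thesis by metis
  qed
  have q_expand2: "q w x v = (\<Sum>c\<in>Basis. \<Sum>d\<in>Basis. ((w \<bullet> c) * (v \<bullet> d)) *\<^sub>R q c x d)" for w x v
  proof -
    have "q c x v = (\<Sum>d\<in>Basis. (v \<bullet> d) *\<^sub>R q c x d)" for c
      by (subst euclidean_representation[of v, symmetric]) (simp only: linear_sum[OF lin_q] linear_scale[OF lin_q])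
    then show ?thesis
      by (subst q_expand) (simp add: scaleR_sum_right)
  qed
  obtain S where S: "orthogonal_transformation S" "\<And>y. T (S y) = y"
    using orthogonal_transformation_inv[OF T] orthogonal_transformation_surj[OF T] by (metis surj_f_inv_f)
  have adj: "T v \<bullet> c = v \<bullet> S c" for v c
    using T S(2) by (metis orthogonal_transformation_def)
  have "laplacian (\<lambda>x. p (T x)) x = (\<Sum>b\<in>Basis. q (T b) (T x) (T b))"
    by (simp add: laplacian_def fdT fqT)
  also have "\<dots> = (\<Sum>b\<in>Basis. \<Sum>c\<in>Basis. \<Sum>d\<in>Basis. ((T b \<bullet> c) * (T b \<bullet> d)) *\<^sub>R q c (T x) d)"
    by (intro sum.cong refl q_expand2)
  also have "\<dots> = (\<Sum>c\<in>Basis. \<Sum>d\<in>Basis. \<Sum>b\<in>Basis. ((T b \<bullet> c) * (T b \<bullet> d)) *\<^sub>R q c (T x) d)"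
    by (rule trans[OF sum.swap], rule sum.cong[OF refl], rule sum.swap)
  also have "\<dots> = (\<Sum>c\<in>Basis. \<Sum>d\<in>Basis. (c \<bullet> d) *\<^sub>R q c (T x) d)"
  proof (intro sum.cong refl)
    fix c d :: 'a
    have "(\<Sum>b\<in>Basis. (T b \<bullet> c) * (T b \<bullet> d)) = S c \<bullet> S d"
      unfolding adj euclidean_inner[of "S c" "S d"] by (simp only: inner_commute[of _ "S c"] inner_commute[of _ "S d"])
    also have "\<dots> = c \<bullet> d" using S(1) by (simp add: orthogonal_transformation_def)
    finally show "(\<Sum>b\<in>Basis. ((T b \<bullet> c) * (T b \<bullet> d)) *\<^sub>R q c (T x) d) = (c \<bullet> d) *\<^sub>R q c (T x) d"
      by (simp add: scaleR_sum_left[symmetric])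
  qed
  also have "\<dots> = (\<Sum>c\<in>Basis. q c (T x) c)"
  proof (intro sum.cong refl)
    fix c :: 'a assume c: "c \<in> Basis"
    have "(\<Sum>d\<in>Basis. (c \<bullet> d) *\<^sub>R q c (T x) d) = (\<Sum>d\<in>Basis. if d = c then q c (T x) d else 0)"
      using c by (intro sum.cong) (auto simp: inner_Basis)
    then show "(\<Sum>d\<in>Basis. (c \<bullet> d) *\<^sub>R q c (T x) d) = q c (T x) c"
      using c by simp
  qed
  also have "\<dots> = laplacian p (T x)"
    by (simp add: laplacian_def fd fq)
  finally show ?thesis .
qed

lemma harmonic_polys_orthogonal:
  fixes h :: "'a::euclidean_space \<Rightarrow> complex" and T :: "'a \<Rightarrow> 'a"
  assumes h: "h \<in> harmonic_polys k" and T: "orthogonal_transformation T"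
  shows "(\<lambda>x. h (T x)) \<in> harmonic_polys k"
proof -
  have linT: "linear T" by (rule orthogonal_transformation_linear[OF T])
  have p: "polynomial_function h" and hom: "\<And>t x. h (t *\<^sub>R x) = of_real (t ^ k) * h x"
    and lap: "\<And>x. laplacian h x = 0"
    using h by (auto simp: harmonic_polys_def)
  have "polynomial_function T"
    using linT by (intro polynomial_function_bounded_linear) (simp add: linear_conv_bounded_linear)
  from polynomial_function_compose[OF this p] have "polynomial_function (\<lambda>x. h (T x))"
    by (simp add: comp_def)
  then show ?thesis
    using hom lap by (simp add: harmonic_polys_def linear_scale[OF linT] laplacian_orthogonal[OF p T])
qed

lemma continuous_on_harmonic_poly:
  "h \<in> harmonic_polys k \<Longrightarrow> continuous_on S h"
  by (simp add: harmonic_polys_def continuous_on_polymonial_function)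

lemma measurable_harmonic_poly:
  "h \<in> harmonic_polys k \<Longrightarrow> h \<in> borel_measurable borel"
  by (intro borel_measurable_continuous_onI continuous_on_harmonic_poly)

text \<open>The reflection is moved from the kernel to \<open>h\<close> by the invariance of the surface measure, and
  \<open>h\<close> composed with it is still reproduced.\<close>
lemma reproducing_kernel_reflection:
  fixes Z :: "'a::euclidean_space \<Rightarrow> 'a \<Rightarrow> complex"
  assumes Z: "reproducing_kernel k Z" and h: "h \<in> harmonic_polys k"
  shows "(LINT u|surface_measure. Z (reflection w u) v * h u) = h (reflection w v)"
proof -
  have Zv: "(\<lambda>u. Z u v) \<in> harmonic_polys k"
    using Z by (simp add: reproducing_kernel_def)
  have h': "(\<lambda>u. h (reflection w u)) \<in> harmonic_polys k"
    by (rule harmonic_polys_orthogonal[OF h orthogonal_reflection])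
  have "(\<lambda>u. Z u v * h (reflection w u)) \<in> borel_measurable surface_measure"
    by (intro measurable_surface_borel borel_measurable_times measurable_harmonic_poly[OF Zv] measurable_harmonic_poly[OF h'])
  from integral_surface_orthogonal[OF orthogonal_reflection[of w] this]
  have "(LINT u|surface_measure. Z (reflection w u) v * h u) = (LINT u|surface_measure. Z u v * h (reflection w u))"
    by (simp add: reflection_involutive)
  also have "\<dots> = h (reflection w v)"
    using Z h' unfolding reproducing_kernel_def by metis
  finally show ?thesis .
qed

section \<open>The Poisson probability density on the sphere\<close>

text \<open>The Poisson kernel of the ball at \<open>r \<xi>\<close>, divided by the area of the sphere to
  become a probability density.\<close>
definition poisson_density :: "real \<Rightarrow> 'a::euclidean_space \<Rightarrow> 'a \<Rightarrow> real" where
  "poisson_density r \<xi> \<zeta> =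
     (1 - r\<^sup>2) / (measure (surface_measure :: 'a measure) (sphere 0 1) * norm (r *\<^sub>R \<xi> - \<zeta>) ^ DIM('a))"

lemma poisson_density_nonneg:
  fixes \<xi> :: "'a::euclidean_space"
  assumes "0 \<le> r" "r < 1"
  shows "0 \<le> poisson_density r \<xi> \<zeta>"
  using assms measure_sphere_pos[where 'a='a] by (simp add: poisson_density_def power_le_one)

lemma dilated_distance:
  fixes \<xi> \<zeta> :: "'a::euclidean_space"
  assumes "norm \<xi> = 1" "norm \<zeta> = 1"
  shows "norm (r *\<^sub>R \<xi> - \<zeta>) = sqrt (1 - 2 * r * (\<zeta> \<bullet> \<xi>) + r\<^sup>2)"
proof -
  have "\<xi> \<bullet> \<xi> = 1" "\<zeta> \<bullet> \<zeta> = 1"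
    using assms by (auto simp: dot_square_norm)
  then show ?thesis
    unfolding norm_eq_sqrt_inner
    by (simp add: inner_diff_left inner_diff_right inner_commute[of \<xi> \<zeta>] power2_eq_square algebra_simps)
qed

lemma poisson_density_commute:
  fixes \<xi> \<zeta> :: "'a::euclidean_space"
  assumes "norm \<xi> = 1" "norm \<zeta> = 1"
  shows "poisson_density r \<xi> \<zeta> = poisson_density r \<zeta> \<xi>"
  using assms unfolding poisson_density_def by (simp add: dilated_distance inner_commute)

lemma dilated_distance_pos:
  fixes \<xi> \<zeta> :: "'a::euclidean_space"
  assumes "norm \<xi> = 1" "norm \<zeta> = 1" "0 \<le> r" "r < 1"
  shows "1 - r \<le> norm (r *\<^sub>R \<xi> - \<zeta>)"
proof -
  have "norm \<zeta> - norm (r *\<^sub>R \<xi>) \<le> norm (\<zeta> - r *\<^sub>R \<xi>)" by (rule norm_triangle_ineq2)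
  then show ?thesis using assms by (simp add: norm_minus_commute)
qed

lemma poisson_density_powr:
  fixes \<xi> \<zeta> :: "'a::euclidean_space"
  assumes "norm \<xi> = 1" "norm \<zeta> = 1" "0 \<le> r" "r < 1"
  shows "poisson_density r \<xi> \<zeta> =
    ((1 - r\<^sup>2) * (1 - 2 * r * (\<zeta> \<bullet> \<xi>) + r\<^sup>2) powr (- real DIM('a) / 2)) / measure (surface_measure :: 'a measure) (sphere 0 1)"
proof -
  define D where "D = 1 - 2 * r * (\<zeta> \<bullet> \<xi>) + r\<^sup>2"
  have "D > 0"
    unfolding D_def using assms inner_sphere_bounded[of \<xi> \<zeta>] by (intro poisson_denominator_pos) auto
  then have "norm (r *\<^sub>R \<xi> - \<zeta>) ^ DIM('a) = D powr (real DIM('a) / 2)"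
    unfolding dilated_distance[OF assms(1,2)] D_def[symmetric]
    by (simp add: powr_half_sqrt[symmetric] powr_power)
  then show ?thesis
    unfolding poisson_density_def D_def[symmetric] by (simp add: powr_minus_divide)
qed

section \<open>Averages over the sphere with Poisson weights\<close>

lemma measurable_ident_surface: "(\<lambda>x. x) \<in> surface_measure \<rightarrow>\<^sub>M (borel :: 'a::euclidean_space measure)"
  by (rule measurable_surface_borel) simp

text \<open>A reflection moves \<open>\<xi>\<close> to a basis vector.\<close>
lemma nn_integral_poisson_density:
  fixes \<xi> :: "'a::euclidean_space"
  assumes \<xi>: "norm \<xi> = 1" and r: "0 \<le> r" "r < 1" and dim: "DIM('a) \<ge> 3"
  shows "(\<integral>\<^sup>+\<zeta>. ennreal (poisson_density r \<xi> \<zeta>) \<partial>surface_measure) = 1"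
proof -
  obtain e :: 'a where e: "e \<in> Basis" using SOME_Basis by blast
  then have e1: "norm e = 1" by simp
  define R where "R = reflection (\<xi> - e)"
  have R: "orthogonal_transformation R" unfolding R_def by (rule orthogonal_reflection)
  have "R \<xi> = e" unfolding R_def by (rule reflection_swap) (simp add: \<xi> e1)
  then have inner: "R \<zeta> \<bullet> e = \<zeta> \<bullet> \<xi>" for \<zeta>
    using R by (metis orthogonal_transformation_def)
  define F where "F t = (1 - r\<^sup>2) * (1 - 2 * r * t + r\<^sup>2) powr (- real DIM('a) / 2)" for t
  define \<omega> where "\<omega> = measure surface_measure (sphere (0::'a) 1)"
  have int: "integrable surface_measure (\<lambda>\<zeta>. F (\<zeta> \<bullet> e))"
    unfolding F_def using r by (intro integrable_zonal[OF _ e1] continuous_intros continuous_on_zonal_power) auto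
  have nonneg: "0 \<le> F t" for t unfolding F_def using r by (simp add: power_le_one)
  have "(\<integral>\<^sup>+\<zeta>. ennreal (poisson_density r \<xi> \<zeta>) \<partial>surface_measure)
      = (\<integral>\<^sup>+\<zeta>. ennreal (F (R \<zeta> \<bullet> e) / \<omega>) \<partial>surface_measure)"
    unfolding inner
    by (intro nn_integral_cong) (simp add: poisson_density_powr \<xi> r F_def \<omega>_def)
  also have "\<dots> = (\<integral>\<^sup>+\<zeta>. ennreal (F (\<zeta> \<bullet> e) / \<omega>) \<partial>surface_measure)"
    using borel_measurable_integrable[OF int]
    by (intro nn_integral_surface_orthogonal[OF R, where f="\<lambda>\<zeta>. ennreal (F (\<zeta> \<bullet> e) / \<omega>)"]
        measurable_compose[OF _ measurable_ennreal] borel_measurable_divide borel_measurable_const)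
  also have "\<dots> = ennreal (LINT \<zeta>|surface_measure. F (\<zeta> \<bullet> e) / \<omega>)"
    using int nonneg measure_nonneg by (intro nn_integral_eq_integral) (auto simp: \<omega>_def)
  also have "(LINT \<zeta>|surface_measure. F (\<zeta> \<bullet> e) / \<omega>) = \<omega> / \<omega>"
    using poisson_kernel_integral_Basis[OF e, of r] r dim by (simp add: F_def \<omega>_def)
  finally show ?thesis
    using measure_sphere_pos[where 'a='a] by (simp add: \<omega>_def)
qed

lemma measurable_poisson_density:
  fixes f g :: "'b \<Rightarrow> 'a::euclidean_space"
  assumes [measurable]: "f \<in> borel_measurable M" "g \<in> borel_measurable M"
  shows "(\<lambda>x. poisson_density r (f x) (g x)) \<in> borel_measurable M"
  unfolding poisson_density_def by measurable

lemma measurable_reflection_surface: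
  fixes f g :: "'b \<Rightarrow> 'a::euclidean_space"
  assumes [measurable]: "f \<in> borel_measurable M" and g: "g \<in> M \<rightarrow>\<^sub>M surface_measure"
  shows "(\<lambda>x. reflection (f x) (g x)) \<in> M \<rightarrow>\<^sub>M surface_measure"
proof -
  have [measurable]: "g \<in> borel_measurable M"
    using measurable_compose[OF g measurable_ident_surface] by simp
  have "g x \<in> sphere 0 1" if "x \<in> space M" for x
    using measurable_space[OF g that] by simp
  moreover have "(\<lambda>x. reflection (f x) (g x)) \<in> borel_measurable M"
    unfolding reflection_def by measurable
  ultimately have "(\<lambda>x. reflection (f x) (g x)) \<in> M \<rightarrow>\<^sub>M restrict_space borel (sphere 0 1)"
    by (intro measurable_restrict_space2) auto
  then show ?thesis
    by (simp add: measurable_cong_sets[OF refl sets_surface_measure])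
qed

lemma sets_sphere_pair_measure [measurable_cong]:
  "sets (sphere_pair_measure :: ('a::euclidean_space \<times> 'a) measure) = sets (surface_measure \<Otimes>\<^sub>M surface_measure)"
  by (simp add: sphere_pair_measure_def)

lemma measurable_surface_imp_borel:
  "f \<in> N \<rightarrow>\<^sub>M surface_measure \<Longrightarrow> f \<in> N \<rightarrow>\<^sub>M (borel :: 'a::euclidean_space measure)"
  by (rule measurable_compose[OF _ measurable_ident_surface])

lemma measurable_reflected_pair:
  fixes \<sigma> :: "'a::euclidean_space measure"
  assumes sets: "sets \<sigma> = sets surface_measure"
  shows "(\<lambda>(z, \<zeta>). (\<zeta>, reflection (r *\<^sub>R fst z - \<zeta>) (snd z)))
      \<in> sphere_pair_measure \<Otimes>\<^sub>M \<sigma> \<rightarrow>\<^sub>M \<sigma> \<Otimes>\<^sub>M surface_measure"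
    and "(\<lambda>(z, \<zeta>). poisson_density r (fst z) \<zeta>) \<in> borel_measurable (sphere_pair_measure \<Otimes>\<^sub>M \<sigma>)"
proof -
  have [measurable_cong]: "sets \<sigma> = sets (surface_measure :: 'a measure)" by (rule sets)
  have [measurable]: "(\<lambda>x. reflection (r *\<^sub>R fst (fst x) - snd x) (snd (fst x)))
      \<in> sphere_pair_measure \<Otimes>\<^sub>M \<sigma> \<rightarrow>\<^sub>M surface_measure"
    by (intro measurable_reflection_surface borel_measurable_diff borel_measurable_scaleR borel_measurable_const
        measurable_surface_imp_borel) measurable
  show "(\<lambda>(z, \<zeta>). (\<zeta>, reflection (r *\<^sub>R fst z - \<zeta>) (snd z)))
      \<in> sphere_pair_measure \<Otimes>\<^sub>M \<sigma> \<rightarrow>\<^sub>M \<sigma> \<Otimes>\<^sub>M surface_measure"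
    unfolding case_prod_beta by measurable
  show "(\<lambda>(z, \<zeta>). poisson_density r (fst z) \<zeta>) \<in> borel_measurable (sphere_pair_measure \<Otimes>\<^sub>M \<sigma>)"
    unfolding case_prod_beta
    by (intro measurable_poisson_density measurable_surface_imp_borel) measurable
qed

lemma measurable_reflected_poisson:
  fixes \<Phi> :: "'a::euclidean_space \<times> 'a \<Rightarrow> ennreal"
  assumes sets: "sets \<sigma> = sets surface_measure"
    and \<Phi>: "\<Phi> \<in> borel_measurable (\<sigma> \<Otimes>\<^sub>M surface_measure)"
  shows "(\<lambda>(z, \<zeta>). ennreal (poisson_density r (fst z) \<zeta>) * \<Phi> (\<zeta>, reflection (r *\<^sub>R fst z - \<zeta>) (snd z)))
     \<in> borel_measurable (sphere_pair_measure \<Otimes>\<^sub>M \<sigma>)"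
  using measurable_compose[OF measurable_reflected_pair(1)[OF sets] \<Phi>] measurable_reflected_pair(2)[OF sets]
  by (simp add: case_prod_beta)

text \<open>This gives the measurability of the Poisson integrals, where \<open>\<sigma>\<close> is the surface measure
  for functions and carries the first factor for measures.\<close>
lemma measurable_poisson_average:
  fixes G :: "'a::euclidean_space \<times> 'a \<Rightarrow> complex"
  assumes \<sigma>: "sigma_finite_measure \<sigma>" and sets: "sets \<sigma> = sets surface_measure"
    and G: "G \<in> borel_measurable (\<sigma> \<Otimes>\<^sub>M surface_measure)"
  shows "(\<lambda>z. LINT \<zeta>|\<sigma>. of_real (poisson_density r (fst z) \<zeta>) * G (\<zeta>, reflection (r *\<^sub>R fst z - \<zeta>) (snd z)))
     \<in> borel_measurable sphere_pair_measure"
proof -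
  have "(\<lambda>(z, \<zeta>). of_real (poisson_density r (fst z) \<zeta>) * G (\<zeta>, reflection (r *\<^sub>R fst z - \<zeta>) (snd z)))
     \<in> borel_measurable (sphere_pair_measure \<Otimes>\<^sub>M \<sigma>)"
    using measurable_compose[OF measurable_reflected_pair(1)[OF sets] G] measurable_reflected_pair(2)[OF sets]
    by (simp add: case_prod_beta)
  then show ?thesis
    by (rule sigma_finite_measure.borel_measurable_lebesgue_integral[OF \<sigma>])
qed

text \<open>Averaging preserves integrals. For fixed \<open>\<zeta>\<close> and \<open>\<xi>\<close> the reflection disappears from the
  \<open>\<eta>\<close>-integral by rotation invariance; what is left of the \<open>\<xi>\<close>-integral is the weight, whose mass is \<open>1\<close>
  in this variable too, by symmetry.\<close>
lemma nn_integral_reflected_poisson: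
  fixes \<Phi> :: "'a::euclidean_space \<times> 'a \<Rightarrow> ennreal"
  assumes \<sigma>: "sigma_finite_measure \<sigma>" and sets: "sets \<sigma> = sets surface_measure"
    and \<Phi>: "\<Phi> \<in> borel_measurable (\<sigma> \<Otimes>\<^sub>M surface_measure)"
    and r: "0 \<le> r" "r < 1" and dim: "DIM('a) \<ge> 3"
  shows "(\<integral>\<^sup>+z. \<integral>\<^sup>+\<zeta>. ennreal (poisson_density r (fst z) \<zeta>) * \<Phi> (\<zeta>, reflection (r *\<^sub>R fst z - \<zeta>) (snd z)) \<partial>\<sigma>
       \<partial>sphere_pair_measure) = (\<integral>\<^sup>+y. \<Phi> y \<partial>(\<sigma> \<Otimes>\<^sub>M surface_measure))"
proof -
  let ?S = "surface_measure :: 'a measure"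
  interpret \<sigma>: sigma_finite_measure \<sigma> by (rule \<sigma>)
  interpret P: pair_sigma_finite \<sigma> ?S by unfold_locales
  interpret SS: pair_sigma_finite ?S ?S by unfold_locales
  interpret N: sigma_finite_measure "sphere_pair_measure :: ('a \<times> 'a) measure"
    unfolding sphere_pair_measure_def by unfold_locales
  interpret Q: pair_sigma_finite "sphere_pair_measure :: ('a \<times> 'a) measure" \<sigma> by unfold_locales
  have [measurable_cong]: "sets \<sigma> = sets ?S" by (rule sets)
  have space: "space \<sigma> = sphere 0 1" using sets_eq_imp_space_eq[OF sets] by simp
  note [measurable] = \<Phi>
  note meas = measurable_reflected_poisson[OF sets \<Phi>, of r]
  have "(\<integral>\<^sup>+z. \<integral>\<^sup>+\<zeta>. ennreal (poisson_density r (fst z) \<zeta>) * \<Phi> (\<zeta>, reflection (r *\<^sub>R fst z - \<zeta>) (snd z)) \<partial>\<sigma>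
       \<partial>sphere_pair_measure)
     = (\<integral>\<^sup>+\<zeta>. \<integral>\<^sup>+z. ennreal (poisson_density r (fst z) \<zeta>) * \<Phi> (\<zeta>, reflection (r *\<^sub>R fst z - \<zeta>) (snd z)) \<partial>sphere_pair_measure \<partial>\<sigma>)"
    using Q.Fubini'[OF meas, symmetric] .
  also have "\<dots> = (\<integral>\<^sup>+\<zeta>. \<integral>\<^sup>+\<eta>. \<Phi> (\<zeta>, \<eta>) \<partial>?S \<partial>\<sigma>)"
  proof (rule nn_integral_cong)
    fix \<zeta> assume \<zeta>: "\<zeta> \<in> space \<sigma>"
    then have \<zeta>1: "norm \<zeta> = 1" and [measurable]: "\<zeta> \<in> space ?S" by (simp_all add: space)
    define G where "G \<xi> \<eta> = ennreal (poisson_density r \<xi> \<zeta>) * \<Phi> (\<zeta>, reflection (r *\<^sub>R \<xi> - \<zeta>) \<eta>)" for \<xi> \<eta>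
    have pair: "(\<lambda>z. (z, \<zeta>)) \<in> ?S \<Otimes>\<^sub>M ?S \<rightarrow>\<^sub>M sphere_pair_measure \<Otimes>\<^sub>M \<sigma>"
      using \<zeta> by measurable
    have "(\<lambda>z. G (fst z) (snd z)) \<in> borel_measurable (?S \<Otimes>\<^sub>M ?S)"
      using measurable_compose[OF pair meas] by (simp add: G_def)
    then have "(\<integral>\<^sup>+z. G (fst z) (snd z) \<partial>sphere_pair_measure) = (\<integral>\<^sup>+\<xi>. \<integral>\<^sup>+\<eta>. G \<xi> \<eta> \<partial>?S \<partial>?S)"
      unfolding sphere_pair_measure_def by (simp add: surface.nn_integral_fst[symmetric])
    also have "\<dots> = (\<integral>\<^sup>+\<xi>. ennreal (poisson_density r \<xi> \<zeta>) * (\<integral>\<^sup>+\<eta>. \<Phi> (\<zeta>, \<eta>) \<partial>?S) \<partial>?S)"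
    proof (rule nn_integral_cong)
      fix \<xi> :: 'a
      have m: "(\<lambda>\<eta>. \<Phi> (\<zeta>, \<eta>)) \<in> borel_measurable ?S" using \<zeta> by measurable
      have m': "(\<lambda>\<eta>. \<Phi> (\<zeta>, reflection (r *\<^sub>R \<xi> - \<zeta>) \<eta>)) \<in> borel_measurable ?S"
        using measurable_compose[OF measurable_orthogonal_surface[OF orthogonal_reflection] m] .
      show "(\<integral>\<^sup>+\<eta>. G \<xi> \<eta> \<partial>?S) = ennreal (poisson_density r \<xi> \<zeta>) * (\<integral>\<^sup>+\<eta>. \<Phi> (\<zeta>, \<eta>) \<partial>?S)"
        unfolding G_def using nn_integral_surface_orthogonal[OF orthogonal_reflection m]
        by (simp add: nn_integral_cmult m')
    qed
    also have "\<dots> = (\<integral>\<^sup>+\<xi>. ennreal (poisson_density r \<xi> \<zeta>) \<partial>?S) * (\<integral>\<^sup>+\<eta>. \<Phi> (\<zeta>, \<eta>) \<partial>?S)"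
      by (intro nn_integral_multc measurable_compose[OF _ measurable_ennreal] measurable_poisson_density
          measurable_ident_surface measurable_const) auto
    also have "(\<integral>\<^sup>+\<xi>. ennreal (poisson_density r \<xi> \<zeta>) \<partial>?S) = (\<integral>\<^sup>+\<xi>. ennreal (poisson_density r \<zeta> \<xi>) \<partial>?S)"
      by (intro nn_integral_cong) (simp add: poisson_density_commute[OF _ \<zeta>1])
    also have "\<dots> = 1"
      by (rule nn_integral_poisson_density[OF \<zeta>1 r dim])
    finally show "(\<integral>\<^sup>+z. ennreal (poisson_density r (fst z) \<zeta>) * \<Phi> (\<zeta>, reflection (r *\<^sub>R fst z - \<zeta>) (snd z)) \<partial>sphere_pair_measure)
      = (\<integral>\<^sup>+\<eta>. \<Phi> (\<zeta>, \<eta>) \<partial>?S)"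
      by (simp add: G_def)
  qed
  also have "\<dots> = (\<integral>\<^sup>+y. \<Phi> y \<partial>(\<sigma> \<Otimes>\<^sub>M surface_measure))"
    by (rule surface.nn_integral_fst[OF \<Phi>])
  finally show ?thesis .
qed

section \<open>Evaluation of the Poisson integral\<close>

lemma poisson_kernel_integral_harmonic:
  fixes Z :: "'a::euclidean_space \<Rightarrow> 'a \<Rightarrow> complex"
  assumes "reproducing_kernel k Z" "h \<in> harmonic_polys k"
  shows "(LINT u|surface_measure. poisson_kernel k Z \<zeta> x u v * h u)
    = of_real (half_c TYPE('a) k * ((1 - (norm x)\<^sup>2) / norm (x - \<zeta>) ^ DIM('a))) * h (reflection (x - \<zeta>) v)"
  unfolding poisson_kernel_def mult.assoc[of _ "Z _ _"]
  by (simp only: integral_mult_right_zero reproducing_kernel_reflection[OF assms])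

lemma half_c_poisson_density:
  fixes \<xi> \<zeta> :: "'a::euclidean_space"
  assumes "norm \<xi> = 1"
  shows "half_c TYPE('a) k * ((1 - (norm (r *\<^sub>R \<xi>))\<^sup>2) / norm (r *\<^sub>R \<xi> - \<zeta>) ^ DIM('a))
    = (real DIM('a) + 2 * real k - 2) / (real DIM('a) - 2) * poisson_density r \<xi> \<zeta>"
  using assms by (simp add: half_c_def poisson_density_def power_mult_distrib)

lemma harmonic_poly_scaleR:
  "h \<in> harmonic_polys k \<Longrightarrow> h (r *\<^sub>R x) = of_real (r ^ k) * h x"
  by (simp add: harmonic_polys_def)

lemma dilated_poisson_kernel_integral:
  fixes Z :: "'a::euclidean_space \<Rightarrow> 'a \<Rightarrow> complex"
  assumes Z: "reproducing_kernel k Z" and h: "h \<in> harmonic_polys k" and \<xi>: "norm \<xi> = 1"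
  shows "(LINT u|surface_measure. poisson_kernel k Z \<zeta> (r *\<^sub>R \<xi>) u (s *\<^sub>R \<eta>) * h u)
    = of_real ((real DIM('a) + 2 * real k - 2) / (real DIM('a) - 2) * s ^ k)
      * (of_real (poisson_density r \<xi> \<zeta>) * h (reflection (r *\<^sub>R \<xi> - \<zeta>) \<eta>))"
  unfolding poisson_kernel_integral_harmonic[OF Z h] half_c_poisson_density[OF \<xi>]
    reflection_scaleR harmonic_poly_scaleR[OF h]
  by (simp only: of_real_mult mult_ac)

lemma dilate_poisson_integral:
  fixes Z :: "'a::euclidean_space \<Rightarrow> 'a \<Rightarrow> complex"
  assumes Z: "reproducing_kernel k Z" 
    and g: "\<And>\<zeta>. \<zeta> \<in> sphere 0 1 \<Longrightarrow> \<exists>h\<in>harmonic_polys k. \<forall>u\<in>sphere 0 1. g (\<zeta>, u) = h u"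
    and \<xi>: "norm \<xi> = 1" and \<eta>: "norm \<eta> = 1"
  shows "dilate r s (poisson_integral k Z g) (\<xi>, \<eta>)
    = of_real ((real DIM('a) + 2 * real k - 2) / (real DIM('a) - 2) * s ^ k)
      * (LINT \<zeta>|surface_measure. of_real (poisson_density r \<xi> \<zeta>) * g (\<zeta>, reflection (r *\<^sub>R \<xi> - \<zeta>) \<eta>))"
proof -
  have "(LINT u|surface_measure. poisson_kernel k Z \<zeta> (r *\<^sub>R \<xi>) u (s *\<^sub>R \<eta>) * g (\<zeta>, u))
    = of_real ((real DIM('a) + 2 * real k - 2) / (real DIM('a) - 2) * s ^ k)
      * (of_real (poisson_density r \<xi> \<zeta>) * g (\<zeta>, reflection (r *\<^sub>R \<xi> - \<zeta>) \<eta>))"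
    if \<zeta>: "\<zeta> \<in> sphere 0 1" for \<zeta>
  proof -
    obtain h where h: "h \<in> harmonic_polys k" "\<And>u. u \<in> sphere 0 1 \<Longrightarrow> g (\<zeta>, u) = h u"
      using g[OF \<zeta>] by blast
    have "(LINT u|surface_measure. poisson_kernel k Z \<zeta> (r *\<^sub>R \<xi>) u (s *\<^sub>R \<eta>) * g (\<zeta>, u))
        = (LINT u|surface_measure. poisson_kernel k Z \<zeta> (r *\<^sub>R \<xi>) u (s *\<^sub>R \<eta>) * h u)"
      by (intro Bochner_Integration.integral_cong refl) (simp add: h(2))
    also have "\<dots> = of_real ((real DIM('a) + 2 * real k - 2) / (real DIM('a) - 2) * s ^ k)
      * (of_real (poisson_density r \<xi> \<zeta>) * h (reflection (r *\<^sub>R \<xi> - \<zeta>) \<eta>))"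
      by (rule dilated_poisson_kernel_integral[OF Z h(1) \<xi>])
    also have "h (reflection (r *\<^sub>R \<xi> - \<zeta>) \<eta>) = g (\<zeta>, reflection (r *\<^sub>R \<xi> - \<zeta>) \<eta>)"
      by (simp add: h(2) \<eta>)
    finally show ?thesis .
  qed
  then have "dilate r s (poisson_integral k Z g) (\<xi>, \<eta>)
    = (LINT \<zeta>|surface_measure. of_real ((real DIM('a) + 2 * real k - 2) / (real DIM('a) - 2) * s ^ k)
      * (of_real (poisson_density r \<xi> \<zeta>) * g (\<zeta>, reflection (r *\<^sub>R \<xi> - \<zeta>) \<eta>)))"
    unfolding dilate_def poisson_integral_def
    by (simp only: case_prod_conv) (intro Bochner_Integration.integral_cong refl, simp)
  then show ?thesis by (simp only: integral_mult_right_zero)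
qed

section \<open>Estimates in the Lebesgue spaces\<close>

text \<open>The graph of \<open>t powr p\<close> lies above its tangent at \<open>a\<close>.\<close>
lemma powr_tangent_bound:
  fixes a t p :: real
  assumes "1 \<le> p" "0 < a" "0 \<le> t"
  shows "p * (t * a powr (p - 1)) \<le> t powr p + (p - 1) * a powr p"
proof (cases "p = 1 \<or> t = 0")
  case False
  then have p: "1 < p" "0 < t" using assms by auto
  have "(t powr p) powr (1 / p) * (a powr p) powr (1 - 1 / p) \<le> 1 / p * t powr p + (1 - 1 / p) * a powr p"
    using p assms by (intro Youngs_inequality_0) auto
  also have "(t powr p) powr (1 / p) * (a powr p) powr (1 - 1 / p) = t * a powr (p - 1)"
    using p assms by (simp add: powr_powr right_diff_distrib)
  finally have "p * (t * a powr (p - 1)) \<le> p * (1 / p * t powr p + (1 - 1 / p) * a powr p)"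
    using p by (intro mult_left_mono) auto
  also have "\<dots> = t powr p + (p - 1) * a powr p" using p by (simp add: field_simps)
  finally show ?thesis .
qed (use assms in \<open>auto simp: zero_le_mult_iff\<close>)

text \<open>Jensen's inequality, obtained by integrating the tangent bound at the norm of the
  expectation. A function that is not integrable has the integral \<open>0\<close>, for which the inequality is trivial.\<close>
lemma (in prob_space) norm_expectation_powr_le:
  fixes X :: "'a \<Rightarrow> 'b::{banach, second_countable_topology}"
  assumes p: "1 \<le> p" and X: "X \<in> borel_measurable M"
  shows "ennreal (norm (\<integral>x. X x \<partial>M) powr p) \<le> (\<integral>\<^sup>+x. ennreal (norm (X x) powr p) \<partial>M)"
proof (cases "integrable M X \<and> (\<integral>x. X x \<partial>M) \<noteq> 0 \<and> (\<integral>\<^sup>+x. ennreal (norm (X x) powr p) \<partial>M) < \<infinity>")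
  case True
  define a where "a = norm (\<integral>x. X x \<partial>M)"
  have a: "0 < a" using True by (simp add: a_def)
  have int: "integrable M (\<lambda>x. norm (X x))" using True by simp
  have intp: "integrable M (\<lambda>x. norm (X x) powr p)"
    using True X by (intro integrableI_nonneg) auto
  have "p * (a * a powr (p - 1)) \<le> p * ((\<integral>x. norm (X x) \<partial>M) * a powr (p - 1))"
    using p a unfolding a_def by (intro mult_left_mono mult_right_mono integral_norm_bound) auto
  also have "\<dots> = (\<integral>x. p * (norm (X x) * a powr (p - 1)) \<partial>M)"
    by simp
  also have "\<dots> \<le> (\<integral>x. norm (X x) powr p + (p - 1) * a powr p \<partial>M)"
    using p a int intp by (intro integral_mono powr_tangent_bound) auto
  also have "\<dots> = (\<integral>x. norm (X x) powr p \<partial>M) + (p - 1) * a powr p"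
    using intp by (simp add: prob_space)
  also have "a * a powr (p - 1) = a powr p"
    using a by (simp add: powr_diff)
  finally have "a powr p \<le> (\<integral>x. norm (X x) powr p \<partial>M)"
    by (simp add: algebra_simps)
  then show ?thesis
    using intp by (subst nn_integral_eq_integral) (auto simp: a_def intro: ennreal_leI)
qed (use p in \<open>auto simp: not_integrable_integral_eq less_top[symmetric]\<close>)

definition poisson_measure :: "real \<Rightarrow> 'a::euclidean_space \<Rightarrow> 'a measure" where
  "poisson_measure r \<xi> = density surface_measure (\<lambda>\<zeta>. ennreal (poisson_density r \<xi> \<zeta>))"

lemma measurable_poisson_density_surface:
  "poisson_density r \<xi> \<in> borel_measurable surface_measure"
  by (intro measurable_poisson_density measurable_const measurable_ident_surface)
     simp

lemma sets_poisson_measure: "sets (poisson_measure r \<xi>) = sets surface_measure"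
  by (simp add: poisson_measure_def)

lemma prob_space_poisson_measure:
  fixes \<xi> :: "'a::euclidean_space"
  assumes "norm \<xi> = 1" "0 \<le> r" "r < 1" "DIM('a) \<ge> 3"
  shows "prob_space (poisson_measure r \<xi>)"
proof
  have "emeasure (poisson_measure r \<xi>) (space (poisson_measure r \<xi>))
      = (\<integral>\<^sup>+\<zeta>. ennreal (poisson_density r \<xi> \<zeta>) * indicator (space surface_measure) \<zeta> \<partial>surface_measure)"
    unfolding poisson_measure_def space_density
    using measurable_poisson_density_surface[of r \<xi>] by (intro emeasure_density sets.top) auto
  also have "\<dots> = (\<integral>\<^sup>+\<zeta>. ennreal (poisson_density r \<xi> \<zeta>) \<partial>surface_measure)"
    by (intro nn_integral_cong) simp
  also have "\<dots> = 1" by (rule nn_integral_poisson_density[OF assms])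
  finally show "emeasure (poisson_measure r \<xi>) (space (poisson_measure r \<xi>)) = 1" .
qed

lemma integral_poisson_measure:
  fixes \<xi> :: "'a::euclidean_space" and X :: "'a \<Rightarrow> complex"
  assumes "0 \<le> r" "r < 1" "X \<in> borel_measurable surface_measure"
  shows "(LINT \<zeta>|poisson_measure r \<xi>. X \<zeta>) = (LINT \<zeta>|surface_measure. of_real (poisson_density r \<xi> \<zeta>) * X \<zeta>)"
  unfolding poisson_measure_def
  using assms measurable_poisson_density_surface[of r \<xi>]
  by (subst integral_density) (auto simp: poisson_density_nonneg scaleR_conv_of_real)

lemma nn_integral_poisson_measure:
  fixes \<xi> :: "'a::euclidean_space" and X :: "'a \<Rightarrow> ennreal"
  assumes "X \<in> borel_measurable surface_measure"
  shows "(\<integral>\<^sup>+\<zeta>. X \<zeta> \<partial>poisson_measure r \<xi>) = (\<integral>\<^sup>+\<zeta>. ennreal (poisson_density r \<xi> \<zeta>) * X \<zeta> \<partial>surface_measure)"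
  unfolding poisson_measure_def
  using assms measurable_poisson_density_surface[of r \<xi>]
  by (intro nn_integral_density) auto

lemma measurable_reflected_section:
  fixes g :: "'a::euclidean_space \<times> 'a \<Rightarrow> 'b"
  assumes g: "g \<in> sphere_pair_measure \<rightarrow>\<^sub>M N" and \<eta>: "norm \<eta> = 1"
  shows "(\<lambda>\<zeta>. g (\<zeta>, reflection (r *\<^sub>R \<xi> - \<zeta>) \<eta>)) \<in> surface_measure \<rightarrow>\<^sub>M N"
proof -
  have "(\<lambda>\<zeta>. reflection (r *\<^sub>R \<xi> - \<zeta>) \<eta>) \<in> surface_measure \<rightarrow>\<^sub>M surface_measure"
    using \<eta> by (intro measurable_reflection_surface borel_measurable_diff measurable_ident_surface measurable_const) simp_all
  then have "(\<lambda>\<zeta>. (\<zeta>, reflection (r *\<^sub>R \<xi> - \<zeta>) \<eta>)) \<in> surface_measure \<rightarrow>\<^sub>M sphere_pair_measure"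
    unfolding sphere_pair_measure_def by (intro measurable_Pair) auto
  from measurable_compose[OF this g] show ?thesis .
qed

lemma measurable_dilate_poisson_integral:
  fixes Z :: "'a::euclidean_space \<Rightarrow> 'a \<Rightarrow> complex"
  assumes Z: "reproducing_kernel k Z" 
    and g: "\<And>\<zeta>. \<zeta> \<in> sphere 0 1 \<Longrightarrow> \<exists>h\<in>harmonic_polys k. \<forall>u\<in>sphere 0 1. g (\<zeta>, u) = h u"
    and meas: "g \<in> borel_measurable sphere_pair_measure"
  shows "dilate r s (poisson_integral k Z g) \<in> borel_measurable sphere_pair_measure"
proof (rule measurable_cong[THEN iffD1, rotated])
  show "(\<lambda>z. of_real ((real DIM('a) + 2 * real k - 2) / (real DIM('a) - 2) * s ^ k)
      * (LINT \<zeta>|surface_measure. of_real (poisson_density r (fst z) \<zeta>) * g (\<zeta>, reflection (r *\<^sub>R fst z - \<zeta>) (snd z))))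
      \<in> borel_measurable sphere_pair_measure"
    using meas
    by (intro borel_measurable_times borel_measurable_const measurable_poisson_average
        surface.sigma_finite_measure_axioms refl) (simp add: sphere_pair_measure_def)
  fix z :: "'a \<times> 'a" assume "z \<in> space sphere_pair_measure"
  then have "norm (fst z) = 1" "norm (snd z) = 1"
    by (auto simp: sphere_pair_measure_def space_pair_measure)
  from dilate_poisson_integral[OF Z g this, of r s]
  show "of_real ((real DIM('a) + 2 * real k - 2) / (real DIM('a) - 2) * s ^ k)
    * (LINT \<zeta>|surface_measure. of_real (poisson_density r (fst z) \<zeta>) * g (\<zeta>, reflection (r *\<^sub>R fst z - \<zeta>) (snd z)))
    = dilate r s (poisson_integral k Z g) z"
    unfolding prod.collapse by (rule sym)
qed

lemma Lp_norm_finite: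
  assumes "p \<noteq> \<infinity>" "f \<in> borel_measurable M"
  shows "Lp_norm p M f < \<infinity> \<longleftrightarrow> (\<integral>\<^sup>+ x. ennreal (norm (f x) powr enn2real p) \<partial>M) < \<infinity>"
  using assms by (auto simp: Lp_norm_def Let_def less_top[symmetric])

text \<open>A bound between the integrals of \<open>p\<close>-th powers is a bound between norms; the finiteness of
  the right-hand integral excludes the value \<open>\<infinity>\<close>, on which \<^const>\<open>Lp_norm\<close> takes its other branch.\<close>
lemma Lp_norm_le:
  assumes p: "1 \<le> p" "p \<noteq> \<infinity>" and f: "f \<in> borel_measurable M" and g: "g \<in> borel_measurable N"
    and C: "0 \<le> C"
    and le: "(\<integral>\<^sup>+ x. ennreal (norm (f x) powr enn2real p) \<partial>M)
      \<le> ennreal (C powr enn2real p) * (\<integral>\<^sup>+ x. ennreal (norm (g x) powr enn2real p) \<partial>N)"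
    and fin: "(\<integral>\<^sup>+ x. ennreal (norm (g x) powr enn2real p) \<partial>N) < \<infinity>"
  shows "Lp_norm p M f \<le> ennreal C * Lp_norm p N g"
proof -
  define q where "q = enn2real p"
  have q: "1 \<le> q"
    using p unfolding q_def by (metis enn2real_1 enn2real_mono ennreal_one_neq_top less_top infinity_ennreal_def)
  obtain I where I: "(\<integral>\<^sup>+ x. ennreal (norm (g x) powr q) \<partial>N) = ennreal I" "0 \<le> I"
    using fin unfolding q_def by (metis less_top ennreal_cases infinity_ennreal_def order_less_irrefl)
  have le': "(\<integral>\<^sup>+ x. ennreal (norm (f x) powr q) \<partial>M) \<le> ennreal (C powr q * I)"
    using le unfolding q_def[symmetric] I by (subst ennreal_mult) (use I(2) in auto)
  then obtain J where J: "(\<integral>\<^sup>+ x. ennreal (norm (f x) powr q) \<partial>M) = ennreal J" "0 \<le> J"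
    by (cases "\<integral>\<^sup>+ x. ennreal (norm (f x) powr q) \<partial>M") (auto simp: top_unique)
  have "J \<le> C powr q * I"
    using le' unfolding J by (subst (asm) ennreal_le_iff) (use I in auto)
  then have "J powr (1 / q) \<le> (C powr q * I) powr (1 / q)"
    using J q by (intro powr_mono2) auto
  also have "\<dots> = C * I powr (1 / q)"
    using C q I by (simp add: powr_mult powr_powr)
  finally have "ennreal (J powr (1 / q)) \<le> ennreal C * ennreal (I powr (1 / q))"
    using C by (subst ennreal_mult[symmetric]) (auto intro: ennreal_leI)
  then show ?thesis
    using p f g I J unfolding Lp_norm_def q_def[symmetric] by simp
qed

text \<open>The value at \<open>(\<xi>, \<eta>)\<close> is \<open>C * s ^ k\<close> times the mean of \<open>g (\<zeta>, R \<eta>)\<close> under the Poisson measure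
  of \<open>\<xi>\<close>. Means satisfy Jensen's inequality and respect bounds that hold almost everywhere, and
  averaging preserves integrals.\<close>
lemma Lp_norm_poisson_integral:
  fixes Z :: "'a::euclidean_space \<Rightarrow> 'a \<Rightarrow> complex"
  assumes dim: "DIM('a) \<ge> 3" and Z: "reproducing_kernel k Z" and p: "1 \<le> p" and g: "g \<in> Lp_harmonic p k"
    and r: "0 \<le> r" "r < 1" and s: "0 \<le> s" "s < 1"
  shows "Lp_norm p sphere_pair_measure (dilate r s (poisson_integral k Z g))
    \<le> ennreal ((real DIM('a) + 2 * real k - 2) / (real DIM('a) - 2)) * Lp_norm p sphere_pair_measure g"
proof -
  define C where "C = (real DIM('a) + 2 * real k - 2) / (real DIM('a) - 2)"
  have C: "0 \<le> C" unfolding C_def using dim by simp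
  define f where "f = dilate r s (poisson_integral k Z g)"
  have harm: "\<And>\<zeta>. \<zeta> \<in> sphere 0 1 \<Longrightarrow> \<exists>h\<in>harmonic_polys k. \<forall>u\<in>sphere 0 1. g (\<zeta>, u) = h u"
    and fin: "Lp_norm p sphere_pair_measure g < \<infinity>"
    using g by (auto simp: Lp_harmonic_def)
  have g_meas: "g \<in> borel_measurable sphere_pair_measure"
    using fin by (auto simp: Lp_norm_def split: if_splits)
  have f_meas: "f \<in> borel_measurable sphere_pair_measure"
    unfolding f_def by (rule measurable_dilate_poisson_integral[OF Z harm g_meas])
  define X where "X z \<zeta> = g (\<zeta>, reflection (r *\<^sub>R fst z - \<zeta>) (snd z))" for z :: "'a \<times> 'a" and \<zeta>
  have pt: "norm (fst z) = 1" "norm (snd z) = 1" if "z \<in> space sphere_pair_measure" for z :: "'a \<times> 'a"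
    using that by (auto simp: sphere_pair_measure_def space_pair_measure)
  have X_meas: "X z \<in> borel_measurable surface_measure" if "z \<in> space sphere_pair_measure" for z
    unfolding X_def using pt(2)[OF that] g_meas by (intro measurable_reflected_section)
  have X_meas': "X z \<in> borel_measurable (poisson_measure r (fst z))" if "z \<in> space sphere_pair_measure" for z
    using X_meas[OF that] by (simp add: measurable_cong_sets[OF sets_poisson_measure refl])
  have f_le: "norm (f z) \<le> C * norm (LINT \<zeta>|poisson_measure r (fst z). X z \<zeta>)"
    if z: "z \<in> space sphere_pair_measure" for z
  proof -
    have "f z = of_real (C * s ^ k) * (LINT \<zeta>|poisson_measure r (fst z). X z \<zeta>)"
      using dilate_poisson_integral[OF Z harm pt[OF z], of r s]
      unfolding f_def C_def integral_poisson_measure[OF r X_meas[OF z]] unfolding X_def prod.collapse by blast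
    then have "norm (f z) = C * s ^ k * norm (LINT \<zeta>|poisson_measure r (fst z). X z \<zeta>)"
      using C s by (simp add: norm_mult norm_power)
    also have "\<dots> \<le> C * 1 * norm (LINT \<zeta>|poisson_measure r (fst z). X z \<zeta>)"
      using C s by (intro mult_right_mono mult_left_mono power_le_one) auto
    finally show ?thesis by simp
  qed
  have prob: "prob_space (poisson_measure r (fst z))" if "z \<in> space sphere_pair_measure" for z :: "'a \<times> 'a"
    using pt(1)[OF that] r dim by (intro prob_space_poisson_measure)
  have transport: "(\<integral>\<^sup>+z. \<integral>\<^sup>+\<zeta>. \<Phi> (\<zeta>, reflection (r *\<^sub>R fst z - \<zeta>) (snd z)) \<partial>poisson_measure r (fst z) \<partial>sphere_pair_measure)
      = (\<integral>\<^sup>+y. \<Phi> y \<partial>sphere_pair_measure)"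
    if \<Phi>: "\<Phi> \<in> borel_measurable sphere_pair_measure" for \<Phi> :: "'a \<times> 'a \<Rightarrow> ennreal"
  proof -
    have "(\<integral>\<^sup>+z. \<integral>\<^sup>+\<zeta>. \<Phi> (\<zeta>, reflection (r *\<^sub>R fst z - \<zeta>) (snd z)) \<partial>poisson_measure r (fst z) \<partial>sphere_pair_measure)
      = (\<integral>\<^sup>+z. \<integral>\<^sup>+\<zeta>. ennreal (poisson_density r (fst z) \<zeta>) * \<Phi> (\<zeta>, reflection (r *\<^sub>R fst z - \<zeta>) (snd z)) \<partial>surface_measure \<partial>sphere_pair_measure)"
      using pt(2) \<Phi> by (intro nn_integral_cong nn_integral_poisson_measure measurable_reflected_section) auto
    also have "\<dots> = (\<integral>\<^sup>+y. \<Phi> y \<partial>sphere_pair_measure)"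
      using nn_integral_reflected_poisson[OF surface.sigma_finite_measure_axioms refl _ r dim, of \<Phi>] \<Phi>
      by (simp add: sphere_pair_measure_def)
    finally show ?thesis .
  qed
  have average_meas: "(\<lambda>z. \<integral>\<^sup>+\<zeta>. \<Phi> (\<zeta>, reflection (r *\<^sub>R fst z - \<zeta>) (snd z)) \<partial>poisson_measure r (fst z))
      \<in> borel_measurable sphere_pair_measure"
    if \<Phi>: "\<Phi> \<in> borel_measurable sphere_pair_measure" for \<Phi> :: "'a \<times> 'a \<Rightarrow> ennreal"
  proof -
    have "(\<lambda>z. \<integral>\<^sup>+\<zeta>. ennreal (poisson_density r (fst z) \<zeta>) * \<Phi> (\<zeta>, reflection (r *\<^sub>R fst z - \<zeta>) (snd z)) \<partial>surface_measure)
        \<in> borel_measurable sphere_pair_measure"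
      using measurable_reflected_poisson[OF refl, of \<Phi> r] \<Phi>
      by (intro surface.borel_measurable_nn_integral) (simp add: sphere_pair_measure_def)
    then show ?thesis
      using pt(2) \<Phi> by (subst measurable_cong[OF nn_integral_poisson_measure]) (auto intro!: measurable_reflected_section)
  qed
  have "Lp_norm p sphere_pair_measure f \<le> ennreal C * Lp_norm p sphere_pair_measure g"
  proof (cases "p = \<infinity>")
    case False
    define q where "q = enn2real p"
    have q: "1 \<le> q"
      using p False unfolding q_def by (metis enn2real_1 enn2real_mono less_top infinity_ennreal_def)
    have "(\<integral>\<^sup>+z. ennreal (norm (f z) powr q) \<partial>sphere_pair_measure)
      \<le> (\<integral>\<^sup>+z. ennreal (C powr q) * (\<integral>\<^sup>+\<zeta>. ennreal (norm (X z \<zeta>) powr q) \<partial>poisson_measure r (fst z)) \<partial>sphere_pair_measure)"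
    proof (rule nn_integral_mono)
      fix z :: "'a \<times> 'a" assume z: "z \<in> space sphere_pair_measure"
      have "norm (f z) powr q \<le> (C * norm (LINT \<zeta>|poisson_measure r (fst z). X z \<zeta>)) powr q"
        using f_le[OF z] q by (intro powr_mono2) auto
      also have "\<dots> = C powr q * norm (LINT \<zeta>|poisson_measure r (fst z). X z \<zeta>) powr q"
        using C by (simp add: powr_mult)
      finally have "ennreal (norm (f z) powr q)
          \<le> ennreal (C powr q) * ennreal (norm (LINT \<zeta>|poisson_measure r (fst z). X z \<zeta>) powr q)"
        by (subst ennreal_mult[symmetric]) (auto intro: ennreal_leI)
      also have "\<dots> \<le> ennreal (C powr q) * (\<integral>\<^sup>+\<zeta>. ennreal (norm (X z \<zeta>) powr q) \<partial>poisson_measure r (fst z))"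
        by (intro mult_left_mono prob_space.norm_expectation_powr_le[OF prob[OF z] q X_meas'[OF z]]) simp
      finally show "ennreal (norm (f z) powr q) \<le> \<dots>" .
    qed
    also have "\<dots> = ennreal (C powr q) * (\<integral>\<^sup>+z. \<integral>\<^sup>+\<zeta>. ennreal (norm (X z \<zeta>) powr q) \<partial>poisson_measure r (fst z) \<partial>sphere_pair_measure)"
      unfolding X_def using g_meas average_meas[of "\<lambda>y. ennreal (norm (g y) powr q)"] by (intro nn_integral_cmult) simp
    also have "\<dots> = ennreal (C powr q) * (\<integral>\<^sup>+y. ennreal (norm (g y) powr q) \<partial>sphere_pair_measure)"
      unfolding X_def using g_meas by (subst transport[of "\<lambda>y. ennreal (norm (g y) powr q)"]) auto
    finally show ?thesis
      using Lp_norm_finite[OF False g_meas] fin unfolding q_def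
      by (intro Lp_norm_le[OF p False f_meas g_meas C]) auto
  next
    case True
    define A where "A = esssup sphere_pair_measure (\<lambda>y. ennreal (norm (g y)))"
    have A: "A < \<infinity>" "Lp_norm p sphere_pair_measure g = A"
      using fin g_meas True by (auto simp: A_def Lp_norm_def)
    have to_real: "norm c \<le> enn2real A" if "\<not> A < ennreal (norm c)" for c :: complex
    proof -
      have "enn2real (ennreal (norm c)) \<le> enn2real A"
        using that A(1) by (intro enn2real_mono) (auto simp: not_less)
      then show ?thesis by simp
    qed
    \<comment> \<open>The indicator of the null set where \<open>g\<close> exceeds its essential supremum.\<close>
    define \<Phi> :: "'a \<times> 'a \<Rightarrow> ennreal" where "\<Phi> y = indicator {y. A < ennreal (norm (g y))} y" for y
    have \<Phi>: "\<Phi> \<in> borel_measurable sphere_pair_measure"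
      unfolding \<Phi>_def indicator_def using g_meas by measurable
    have "AE y in sphere_pair_measure. \<Phi> y = 0"
      using esssup_AE[of "\<lambda>y. ennreal (norm (g y))" sphere_pair_measure]
      by eventually_elim (auto simp: \<Phi>_def A_def[symmetric] indicator_def)
    then have "(\<integral>\<^sup>+y. \<Phi> y \<partial>sphere_pair_measure) = 0"
      using \<Phi> by (simp add: nn_integral_0_iff_AE)
    then have zero: "(\<integral>\<^sup>+z. \<integral>\<^sup>+\<zeta>. \<Phi> (\<zeta>, reflection (r *\<^sub>R fst z - \<zeta>) (snd z)) \<partial>poisson_measure r (fst z) \<partial>sphere_pair_measure) = 0"
      by (simp add: transport[OF \<Phi>])
    have "AE z in sphere_pair_measure. (\<integral>\<^sup>+\<zeta>. \<Phi> (\<zeta>, reflection (r *\<^sub>R fst z - \<zeta>) (snd z)) \<partial>poisson_measure r (fst z)) = 0"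
      using zero by (simp add: nn_integral_0_iff_AE average_meas[OF \<Phi>])
    then have "AE z in sphere_pair_measure. ennreal (norm (f z)) \<le> ennreal C * A"
    proof (rule AE_mp, intro AE_I2 impI)
      fix z :: "'a \<times> 'a" assume z: "z \<in> space sphere_pair_measure"
        and int0: "(\<integral>\<^sup>+\<zeta>. \<Phi> (\<zeta>, reflection (r *\<^sub>R fst z - \<zeta>) (snd z)) \<partial>poisson_measure r (fst z)) = 0"
      interpret prob_space "poisson_measure r (fst z)" by (rule prob[OF z])
      have "(\<lambda>\<zeta>. \<Phi> (\<zeta>, reflection (r *\<^sub>R fst z - \<zeta>) (snd z))) \<in> borel_measurable (poisson_measure r (fst z))"
        using measurable_reflected_section[OF \<Phi> pt(2)[OF z], of r "fst z"]
        by (simp add: measurable_cong_sets[OF sets_poisson_measure refl])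
      then have "AE \<zeta> in poisson_measure r (fst z). \<Phi> (\<zeta>, reflection (r *\<^sub>R fst z - \<zeta>) (snd z)) = 0"
        using int0 by (simp add: nn_integral_0_iff_AE)
      then have AE: "AE \<zeta> in poisson_measure r (fst z). norm (X z \<zeta>) \<le> enn2real A"
        by eventually_elim (auto simp: \<Phi>_def X_def indicator_def split: if_splits intro: to_real)
      then have "integrable (poisson_measure r (fst z)) (X z)"
        using X_meas'[OF z] by (rule integrable_const_bound)
      then have "norm (LINT \<zeta>|poisson_measure r (fst z). X z \<zeta>) \<le> (LINT \<zeta>|poisson_measure r (fst z). enn2real A)"
        using AE by (intro integral_norm_bound[THEN order_trans] integral_mono_AE) auto
      also have "\<dots> = enn2real A" by (simp add: prob_space)
      finally have "C * norm (LINT \<zeta>|poisson_measure r (fst z). X z \<zeta>) \<le> C * enn2real A"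
        using C by (intro mult_left_mono)
      then have "ennreal (norm (f z)) \<le> ennreal (C * enn2real A)"
        using f_le[OF z] by (intro ennreal_leI) linarith
      also have "\<dots> = ennreal C * A"
        using C A by (simp add: ennreal_mult)
      finally show "ennreal (norm (f z)) \<le> ennreal C * A" .
    qed
    then have "esssup sphere_pair_measure (\<lambda>z. ennreal (norm (f z))) \<le> ennreal C * A"
      using f_meas by (intro esssup_I) auto
    then show ?thesis
      using True f_meas A(2) by (simp add: Lp_norm_def)
  qed
  then show ?thesis by (simp add: f_def C_def)
qed

section \<open>The upper variation of a signed measure\<close>

text \<open>The terms may be negative and the convergence conditional: on the right, negative terms count as \<open>0\<close>.\<close>
lemma ennreal_sums_le:
  assumes "x sums (s :: real)"
  shows "ennreal s \<le> (\<Sum>i. ennreal (x i))"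
proof (cases "(\<Sum>i. ennreal (max 0 (x i))) = top")
  case False
  then have summ: "summable (\<lambda>i. max 0 (x i))" by (intro summable_suminf_not_top) auto
  have "s \<le> (\<Sum>i. max 0 (x i))"
    using assms summ by (auto simp: sums_iff intro!: suminf_le)
  then have "ennreal s \<le> ennreal (\<Sum>i. max 0 (x i))" by (rule ennreal_leI)
  also have "\<dots> = (\<Sum>i. ennreal (max 0 (x i)))"
    using summ by (intro suminf_ennreal2[symmetric]) auto
  finally show ?thesis unfolding ennreal_max_0 .
qed (simp add: ennreal_max_0)

locale signed_measure =
  fixes M :: "'a measure" and \<nu> :: "'a set \<Rightarrow> real"
  assumes sums: "range A \<subseteq> sets M \<Longrightarrow> disjoint_family A \<Longrightarrow> (\<lambda>i. \<nu> (A i)) sums \<nu> (\<Union>i. A i)"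
begin

lemma empty [simp]: "\<nu> {} = 0"
proof -
  have "(\<lambda>i::nat. \<nu> {}) sums \<nu> {}"
    using sums[of "\<lambda>_. {}"] by (simp add: disjoint_family_on_def)
  from sums_summable[OF this] show ?thesis by (simp add: summable_const_iff)
qed

lemma additive:
  assumes "A \<in> sets M" "B \<in> sets M" "A \<inter> B = {}"
  shows "\<nu> (A \<union> B) = \<nu> A + \<nu> B"
proof -
  have "(\<lambda>i. \<nu> (binaryset A B i)) sums \<nu> (\<Union>i. binaryset A B i)"
    using assms by (intro sums) (auto simp: range_binaryset_eq disjoint_family_on_def binaryset_def)
  moreover have "(\<lambda>i. \<nu> (binaryset A B i)) sums (\<Sum>i\<in>{0, 1}. \<nu> (binaryset A B i))"
    by (intro sums_finite) (auto simp: binaryset_def)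
  ultimately show ?thesis
    by (auto simp: UN_binaryset_eq binaryset_def dest: sums_unique2)
qed

text \<open>The formula of \<^const>\<open>upper_variation\<close> as a bare set function, for which countable additivity has to
  be shown before \<^const>\<open>measure_of\<close> takes these values.\<close>
definition variation :: "'a set \<Rightarrow> ennreal" where
  "variation E = (SUP A\<in>{A \<in> sets M. A \<subseteq> E}. ennreal (\<nu> A))"

lemma variation_upper: "A \<in> sets M \<Longrightarrow> A \<subseteq> E \<Longrightarrow> ennreal (\<nu> A) \<le> variation E"
  unfolding variation_def by (rule SUP_upper) auto

lemma variation_mono: "E \<subseteq> F \<Longrightarrow> variation E \<le> variation F"
  unfolding variation_def by (rule SUP_subset_mono) auto

text \<open>Subsets of \<open>E\<close> and of \<open>F\<close> that nearly attain the suprema are disjoint; subsets of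
  negative measure contribute \<open>0\<close>, like the empty set.\<close>
lemma variation_superadditive:
  assumes "E \<inter> F = {}"
  shows "variation E + variation F \<le> variation (E \<union> F)"
proof -
  have le: "ennreal (\<nu> A) + ennreal (\<nu> B) \<le> variation (E \<union> F)"
    if A: "A \<in> sets M" "A \<subseteq> E" and B: "B \<in> sets M" "B \<subseteq> F" for A B
  proof (cases "0 \<le> \<nu> A \<and> 0 \<le> \<nu> B")
    case True
    have "\<nu> A + \<nu> B = \<nu> (A \<union> B)" using assms A B by (intro additive[symmetric]) auto
    then have "ennreal (\<nu> A) + ennreal (\<nu> B) = ennreal (\<nu> (A \<union> B))"
      using True by (simp flip: ennreal_plus)
    also have "\<dots> \<le> variation (E \<union> F)" using A B by (intro variation_upper) auto
    finally show ?thesis .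
  next
    case False
    then show ?thesis
      using variation_upper[of A "E \<union> F"] variation_upper[of B "E \<union> F"] A B
      by (auto simp: ennreal_neg not_le le_supI1 le_supI2)
  qed
  have ne: "{A \<in> sets M. A \<subseteq> G} \<noteq> {}" for G by auto
  have "variation E + variation F = (SUP A\<in>{A \<in> sets M. A \<subseteq> E}. SUP B\<in>{B \<in> sets M. B \<subseteq> F}. ennreal (\<nu> A) + ennreal (\<nu> B))"
    unfolding variation_def
    by (simp only: ennreal_SUP_add_left[OF ne, symmetric] ennreal_SUP_add_right[OF ne, symmetric])
  also have "\<dots> \<le> variation (E \<union> F)"
    by (intro SUP_least) (use le in auto)
  finally show ?thesis .
qed

lemma measure_space_variation: "measure_space (space M) (sets M) variation"
  unfolding measure_space_def
proof (intro conjI)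
  show "sigma_algebra (space M) (sets M)" ..
  show "positive (sets M) variation"
    by (auto simp: positive_def variation_def)
  show "countably_additive (sets M) variation"
    unfolding countably_additive_def
  proof (intro allI impI)
    fix E :: "nat \<Rightarrow> 'a set"
    assume E: "range E \<subseteq> sets M" "disjoint_family E"
    show "(\<Sum>i. variation (E i)) = variation (\<Union>i. E i)"
    proof (rule antisym)
      have "(\<Sum>i<n. variation (E i)) \<le> variation (\<Union>i<n. E i)" for n
      proof (induction n)
        case (Suc n)
        have "(\<Sum>i<Suc n. variation (E i)) \<le> variation (\<Union>i<n. E i) + variation (E n)"
          using Suc by (simp add: add_right_mono)
        also have "\<dots> \<le> variation ((\<Union>i<n. E i) \<union> E n)"
        proof (rule variation_superadditive)
          have "E i \<inter> E n = {}" if "i < n" for i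
            using E(2) that by (simp add: disjoint_family_on_def)
          then show "(\<Union>i<n. E i) \<inter> E n = {}" by blast
        qed
        also have "(\<Union>i<n. E i) \<union> E n = (\<Union>i<Suc n. E i)"
          by (auto simp: lessThan_Suc)
        finally show ?case .
      qed simp
      also have "variation (\<Union>i<n. E i) \<le> variation (\<Union>i. E i)" for n
        by (intro variation_mono) auto
      finally show "(\<Sum>i. variation (E i)) \<le> variation (\<Union>i. E i)"
        by (simp add: suminf_eq_SUP SUP_least)
      show "variation (\<Union>i. E i) \<le> (\<Sum>i. variation (E i))"
        unfolding variation_def[of "\<Union>i. E i"]
      proof (rule SUP_least)
        fix A assume "A \<in> {A \<in> sets M. A \<subseteq> (\<Union>i. E i)}"
        then have A: "A \<in> sets M" "A = (\<Union>i. A \<inter> E i)" by auto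
        have "(\<lambda>i. \<nu> (A \<inter> E i)) sums \<nu> (\<Union>i. A \<inter> E i)"
          using A(1) E by (intro sums disjoint_family_subset[OF E(2)]) auto
        from ennreal_sums_le[OF this] have "ennreal (\<nu> A) \<le> (\<Sum>i. ennreal (\<nu> (A \<inter> E i)))"
          unfolding A(2)[symmetric] .
        also have "\<dots> \<le> (\<Sum>i. variation (E i))"
          using A E by (intro suminf_le summableI variation_upper) auto
        finally show "ennreal (\<nu> A) \<le> (\<Sum>i. variation (E i))" .
      qed
    qed
  qed
qed

lemma upper_variation_eq: "upper_variation M \<nu> = measure_of (space M) (sets M) variation"
  by (simp add: upper_variation_def variation_def[abs_def])

lemma sets_upper_variation [simp]: "sets (upper_variation M \<nu>) = sets M"
  by (simp add: upper_variation_def)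

lemma space_upper_variation [simp]: "space (upper_variation M \<nu>) = space M"
  by (simp add: upper_variation_def)

lemma emeasure_upper_variation:
  assumes "E \<in> sets M"
  shows "emeasure (upper_variation M \<nu>) E = (SUP A\<in>{A \<in> sets M. A \<subseteq> E}. ennreal (\<nu> A))"
proof -
  have "emeasure (upper_variation M \<nu>) E = variation E"
    using measure_space_variation assms
    by (intro emeasure_measure_of[OF upper_variation_eq]) (auto simp: measure_space_def sets.space_closed dest: sets.sets_into_space)
  then show ?thesis by (simp add: variation_def)
qed

text \<open>If \<open>A \<subseteq> E\<close> has \<open>\<nu> A > 1 + |\<nu> E|\<close>, then \<open>\<nu> (E - A) < -1\<close>. So both pieces have large measure, and
  by additivity one of them has infinite variation again.\<close>
lemma variation_split:
  assumes E: "E \<in> sets M" "variation E = \<infinity>"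
  shows "\<exists>B. (B \<in> sets M \<and> variation B = \<infinity>) \<and> B \<subseteq> E \<and> 1 < \<bar>\<nu> (E - B)\<bar>"
proof -
  have "ennreal (1 + \<bar>\<nu> E\<bar>) < variation E" using E by simp
  then obtain A where A: "A \<in> sets M" "A \<subseteq> E" "ennreal (1 + \<bar>\<nu> E\<bar>) < ennreal (\<nu> A)"
    unfolding variation_def less_SUP_iff by auto
  have large: "1 + \<bar>\<nu> E\<bar> < \<nu> A" using A(3) by (subst (asm) ennreal_less_iff) auto
  have un: "A \<union> (E - A) = E" using A by auto
  have "\<nu> E = \<nu> A + \<nu> (E - A)"
    using additive[of A "E - A", unfolded un] A E by auto
  then have large': "1 < \<bar>\<nu> (E - A)\<bar>" using large by linarith
  have "variation E \<le> variation A + variation (E - A)"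
    using emeasure_subadditive[of A "upper_variation M \<nu>" "E - A", unfolded un] A E
    by (simp add: emeasure_upper_variation variation_def)
  then have "variation A = \<infinity> \<or> variation (E - A) = \<infinity>"
    using E(2) by (auto simp: top_unique ennreal_add_eq_top)
  then show ?thesis
  proof
    assume "variation A = \<infinity>"
    then show ?thesis using A large' by (intro exI[of _ A]) auto
  next
    assume "variation (E - A) = \<infinity>"
    moreover have "E - (E - A) = A" using A by auto
    ultimately show ?thesis using A E large by (intro exI[of _ "E - A"]) auto
  qed
qed

text \<open>Otherwise repeated splitting produces disjoint sets whose measures exceed \<open>1\<close> in absolute value
  and still form a convergent series.\<close>
lemma variation_finite: "variation (space M) \<noteq> \<infinity>"
proof
  assume inf: "variation (space M) = \<infinity>"
  have "\<exists>B. \<forall>n. (B n \<in> sets M \<and> variation (B n) = \<infinity>) \<and> (B (Suc n) \<subseteq> B n \<and> 1 < \<bar>\<nu> (B n - B (Suc n))\<bar>)"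
    by (rule dependent_nat_choice) (use inf variation_split in auto)
  then obtain B where B: "\<And>n. B n \<in> sets M" "\<And>n. B (Suc n) \<subseteq> B n" "\<And>n. 1 < \<bar>\<nu> (B n - B (Suc n))\<bar>"
    by blast
  define D where "D n = B n - B (Suc n)" for n
  have dec: "decseq B" using B(2) by (intro decseq_SucI)
  have "D m \<inter> D n = {}" if "m < n" for m n
    using decseqD[OF dec, of "Suc m" n] that by (auto simp: D_def)
  then have "disjoint_family D"
    unfolding disjoint_family_on_def by (metis Int_commute linorder_neqE_nat)
  moreover have "range D \<subseteq> sets M" using B(1) by (auto simp: D_def)
  ultimately have "(\<lambda>n. \<nu> (D n)) sums \<nu> (\<Union>n. D n)" by (intro sums)
  then have "(\<lambda>n. \<nu> (D n)) \<longlonglongrightarrow> 0"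
    by (intro summable_LIMSEQ_zero sums_summable)
  then obtain n where "\<bar>\<nu> (D n)\<bar> < 1"
    using LIMSEQ_D[of "\<lambda>n. \<nu> (D n)" 0 1] by auto
  with B(3)[of n] show False by (simp add: D_def)
qed

lemma finite_measure_upper_variation: "finite_measure (upper_variation M \<nu>)"
  by (rule finite_measureI) (use variation_finite in \<open>simp add: emeasure_upper_variation variation_def\<close>)

text \<open>The supremum of \<open>\<nu>\<close> over the subsets of \<open>E\<close> is attained at the part of \<open>E\<close> where \<open>f \<ge> 0\<close>.\<close>
lemma upper_variation_density:
  assumes f: "integrable M f" and \<nu>: "\<And>A. A \<in> sets M \<Longrightarrow> \<nu> A = (LINT x:A|M. f x)"
  shows "upper_variation M \<nu> = density M (\<lambda>x. ennreal (max 0 (f x)))"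
proof (rule measure_eqI)
  note [measurable] = borel_measurable_integrable[OF f]
  fix E assume "E \<in> sets (upper_variation M \<nu>)"
  then have E [measurable]: "E \<in> sets M" by simp
  have int_A: "integrable M (\<lambda>x. indicator A x * f x)" if "A \<in> sets M" for A
    using integrable_mult_indicator[OF that f] by simp
  have int_pos: "integrable M (\<lambda>x. indicator A x * max 0 (f x))" if A: "A \<in> sets M" for A
    using integrable_mult_indicator[OF A, of "\<lambda>x. max 0 (f x)"] integrable_max[OF integrable_zero f] by simp
  have eq: "ennreal (LINT x|M. indicator A x * max 0 (f x)) = (\<integral>\<^sup>+x. ennreal (max 0 (f x)) * indicator A x \<partial>M)"
    if A: "A \<in> sets M" for A
    by (subst nn_integral_eq_integral[OF int_pos[OF A], symmetric])
       (auto simp: indicator_def intro!: nn_integral_cong)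
  have dens: "emeasure (density M (\<lambda>x. ennreal (max 0 (f x)))) E = (\<integral>\<^sup>+x. ennreal (max 0 (f x)) * indicator E x \<partial>M)"
    by (rule emeasure_density) auto
  show "emeasure (upper_variation M \<nu>) E = emeasure (density M (\<lambda>x. ennreal (max 0 (f x)))) E"
    unfolding emeasure_upper_variation[OF E] dens
  proof (rule antisym)
    show "(SUP A\<in>{A \<in> sets M. A \<subseteq> E}. ennreal (\<nu> A)) \<le> (\<integral>\<^sup>+x. ennreal (max 0 (f x)) * indicator E x \<partial>M)"
    proof (rule SUP_least)
      fix A assume "A \<in> {A \<in> sets M. A \<subseteq> E}"
      then have A: "A \<in> sets M" "A \<subseteq> E" by auto
      have "\<nu> A \<le> (LINT x|M. indicator A x * max 0 (f x))"
        unfolding \<nu>[OF A(1)] set_lebesgue_integral_def real_scaleR_def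
        by (intro integral_mono int_A int_pos A mult_left_mono) auto
      then have "ennreal (\<nu> A) \<le> (\<integral>\<^sup>+x. ennreal (max 0 (f x)) * indicator A x \<partial>M)"
        unfolding eq[OF A(1), symmetric] by (rule ennreal_leI)
      also have "\<dots> \<le> (\<integral>\<^sup>+x. ennreal (max 0 (f x)) * indicator E x \<partial>M)"
        using A by (intro nn_integral_mono) (auto simp: indicator_def)
      finally show "ennreal (\<nu> A) \<le> \<dots>" .
    qed
    define P where "P = {x \<in> E. 0 \<le> f x}"
    have "P = E \<inter> {x \<in> space M. 0 \<le> f x}" using sets.sets_into_space[OF E] by (auto simp: P_def)
    then have P: "P \<in> sets M" "P \<subseteq> E" by (auto simp: P_def)
    have "(\<integral>\<^sup>+x. ennreal (max 0 (f x)) * indicator E x \<partial>M) = ennreal (LINT x|M. indicator E x * max 0 (f x))"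
      by (rule eq[OF E, symmetric])
    also have "(LINT x|M. indicator E x * max 0 (f x)) = \<nu> P"
      unfolding \<nu>[OF P(1)] set_lebesgue_integral_def real_scaleR_def
      by (intro Bochner_Integration.integral_cong) (auto simp: P_def indicator_def)
    also have "ennreal (\<nu> P) \<le> (SUP A\<in>{A \<in> sets M. A \<subseteq> E}. ennreal (\<nu> A))"
      using P by (intro SUP_upper) auto
    finally show "(\<integral>\<^sup>+x. ennreal (max 0 (f x)) * indicator E x \<partial>M) \<le> (SUP A\<in>{A \<in> sets M. A \<subseteq> E}. ennreal (\<nu> A))" .
  qed
qed simp

end

section \<open>Densities of complex measures\<close>

lemma complex_measure_parts:
  assumes "complex_measure M \<mu>"
  shows "signed_measure M (\<lambda>A. Re (\<mu> A))" "signed_measure M (\<lambda>A. - Re (\<mu> A))"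
    "signed_measure M (\<lambda>A. Im (\<mu> A))" "signed_measure M (\<lambda>A. - Im (\<mu> A))"
  using assms by (auto simp: signed_measure_def complex_measure_def sums_complex_iff intro: sums_minus)

text \<open>If the four parts of the Jordan decomposition have densities with respect to one measure \<open>\<sigma>\<close>,
  integration against \<open>\<mu>\<close> is integration against a complex density.\<close>
lemma complex_measure_integral_density:
  fixes \<phi> :: "'a \<Rightarrow> complex"
  assumes sets: "sets \<sigma> = sets M"
    and dens: "upper_variation M (\<lambda>A. Re (\<mu> A)) = density \<sigma> (\<lambda>x. ennreal (a x))"
      "upper_variation M (\<lambda>A. - Re (\<mu> A)) = density \<sigma> (\<lambda>x. ennreal (b x))"
      "upper_variation M (\<lambda>A. Im (\<mu> A)) = density \<sigma> (\<lambda>x. ennreal (c x))"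
      "upper_variation M (\<lambda>A. - Im (\<mu> A)) = density \<sigma> (\<lambda>x. ennreal (d x))"
    and int: "integrable \<sigma> a" "integrable \<sigma> b" "integrable \<sigma> c" "integrable \<sigma> d"
    and nonneg: "\<And>x. 0 \<le> a x" "\<And>x. 0 \<le> b x" "\<And>x. 0 \<le> c x" "\<And>x. 0 \<le> d x"
    and \<phi>: "\<phi> \<in> borel_measurable M" "\<And>x. x \<in> space M \<Longrightarrow> norm (\<phi> x) \<le> B"
  shows "complex_measure_integral M \<mu> \<phi>
      = (LINT x|\<sigma>. (of_real (a x - b x) + \<i> * of_real (c x - d x)) * \<phi> x)"
proof -
  have [measurable]: "\<phi> \<in> borel_measurable \<sigma>" using \<phi>(1) sets by (simp cong: measurable_cong_sets)
  have space: "space \<sigma> = space M" by (rule sets_eq_imp_space_eq[OF sets])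
  have int_\<phi>: "integrable \<sigma> (\<lambda>x. of_real (f x) * \<phi> x)" if f: "integrable \<sigma> f" for f :: "'a \<Rightarrow> real"
  proof (rule Bochner_Integration.integrable_bound[of _ "\<lambda>x. B * f x"])
    show "integrable \<sigma> (\<lambda>x. B * f x)" using f by simp
    show "(\<lambda>x. of_real (f x) * \<phi> x) \<in> borel_measurable \<sigma>" using f by measurable
    show "AE x in \<sigma>. norm (of_real (f x) * \<phi> x) \<le> norm (B * f x)"
    proof (rule AE_I2)
      fix x assume "x \<in> space \<sigma>"
      then have "norm (\<phi> x) \<le> \<bar>B\<bar>" using \<phi>(2)[of x] by (simp add: space)
      then show "norm (of_real (f x) * \<phi> x) \<le> norm (B * f x)"
        by (simp add: norm_mult abs_mult mult.commute[of "\<bar>f x\<bar>"] mult_right_mono)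
    qed
  qed
  have d: "(LINT x|density \<sigma> (\<lambda>x. ennreal (f x)). \<phi> x) = (LINT x|\<sigma>. of_real (f x) * \<phi> x)"
    if "integrable \<sigma> f" "\<And>x. 0 \<le> f x" for f :: "'a \<Rightarrow> real"
    using that by (subst integral_density) (auto simp: scaleR_conv_of_real)
  note i = int_\<phi>[OF int(1)] int_\<phi>[OF int(2)] int_\<phi>[OF int(3)] int_\<phi>[OF int(4)]
  have "complex_measure_integral M \<mu> \<phi> =
      ((LINT x|\<sigma>. of_real (a x) * \<phi> x) - (LINT x|\<sigma>. of_real (b x) * \<phi> x)) +
     \<i> * ((LINT x|\<sigma>. of_real (c x) * \<phi> x) - (LINT x|\<sigma>. of_real (d x) * \<phi> x))"
    unfolding complex_measure_integral_def dens
    by (simp only: d[OF int(1) nonneg(1)] d[OF int(2) nonneg(2)] d[OF int(3) nonneg(3)] d[OF int(4) nonneg(4)])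
  also have "\<dots> = (LINT x|\<sigma>. (of_real (a x) * \<phi> x - of_real (b x) * \<phi> x) + \<i> * (of_real (c x) * \<phi> x - of_real (d x) * \<phi> x))"
    using i by simp
  also have "\<dots> = (LINT x|\<sigma>. (of_real (a x - b x) + \<i> * of_real (c x - d x)) * \<phi> x)"
    by (intro Bochner_Integration.integral_cong refl) (simp add: algebra_simps)
  finally show ?thesis .
qed

lemma complex_measure_integral_indefinite:
  fixes \<phi> h :: "'a \<Rightarrow> complex"
  assumes \<mu>: "complex_measure M \<mu>" and h: "integrable M h" and \<mu>_eq: "\<And>A. A \<in> sets M \<Longrightarrow> \<mu> A = (LINT x:A|M. h x)"
    and \<phi>: "\<phi> \<in> borel_measurable M" "\<And>x. x \<in> space M \<Longrightarrow> norm (\<phi> x) \<le> B"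
  shows "complex_measure_integral M \<mu> \<phi> = (LINT x|M. h x * \<phi> x)"
proof -
  have set_int: "set_integrable M A h" if "A \<in> sets M" for A
    using integrable_mult_indicator[OF that h] by (simp add: set_integrable_def)
  have Re: "Re (\<mu> A) = (LINT x:A|M. Re (h x))" and Im: "Im (\<mu> A) = (LINT x:A|M. Im (h x))"
    if A: "A \<in> sets M" for A
    using set_int[OF A] unfolding \<mu>_eq[OF A] set_lebesgue_integral_def set_integrable_def
    by (simp_all flip: integral_Re integral_Im)
  have int: "integrable M (\<lambda>x. Re (h x))" "integrable M (\<lambda>x. Im (h x))"
    "integrable M (\<lambda>x. - Re (h x))" "integrable M (\<lambda>x. - Im (h x))"
    using h by auto
  note sm = complex_measure_parts[OF \<mu>]
  have "complex_measure_integral M \<mu> \<phi>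
      = (LINT x|M. (of_real (max 0 (Re (h x)) - max 0 (- Re (h x))) + \<i> * of_real (max 0 (Im (h x)) - max 0 (- Im (h x)))) * \<phi> x)"
  proof (rule complex_measure_integral_density[OF refl])
    show "upper_variation M (\<lambda>A. Re (\<mu> A)) = density M (\<lambda>x. ennreal (max 0 (Re (h x))))"
      using sm(1) int(1) by (rule signed_measure.upper_variation_density) (rule Re)
    show "upper_variation M (\<lambda>A. - Re (\<mu> A)) = density M (\<lambda>x. ennreal (max 0 (- Re (h x))))"
      using sm(2) int(3) by (rule signed_measure.upper_variation_density) (simp add: Re set_lebesgue_integral_def)
    show "upper_variation M (\<lambda>A. Im (\<mu> A)) = density M (\<lambda>x. ennreal (max 0 (Im (h x))))"
      using sm(3) int(2) by (rule signed_measure.upper_variation_density) (rule Im)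
    show "upper_variation M (\<lambda>A. - Im (\<mu> A)) = density M (\<lambda>x. ennreal (max 0 (- Im (h x))))"
      using sm(4) int(4) by (rule signed_measure.upper_variation_density) (simp add: Im set_lebesgue_integral_def)
  qed (use int \<phi> in auto)
  also have "\<dots> = (LINT x|M. h x * \<phi> x)"
    by (intro Bochner_Integration.integral_cong refl arg_cong2[where f="(*)"])
       (simp add: complex_eq_iff max_def)
  finally show ?thesis .
qed

text \<open>A common dominating measure, needed to apply the Radon-Nikodym theorem to several measures at
  once.\<close>
lemma sum_of_measures:
  fixes N :: "'i \<Rightarrow> 'a measure"
  assumes I: "finite I" and fin: "\<And>i. i \<in> I \<Longrightarrow> finite_measure (N i)" and sets: "\<And>i. i \<in> I \<Longrightarrow> sets (N i) = sets M"
  obtains \<sigma> where "finite_measure \<sigma>" "sets \<sigma> = sets M" "\<And>i. i \<in> I \<Longrightarrow> absolutely_continuous \<sigma> (N i)"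
proof
  define \<sigma> where "\<sigma> = measure_of (space M) (sets M) (\<lambda>E. \<Sum>i\<in>I. emeasure (N i) E)"
  show sets_\<sigma>: "sets \<sigma> = sets M" by (simp add: \<sigma>_def)
  have em: "emeasure \<sigma> E = (\<Sum>i\<in>I. emeasure (N i) E)" if "E \<in> sets M" for E
  proof (rule emeasure_measure_of[OF \<sigma>_def])
    show "sets M \<subseteq> Pow (space M)" by (rule sets.space_closed)
    show "E \<in> sets \<sigma>" using that by (simp add: sets_\<sigma>)
    show "positive (sets \<sigma>) (\<lambda>E. \<Sum>i\<in>I. emeasure (N i) E)" by (simp add: positive_def)
    show "countably_additive (sets \<sigma>) (\<lambda>E. \<Sum>i\<in>I. emeasure (N i) E)"
      unfolding countably_additive_def sets_\<sigma>
    proof (intro allI impI)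
      fix A :: "nat \<Rightarrow> 'a set" assume A: "range A \<subseteq> sets M" "disjoint_family A"
      have "(\<Sum>n. \<Sum>i\<in>I. emeasure (N i) (A n)) = (\<Sum>i\<in>I. \<Sum>n. emeasure (N i) (A n))"
        by (intro suminf_sum summableI)
      also have "\<dots> = (\<Sum>i\<in>I. emeasure (N i) (\<Union>n. A n))"
        using A sets by (intro sum.cong refl suminf_emeasure) auto
      finally show "(\<Sum>n. \<Sum>i\<in>I. emeasure (N i) (A n)) = (\<Sum>i\<in>I. emeasure (N i) (\<Union>n. A n))" .
    qed
  qed
  have space: "space \<sigma> = space M" by (rule sets_eq_imp_space_eq[OF sets_\<sigma>])
  show "finite_measure \<sigma>"
    using fin I sets by (intro finite_measureI)
      (auto simp: space em ennreal_sum_eq_top finite_measure.emeasure_finite)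
  show "absolutely_continuous \<sigma> (N i)" if "i \<in> I" for i
    using that I sets[OF that]
    by (auto simp: absolutely_continuous_def null_sets_def sets_\<sigma> em)
qed

lemma finite_density:
  assumes \<sigma>: "finite_measure \<sigma>" and N: "finite_measure N" and sets: "sets N = sets \<sigma>" and ac: "absolutely_continuous \<sigma> N"
  shows "\<exists>f. integrable \<sigma> f \<and> (\<forall>x. 0 \<le> (f x :: real)) \<and> N = density \<sigma> (\<lambda>x. ennreal (f x))"
proof -
  interpret \<sigma>: finite_measure \<sigma> by (rule \<sigma>)
  obtain f where f: "f \<in> borel_measurable \<sigma>" "AE x in \<sigma>. RN_deriv \<sigma> N x = ennreal (f x)" "\<And>x. 0 \<le> f x"
    using \<sigma>.real_RN_deriv[OF N ac sets] by metis
  have N_eq: "N = density \<sigma> (\<lambda>x. ennreal (f x))"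
    by (rule trans[OF \<sigma>.density_RN_deriv[OF ac sets, symmetric]], rule density_cong) (use f in auto)
  have "(\<integral>\<^sup>+x. ennreal (f x) \<partial>\<sigma>) = emeasure N (space \<sigma>)"
    by (subst N_eq, subst emeasure_density) (use f in \<open>auto intro!: nn_integral_cong\<close>)
  also have "\<dots> < \<infinity>"
    using finite_measure.emeasure_finite[OF N] by (simp add: less_top[symmetric])
  finally have "integrable \<sigma> f" using f by (intro integrableI_nonneg) auto
  with f(3) N_eq show ?thesis by blast
qed

text \<open>The sum \<open>\<sigma>\<close> of the four parts of the Jordan decomposition dominates each of them, so
  the Radon-Nikodym theorem gives the densities. Splitting integrals against \<open>\<mu>\<close> into the four parts
  would lose a constant in the estimates; the modulus of the complex density \<open>w\<close> does not.\<close>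
lemma complex_measure_density:
  assumes \<mu>: "complex_measure M \<mu>"
  obtains \<sigma> w where "finite_measure \<sigma>" "sets \<sigma> = sets M" "integrable \<sigma> (w :: 'a \<Rightarrow> complex)"
    "\<And>\<phi>. \<phi> \<in> borel_measurable M \<Longrightarrow> bounded (\<phi> ` space M) \<Longrightarrow>
      complex_measure_integral M \<mu> \<phi> = (LINT x|\<sigma>. w x * \<phi> x)"
proof -
  note sm = complex_measure_parts[OF \<mu>]
  define N where "N = [upper_variation M (\<lambda>A. Re (\<mu> A)), upper_variation M (\<lambda>A. - Re (\<mu> A)),
    upper_variation M (\<lambda>A. Im (\<mu> A)), upper_variation M (\<lambda>A. - Im (\<mu> A))]"
  have N: "finite_measure L \<and> sets L = sets M" if "L \<in> set N" for L
    using that sm by (auto simp: N_def signed_measure.finite_measure_upper_variation signed_measure.sets_upper_variation)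
  obtain \<sigma> where \<sigma>: "finite_measure \<sigma>" "sets \<sigma> = sets M" "\<And>L. L \<in> set N \<Longrightarrow> absolutely_continuous \<sigma> L"
    using sum_of_measures[of "set N" "\<lambda>L. L" M] N by auto
  have ex: "\<exists>f. integrable \<sigma> f \<and> (\<forall>x. 0 \<le> (f x :: real)) \<and> L = density \<sigma> (\<lambda>x. ennreal (f x))" if "L \<in> set N" for L
    using N[OF that] \<sigma> that by (intro finite_density) auto
  obtain a where a: "integrable \<sigma> a" "\<And>x. 0 \<le> (a x :: real)" "upper_variation M (\<lambda>A. Re (\<mu> A)) = density \<sigma> (\<lambda>x. ennreal (a x))"
    using ex[of "upper_variation M (\<lambda>A. Re (\<mu> A))"] by (auto simp: N_def)
  obtain b where b: "integrable \<sigma> b" "\<And>x. 0 \<le> (b x :: real)" "upper_variation M (\<lambda>A. - Re (\<mu> A)) = density \<sigma> (\<lambda>x. ennreal (b x))"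
    using ex[of "upper_variation M (\<lambda>A. - Re (\<mu> A))"] by (auto simp: N_def)
  obtain c where c: "integrable \<sigma> c" "\<And>x. 0 \<le> (c x :: real)" "upper_variation M (\<lambda>A. Im (\<mu> A)) = density \<sigma> (\<lambda>x. ennreal (c x))"
    using ex[of "upper_variation M (\<lambda>A. Im (\<mu> A))"] by (auto simp: N_def)
  obtain d where d: "integrable \<sigma> d" "\<And>x. 0 \<le> (d x :: real)" "upper_variation M (\<lambda>A. - Im (\<mu> A)) = density \<sigma> (\<lambda>x. ennreal (d x))"
    using ex[of "upper_variation M (\<lambda>A. - Im (\<mu> A))"] by (auto simp: N_def)
  show thesis
  proof (rule that[OF \<sigma>(1,2)])
    show "integrable \<sigma> (\<lambda>x. of_real (a x - b x) + \<i> * of_real (c x - d x))"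
      using a b c d by auto
    show "complex_measure_integral M \<mu> \<phi> = (LINT x|\<sigma>. (of_real (a x - b x) + \<i> * of_real (c x - d x)) * \<phi> x)"
      if \<phi>: "\<phi> \<in> borel_measurable M" "bounded (\<phi> ` space M)" for \<phi>
    proof -
      obtain B where "\<And>x. x \<in> space M \<Longrightarrow> norm (\<phi> x) \<le> B"
        using \<phi>(2) by (auto simp: bounded_iff)
      with a b c d \<phi>(1) show ?thesis
        by (intro complex_measure_integral_density[OF \<sigma>(2)]) auto
    qed
  qed
qed

section \<open>Total variation and products\<close>

text \<open>Cut the space into countably many pieces on which \<open>F\<close> varies by less than \<open>2 \<epsilon>\<close>: preimages of
  disjoint parts of balls around a countable dense set. On such a piece there is almost no
  cancellation: the modulus of the integral of \<open>F\<close> differs from the integral of \<open>|F|\<close> by at most \<open>2 \<epsilon>\<close>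
  times the mass of the piece.\<close>
lemma nn_integral_le_total_variation_norm:
  fixes F :: "'a \<Rightarrow> complex"
  assumes N: "finite_measure N" and sets: "sets N = sets M" and F: "integrable N F"
    and \<nu>: "\<And>A. A \<in> sets M \<Longrightarrow> \<nu> A = (LINT x:A|N. F x)"
  shows "(\<integral>\<^sup>+x. ennreal (norm (F x)) \<partial>N) \<le> total_variation_norm M \<nu>"
proof (rule ennreal_le_epsilon)
  interpret finite_measure N by (rule N)
  note [measurable] = borel_measurable_integrable[OF F]
  have space: "space N = space M" by (rule sets_eq_imp_space_eq[OF sets])
  fix e :: real assume "0 < e"
  define c where "c = measure N (space N)"
  \<comment> \<open>The error summed over all pieces is \<open>2 * \<epsilon> * c\<close>; the \<open>1\<close> keeps the denominator positive.\<close>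
  define \<epsilon> where "\<epsilon> = e / (2 * c + 1)"
  have c: "0 \<le> c" by (simp add: c_def)
  have \<epsilon>: "0 < \<epsilon>" using \<open>0 < e\<close> c by (simp add: \<epsilon>_def)
  have "\<epsilon> * (2 * c) \<le> \<epsilon> * (2 * c + 1)" using \<epsilon> by (intro mult_left_mono) auto
  also have "\<dots> = e" using c by (simp add: \<epsilon>_def)
  finally have \<epsilon>_le: "2 * \<epsilon> * c \<le> e" by simp
  obtain D :: "complex set" where D: "countable D" "\<And>X. open X \<Longrightarrow> X \<noteq> {} \<Longrightarrow> \<exists>d\<in>D. d \<in> X"
    by (rule countable_dense_setE) blast
  have "D \<noteq> {}" using D(2)[of UNIV] by auto
  define d where "d = from_nat_into D"
  have range_d: "range d = D"
    unfolding d_def using D(1) \<open>D \<noteq> {}\<close> by (rule range_from_nat_into[rotated])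
  define Q where "Q = disjointed (\<lambda>i. ball (d i) \<epsilon>)"
  define A where "A i = F -` Q i \<inter> space N" for i
  have Q_meas: "Q i \<in> sets borel" for i
  proof -
    have "range Q \<subseteq> sets borel"
      unfolding Q_def by (rule sets.range_disjointed_sets) auto
    then show ?thesis by blast
  qed
  have A_meas [measurable]: "A i \<in> sets N" for i
    unfolding A_def using Q_meas by measurable
  have A_disj: "disjoint_family A"
    using disjoint_family_disjointed[of "\<lambda>i. ball (d i) \<epsilon>"]
    by (auto simp: disjoint_family_on_def A_def Q_def)
  have "x \<in> (\<Union>i. Q i)" for x
  proof -
    obtain y where "y \<in> D" "y \<in> ball x \<epsilon>" using D(2)[of "ball x \<epsilon>"] \<epsilon> by auto
    then obtain i where "d i \<in> ball x \<epsilon>" using range_d by auto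
    then have "x \<in> (\<Union>i. ball (d i) \<epsilon>)" by (auto simp: dist_commute)
    then show ?thesis unfolding Q_def by (simp add: UN_disjointed_eq)
  qed
  then have A_cover: "(\<Union>i. A i) = space N" by (auto simp: A_def)
  have A_le: "(\<integral>\<^sup>+x\<in>A i. ennreal (norm (F x)) \<partial>N) \<le> ennreal (norm (\<nu> (A i))) + ennreal (2 * \<epsilon>) * emeasure N (A i)" for i
  proof -
    define a where "a = measure N (A i)"
    have near: "norm (F x - d i) \<le> \<epsilon>" if "x \<in> A i" for x
      using that disjointed_subset[of "\<lambda>i. ball (d i) \<epsilon>" i] by (auto simp: A_def Q_def dist_norm norm_minus_commute subset_iff less_imp_le)
    have int_F: "integrable N (\<lambda>x. indicator (A i) x *\<^sub>R F x)"
      by (rule integrable_mult_indicator[OF A_meas F])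
    have int_d: "integrable N (\<lambda>x. indicator (A i) x *\<^sub>R d i)"
      by (rule integrable_mult_indicator[OF A_meas]) simp
    have int_a: "(LINT x|N. indicator (A i) x *\<^sub>R y) = a *\<^sub>R y" for y :: "'b::{banach, second_countable_topology}"
    proof -
      have "integrable N (indicator (A i) :: _ \<Rightarrow> real)"
        by (intro integrable_real_indicator A_meas) (simp add: emeasure_eq_measure)
      then show ?thesis by (subst integral_scaleR_left) (simp_all add: a_def)
    qed
    have "\<nu> (A i) - a *\<^sub>R d i = (LINT x|N. indicator (A i) x *\<^sub>R F x) - (LINT x|N. indicator (A i) x *\<^sub>R d i)"
      using \<nu>[of "A i"] A_meas[of i] unfolding sets int_a by (simp add: set_lebesgue_integral_def)
    also have "\<dots> = (LINT x|N. indicator (A i) x *\<^sub>R F x - indicator (A i) x *\<^sub>R d i)"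
      using int_F int_d by simp
    also have "norm \<dots> \<le> (LINT x|N. indicator (A i) x *\<^sub>R \<epsilon>)"
    proof (rule order_trans[OF integral_norm_bound integral_mono])
      show "integrable N (\<lambda>x. norm (indicator (A i) x *\<^sub>R F x - indicator (A i) x *\<^sub>R d i))"
        by (intro integrable_norm Bochner_Integration.integrable_diff int_F int_d)
      show "integrable N (\<lambda>x. indicator (A i) x *\<^sub>R \<epsilon>)"
        by (rule integrable_mult_indicator[OF A_meas]) simp
      show "norm (indicator (A i) x *\<^sub>R F x - indicator (A i) x *\<^sub>R d i) \<le> indicator (A i) x *\<^sub>R \<epsilon>" for x
        using near[of x] by (auto simp: indicator_def)
    qed
    finally have "norm (\<nu> (A i) - a *\<^sub>R d i) \<le> a *\<^sub>R \<epsilon>"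
      unfolding int_a .
    then have 1: "a * norm (d i) \<le> norm (\<nu> (A i)) + a * \<epsilon>"
      using norm_triangle_ineq3[of "\<nu> (A i)" "a *\<^sub>R d i"] by (simp add: a_def)
    have "(\<integral>\<^sup>+x\<in>A i. ennreal (norm (F x)) \<partial>N) \<le> (\<integral>\<^sup>+x. ennreal (norm (d i) + \<epsilon>) * indicator (A i) x \<partial>N)"
    proof (intro nn_integral_mono)
      fix x show "ennreal (norm (F x)) * indicator (A i) x \<le> ennreal (norm (d i) + \<epsilon>) * indicator (A i) x"
        using near[of x] norm_triangle_sub[of "F x" "d i"] by (auto simp: indicator_def intro!: ennreal_leI)
    qed
    also have "\<dots> = ennreal ((norm (d i) + \<epsilon>) * a)"
      using \<epsilon> by (simp add: nn_integral_cmult_indicator emeasure_eq_measure a_def ennreal_mult)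
    also have "\<dots> \<le> ennreal (norm (\<nu> (A i)) + 2 * \<epsilon> * a)"
      using 1 by (intro ennreal_leI) (simp add: algebra_simps)
    also have "\<dots> = ennreal (norm (\<nu> (A i))) + ennreal (2 * \<epsilon>) * emeasure N (A i)"
      using \<epsilon> by (simp add: emeasure_eq_measure a_def ennreal_mult ennreal_plus)
    finally show ?thesis .
  qed
  have "(\<integral>\<^sup>+x. ennreal (norm (F x)) \<partial>N) = (\<integral>\<^sup>+x\<in>(\<Union>i. A i). ennreal (norm (F x)) \<partial>N)"
    unfolding A_cover by (intro nn_integral_cong) simp
  also have "\<dots> = (\<Sum>i. \<integral>\<^sup>+x\<in>A i. ennreal (norm (F x)) \<partial>N)"
    using A_disj by (intro nn_integral_disjoint_family) auto
  also have "\<dots> \<le> (\<Sum>i. ennreal (norm (\<nu> (A i))) + ennreal (2 * \<epsilon>) * emeasure N (A i))"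
    by (intro suminf_le A_le summableI)
  also have "\<dots> = (\<Sum>i. ennreal (norm (\<nu> (A i)))) + ennreal (2 * \<epsilon>) * (\<Sum>i. emeasure N (A i))"
    by (simp add: suminf_add[symmetric] summableI)
  also have "(\<Sum>i. emeasure N (A i)) = ennreal c"
    using A_disj by (subst suminf_emeasure) (auto simp: A_cover c_def emeasure_eq_measure)
  also have "(\<Sum>i. ennreal (norm (\<nu> (A i)))) \<le> total_variation_norm M \<nu>"
    unfolding total_variation_norm_def
    by (intro SUP_upper) (use A_disj A_cover A_meas sets space in auto)
  also have "ennreal (2 * \<epsilon>) * ennreal c \<le> ennreal e"
    using \<epsilon> c \<epsilon>_le by (simp add: ennreal_mult[symmetric] ennreal_leI)
  finally show "(\<integral>\<^sup>+x. ennreal (norm (F x)) \<partial>N) \<le> total_variation_norm M \<nu> + ennreal e"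
    by (simp add: add_mono add_right_mono)
qed

lemma Lp_norm_1:
  assumes "f \<in> borel_measurable M"
  shows "Lp_norm 1 M f = (\<integral>\<^sup>+x. ennreal (norm (f x)) \<partial>M)"
  using assms by (auto simp: Lp_norm_def Let_def less_top[symmetric])

lemma (in pair_sigma_finite) integrable_product:
  fixes f :: "'a \<Rightarrow> complex" and g :: "'b \<Rightarrow> complex"
  assumes f: "integrable M1 f" and g: "integrable M2 g"
  shows "integrable (M1 \<Otimes>\<^sub>M M2) (\<lambda>x. f (fst x) * g (snd x))"
proof (rule integrableI_bounded)
  note [measurable] = borel_measurable_integrable[OF f] borel_measurable_integrable[OF g]
  show "(\<lambda>x. f (fst x) * g (snd x)) \<in> borel_measurable (M1 \<Otimes>\<^sub>M M2)" by measurable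
  have "(\<integral>\<^sup>+x. ennreal (norm (f (fst x) * g (snd x))) \<partial>(M1 \<Otimes>\<^sub>M M2))
      = (\<integral>\<^sup>+x. \<integral>\<^sup>+y. ennreal (norm (f x)) * ennreal (norm (g y)) \<partial>M2 \<partial>M1)"
    by (subst M2.nn_integral_fst[symmetric]) (auto simp: norm_mult ennreal_mult)
  also have "\<dots> = (\<integral>\<^sup>+x. ennreal (norm (f x)) \<partial>M1) * (\<integral>\<^sup>+y. ennreal (norm (g y)) \<partial>M2)"
    by (simp add: nn_integral_cmult nn_integral_multc)
  also have "\<dots> < \<infinity>"
    using f g by (auto simp: integrable_iff_bounded ennreal_mult_less_top)
  finally show "(\<integral>\<^sup>+x. ennreal (norm (f (fst x) * g (snd x))) \<partial>(M1 \<Otimes>\<^sub>M M2)) < \<infinity>" .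
qed

text \<open>Fubini, applied to the indicator of \<open>E\<close> times \<open>w (fst y) * h (snd y)\<close>.\<close>
lemma product_complex_measure_density:
  fixes h :: "'b \<Rightarrow> complex" and w :: "'a \<Rightarrow> complex"
  assumes \<sigma>: "finite_measure \<sigma>" "sets \<sigma> = sets M" "integrable \<sigma> w"
    and weight: "\<And>\<phi>. \<phi> \<in> borel_measurable M \<Longrightarrow> bounded (\<phi> ` space M) \<Longrightarrow>
      complex_measure_integral M \<mu>\<^sub>1 \<phi> = (LINT x|\<sigma>. w x * \<phi> x)"
    and L: "finite_measure L" and h: "integrable L h" and \<mu>\<^sub>2: "\<And>A. A \<in> sets L \<Longrightarrow> \<mu>\<^sub>2 A = (LINT u:A|L. h u)"
    and E: "E \<in> sets (M \<Otimes>\<^sub>M L)"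
  shows "product_complex_measure M \<mu>\<^sub>1 \<mu>\<^sub>2 E = (LINT y:E|\<sigma> \<Otimes>\<^sub>M L. w (fst y) * h (snd y))"
proof -
  interpret \<sigma>: finite_measure \<sigma> by (rule \<sigma>(1))
  interpret L: finite_measure L by (rule L)
  interpret P: pair_sigma_finite \<sigma> L by unfold_locales
  note [measurable_cong] = \<sigma>(2)
  note [measurable] = borel_measurable_integrable[OF h] borel_measurable_integrable[OF \<sigma>(3)] E
  have E' [measurable]: "E \<in> sets (\<sigma> \<Otimes>\<^sub>M L)"
    using E sets_pair_measure_cong[OF \<sigma>(2) refl] by simp
  have slice: "Pair x -` E \<in> sets L" for x using E by (rule sets_Pair1)
  define \<phi> where "\<phi> x = (LINT u|L. indicator E (x, u) *\<^sub>R h u)" for x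
  have \<mu>\<^sub>2_slice: "\<mu>\<^sub>2 (Pair x -` E) = \<phi> x" for x
    unfolding \<mu>\<^sub>2[OF slice] set_lebesgue_integral_def \<phi>_def
    by (intro Bochner_Integration.integral_cong) (auto simp: indicator_def)
  have \<phi>_meas: "\<phi> \<in> borel_measurable M"
    unfolding \<phi>_def by measurable
  have \<phi>_bound: "norm (\<phi> x) \<le> (LINT u|L. norm (h u))" for x
  proof -
    have "norm (\<phi> x) \<le> (LINT u|L. norm (indicator E (x, u) *\<^sub>R h u))"
      unfolding \<phi>_def by (rule integral_norm_bound)
    also have "\<dots> \<le> (LINT u|L. norm (h u))"
    proof (rule integral_mono_AE)
      have "integrable L (\<lambda>u. norm (indicator (Pair x -` E) u *\<^sub>R h u))"
        by (rule integrable_norm[OF integrable_mult_indicator[OF slice h]])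
      then show "integrable L (\<lambda>u. norm (indicator E (x, u) *\<^sub>R h u))"
        by (simp add: indicator_def)
    qed (use h in \<open>auto simp: indicator_def\<close>)
    finally show ?thesis .
  qed
  have int: "integrable (\<sigma> \<Otimes>\<^sub>M L) (\<lambda>y. indicator E y *\<^sub>R (w (fst y) * h (snd y)))"
    by (rule integrable_mult_indicator[OF E' P.integrable_product[OF \<sigma>(3) h]])
  have "product_complex_measure M \<mu>\<^sub>1 \<mu>\<^sub>2 E = (LINT x|\<sigma>. w x * \<phi> x)"
    unfolding product_complex_measure_def \<mu>\<^sub>2_slice
    using \<phi>_bound by (intro weight[OF \<phi>_meas]) (auto simp: bounded_iff)
  also have "\<dots> = (LINT x|\<sigma>. LINT u|L. indicator E (x, u) *\<^sub>R (w x * h u))"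
    unfolding \<phi>_def integral_mult_right_zero[symmetric] by simp
  also have "\<dots> = (LINT y:E|\<sigma> \<Otimes>\<^sub>M L. w (fst y) * h (snd y))"
    using P.integral_fst'[OF int] by (simp add: set_lebesgue_integral_def)
  finally show ?thesis .
qed

section \<open>Poisson integrals of measures\<close>

text \<open>The inner integral is a Lebesgue integral of \<open>h\<close> and is evaluated by the reproducing
  property. The outer one is an integral with the complex density \<open>w\<close>, so the modulus of the Poisson integral
  is at most \<open>C\<close> times the average of \<open>|w(\<zeta>) h(R \<eta>)|\<close> with respect to \<open>\<sigma>\<close>.\<close>
lemma Lp_norm_poisson_integral_measure:
  fixes Z :: "'a::euclidean_space \<Rightarrow> 'a \<Rightarrow> complex"
  assumes dim: "DIM('a) \<ge> 3" and Z: "reproducing_kernel k Z" and \<mu>: "(\<mu>\<^sub>1, \<mu>\<^sub>2) \<in> harmonic_measures k"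
    and r: "0 \<le> r" "r < 1" and s: "0 \<le> s" "s < 1"
  shows "Lp_norm 1 sphere_pair_measure (dilate r s (poisson_integral_measure k Z \<mu>\<^sub>1 \<mu>\<^sub>2))
    \<le> ennreal ((real DIM('a) + 2 * real k - 2) / (real DIM('a) - 2)) *
      total_variation_norm sphere_pair_measure (product_complex_measure surface_measure \<mu>\<^sub>1 \<mu>\<^sub>2)"
proof -
  let ?S = "surface_measure :: 'a measure"
  define C where "C = (real DIM('a) + 2 * real k - 2) / (real DIM('a) - 2)"
  have C: "0 \<le> C" unfolding C_def using dim by simp
  obtain h where \<mu>\<^sub>1: "complex_measure ?S \<mu>\<^sub>1" and \<mu>\<^sub>2: "complex_measure ?S \<mu>\<^sub>2" and h: "h \<in> harmonic_polys k"
    and \<mu>\<^sub>2_eq: "\<And>A. A \<in> sets ?S \<Longrightarrow> \<mu>\<^sub>2 A = (LINT u:A|?S. h u)"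
    using \<mu> by (auto simp: harmonic_measures_def)
  have int_h: "integrable ?S h"
    by (intro integrable_surface_continuous continuous_on_harmonic_poly[OF h])
  obtain \<sigma> w where \<sigma>: "finite_measure \<sigma>" "sets \<sigma> = sets ?S" "integrable \<sigma> (w :: 'a \<Rightarrow> complex)"
    and weight: "\<And>\<phi>. \<phi> \<in> borel_measurable ?S \<Longrightarrow> bounded (\<phi> ` space ?S) \<Longrightarrow>
      complex_measure_integral ?S \<mu>\<^sub>1 \<phi> = (LINT x|\<sigma>. w x * \<phi> x)"
    using complex_measure_density[OF \<mu>\<^sub>1] by blast
  interpret \<sigma>: finite_measure \<sigma> by (rule \<sigma>(1))
  interpret P: pair_sigma_finite \<sigma> ?S by unfold_locales
  note [measurable_cong] = \<sigma>(2)
  have space_\<sigma>: "space \<sigma> = sphere 0 1" using sets_eq_imp_space_eq[OF \<sigma>(2)] by simp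
  have bounded_on_sphere: "\<exists>B. \<forall>x\<in>sphere 0 1. norm (p x) \<le> B" if "p \<in> harmonic_polys k" for p :: "'a \<Rightarrow> complex"
    using compact_imp_bounded[OF compact_continuous_image[OF continuous_on_harmonic_poly[OF that] compact_sphere]]
    by (auto simp: bounded_iff)
  define F where "F y = w (fst y) * h (snd y)" for y
  have int_F: "integrable (\<sigma> \<Otimes>\<^sub>M ?S) F"
    unfolding F_def by (rule P.integrable_product[OF \<sigma>(3) int_h])
  define f where "f = dilate r s (poisson_integral_measure k Z \<mu>\<^sub>1 \<mu>\<^sub>2)"
  define K where "K z \<zeta> = of_real (poisson_density r (fst z) \<zeta>) * F (\<zeta>, reflection (r *\<^sub>R fst z - \<zeta>) (snd z))"
    for z :: "'a \<times> 'a" and \<zeta>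
  have inner: "complex_measure_integral ?S \<mu>\<^sub>2 (\<lambda>u. poisson_kernel k Z \<zeta> (r *\<^sub>R \<xi>) u (s *\<^sub>R \<eta>))
      = of_real (C * s ^ k) * (of_real (poisson_density r \<xi> \<zeta>) * h (reflection (r *\<^sub>R \<xi> - \<zeta>) \<eta>))"
    if \<xi>: "norm \<xi> = 1" for \<zeta> \<xi> \<eta>
  proof -
    have Zv: "(\<lambda>u. Z u (s *\<^sub>R \<eta>)) \<in> harmonic_polys k"
      using Z by (simp add: reproducing_kernel_def)
    have Zr: "(\<lambda>u. Z (reflection (r *\<^sub>R \<xi> - \<zeta>) u) (s *\<^sub>R \<eta>)) \<in> harmonic_polys k"
      using harmonic_polys_orthogonal[OF Zv orthogonal_reflection] .
    obtain B where B: "\<And>u. u \<in> sphere 0 1 \<Longrightarrow> norm (Z (reflection (r *\<^sub>R \<xi> - \<zeta>) u) (s *\<^sub>R \<eta>)) \<le> B"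
      using bounded_on_sphere[OF Zr] by blast
    define c where "c = complex_of_real (half_c TYPE('a) k * ((1 - (norm (r *\<^sub>R \<xi>))\<^sup>2) / norm (r *\<^sub>R \<xi> - \<zeta>) ^ DIM('a)))"
    have pk: "poisson_kernel k Z \<zeta> (r *\<^sub>R \<xi>) u (s *\<^sub>R \<eta>) = c * Z (reflection (r *\<^sub>R \<xi> - \<zeta>) u) (s *\<^sub>R \<eta>)" for u
      by (simp add: poisson_kernel_def c_def)
    have "complex_measure_integral ?S \<mu>\<^sub>2 (\<lambda>u. poisson_kernel k Z \<zeta> (r *\<^sub>R \<xi>) u (s *\<^sub>R \<eta>))
        = (LINT u|?S. h u * poisson_kernel k Z \<zeta> (r *\<^sub>R \<xi>) u (s *\<^sub>R \<eta>))"
    proof (rule complex_measure_integral_indefinite[OF \<mu>\<^sub>2 int_h \<mu>\<^sub>2_eq, where B="norm c * B"])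
      show "(\<lambda>u. poisson_kernel k Z \<zeta> (r *\<^sub>R \<xi>) u (s *\<^sub>R \<eta>)) \<in> borel_measurable ?S"
        unfolding pk by (intro measurable_surface_borel borel_measurable_times measurable_const measurable_harmonic_poly[OF Zr]) simp
      show "norm (poisson_kernel k Z \<zeta> (r *\<^sub>R \<xi>) u (s *\<^sub>R \<eta>)) \<le> norm c * B" if "u \<in> space ?S" for u
        using B[of u] that by (simp add: pk norm_mult mult_left_mono)
    qed
    also have "\<dots> = (LINT u|?S. poisson_kernel k Z \<zeta> (r *\<^sub>R \<xi>) u (s *\<^sub>R \<eta>) * h u)"
      by (simp only: mult.commute)
    also have "\<dots> = of_real (C * s ^ k) * (of_real (poisson_density r \<xi> \<zeta>) * h (reflection (r *\<^sub>R \<xi> - \<zeta>) \<eta>))"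
      unfolding C_def by (rule dilated_poisson_kernel_integral[OF Z h \<xi>])
    finally show ?thesis .
  qed
  have f_eq: "f z = of_real (C * s ^ k) * (LINT \<zeta>|\<sigma>. K z \<zeta>)" if z: "norm (fst z) = 1" "norm (snd z) = 1" for z
  proof -
    define \<phi> where "\<phi> \<zeta> = of_real (C * s ^ k) * (of_real (poisson_density r (fst z) \<zeta>) * h (reflection (r *\<^sub>R fst z - \<zeta>) (snd z)))" for \<zeta>
    obtain B where B: "\<And>u. u \<in> sphere 0 1 \<Longrightarrow> norm (h u) \<le> B" using bounded_on_sphere[OF h] by blast
    define q where "q = (1 - r\<^sup>2) / (measure ?S (sphere 0 1) * (1 - r) ^ DIM('a))"
    have q: "poisson_density r (fst z) \<zeta> \<le> q" if "norm \<zeta> = 1" for \<zeta>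
      unfolding poisson_density_def q_def
      using r dilated_distance_pos[OF z(1) that r] measure_sphere_pos[where 'a='a]
      by (intro divide_left_mono mult_left_mono power_mono mult_pos_pos zero_less_power) (auto simp: power_le_one)
    have "f z = complex_measure_integral ?S \<mu>\<^sub>1 \<phi>"
      by (simp add: f_def dilate_def poisson_integral_measure_def case_prod_beta inner[OF z(1)] \<phi>_def[abs_def])
    also have "\<dots> = (LINT \<zeta>|\<sigma>. w \<zeta> * \<phi> \<zeta>)"
    proof (rule weight)
      have "(\<lambda>\<zeta>. h (reflection (r *\<^sub>R fst z - \<zeta>) (snd z))) \<in> borel_measurable ?S"
        by (intro measurable_compose[OF _ measurable_harmonic_poly[OF h]] measurable_surface_imp_borel
            measurable_reflection_surface borel_measurable_diff measurable_ident_surface borel_measurable_const measurable_const)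
           (simp_all add: z)
      then show "\<phi> \<in> borel_measurable ?S"
        unfolding \<phi>_def using measurable_poisson_density_surface[of r "fst z"]
        by (intro borel_measurable_times borel_measurable_const measurable_compose[OF _ borel_measurable_of_real])
      have "norm (\<phi> \<zeta>) \<le> norm (of_real (C * s ^ k) :: complex) * (q * B)" if "norm \<zeta> = 1" for \<zeta>
        using that unfolding \<phi>_def norm_mult[of _ "_ * _"]
        using q[of \<zeta>] B[of "reflection (r *\<^sub>R fst z - \<zeta>) (snd z)"] z poisson_density_nonneg[OF r, of "fst z" \<zeta>]
        by (intro mult_left_mono) (auto simp: norm_mult intro!: mult_mono)
      then show "bounded (\<phi> ` space ?S)"
        unfolding bounded_iff
        by (intro exI[of _ "norm (of_real (C * s ^ k) :: complex) * (q * B)"]) simp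
    qed
    also have "\<dots> = (LINT \<zeta>|\<sigma>. of_real (C * s ^ k) * K z \<zeta>)"
      by (intro Bochner_Integration.integral_cong refl) (simp only: \<phi>_def K_def F_def fst_conv snd_conv mult_ac)
    also have "\<dots> = of_real (C * s ^ k) * (LINT \<zeta>|\<sigma>. K z \<zeta>)"
      by (rule integral_mult_right_zero)
    finally show ?thesis .
  qed
  have pt: "norm (fst z) = 1" "norm (snd z) = 1" if "z \<in> space sphere_pair_measure" for z :: "'a \<times> 'a"
    using that by (auto simp: sphere_pair_measure_def space_pair_measure)
  have f_meas: "f \<in> borel_measurable sphere_pair_measure"
  proof (rule measurable_cong[THEN iffD1, rotated])
    show "(\<lambda>z. of_real (C * s ^ k) * (LINT \<zeta>|\<sigma>. K z \<zeta>)) \<in> borel_measurable sphere_pair_measure"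
      unfolding K_def using borel_measurable_integrable[OF int_F]
      by (intro borel_measurable_times borel_measurable_const measurable_poisson_average
          \<sigma>.sigma_finite_measure_axioms \<sigma>(2))
  qed (use f_eq pt in auto)
  have "Lp_norm 1 sphere_pair_measure f = (\<integral>\<^sup>+z. ennreal (norm (f z)) \<partial>sphere_pair_measure)"
    by (rule Lp_norm_1[OF f_meas])
  also have "\<dots> \<le> (\<integral>\<^sup>+z. ennreal C * (\<integral>\<^sup>+\<zeta>. ennreal (poisson_density r (fst z) \<zeta>)
      * ennreal (norm (F (\<zeta>, reflection (r *\<^sub>R fst z - \<zeta>) (snd z)))) \<partial>\<sigma>) \<partial>sphere_pair_measure)"
  proof (rule nn_integral_mono)
    fix z :: "'a \<times> 'a" assume z: "z \<in> space sphere_pair_measure"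
    have "norm (f z) = C * s ^ k * norm (LINT \<zeta>|\<sigma>. K z \<zeta>)"
      using C s by (simp add: f_eq[OF pt[OF z]] norm_mult norm_power)
    also have "\<dots> \<le> C * 1 * norm (LINT \<zeta>|\<sigma>. K z \<zeta>)"
      using C s by (intro mult_right_mono mult_left_mono power_le_one) auto
    finally have "ennreal (norm (f z)) \<le> ennreal C * ennreal (norm (LINT \<zeta>|\<sigma>. K z \<zeta>))"
      using C by (simp add: ennreal_mult[symmetric] ennreal_leI)
    also have "ennreal (norm (LINT \<zeta>|\<sigma>. K z \<zeta>)) \<le> (\<integral>\<^sup>+\<zeta>. ennreal (norm (K z \<zeta>)) \<partial>\<sigma>)"
    proof (cases "integrable \<sigma> (K z)")
      case True then show ?thesis by (rule integral_norm_bound_ennreal)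
    qed (simp add: not_integrable_integral_eq)
    also have "\<dots> = (\<integral>\<^sup>+\<zeta>. ennreal (poisson_density r (fst z) \<zeta>)
        * ennreal (norm (F (\<zeta>, reflection (r *\<^sub>R fst z - \<zeta>) (snd z)))) \<partial>\<sigma>)"
      using poisson_density_nonneg[OF r, of "fst z"] by (intro nn_integral_cong) (simp add: K_def norm_mult ennreal_mult)
    finally show "ennreal (norm (f z)) \<le> ennreal C * (\<integral>\<^sup>+\<zeta>. ennreal (poisson_density r (fst z) \<zeta>)
        * ennreal (norm (F (\<zeta>, reflection (r *\<^sub>R fst z - \<zeta>) (snd z)))) \<partial>\<sigma>)"
      by (simp add: mult_left_mono)
  qed
  also have "\<dots> = ennreal C * (\<integral>\<^sup>+z. \<integral>\<^sup>+\<zeta>. ennreal (poisson_density r (fst z) \<zeta>)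
      * ennreal (norm (F (\<zeta>, reflection (r *\<^sub>R fst z - \<zeta>) (snd z)))) \<partial>\<sigma> \<partial>sphere_pair_measure)"
    using borel_measurable_integrable[OF int_F]
    by (intro nn_integral_cmult \<sigma>.borel_measurable_nn_integral
        measurable_reflected_poisson[OF \<sigma>(2), of "\<lambda>y. ennreal (norm (F y))"]) simp
  also have "\<dots> = ennreal C * (\<integral>\<^sup>+y. ennreal (norm (F y)) \<partial>(\<sigma> \<Otimes>\<^sub>M ?S))"
    using borel_measurable_integrable[OF int_F]
    by (subst nn_integral_reflected_poisson[OF \<sigma>.sigma_finite_measure_axioms \<sigma>(2) _ r dim, of "\<lambda>y. ennreal (norm (F y))"]) simp_all
  also have "\<dots> \<le> ennreal C * total_variation_norm sphere_pair_measure (product_complex_measure ?S \<mu>\<^sub>1 \<mu>\<^sub>2)"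
  proof (intro mult_left_mono nn_integral_le_total_variation_norm[OF _ _ int_F])
    show "finite_measure (\<sigma> \<Otimes>\<^sub>M ?S)"
      by (rule finite_measure_pair_measure) unfold_locales
    show "sets (\<sigma> \<Otimes>\<^sub>M ?S) = sets (sphere_pair_measure :: ('a \<times> 'a) measure)"
      unfolding sphere_pair_measure_def by (rule sets_pair_measure_cong[OF \<sigma>(2) refl])
    fix E :: "('a \<times> 'a) set" assume "E \<in> sets sphere_pair_measure"
    then have "E \<in> sets (?S \<Otimes>\<^sub>M ?S)" by (simp add: sphere_pair_measure_def)
    from product_complex_measure_density[OF \<sigma> weight surface.finite_measure_axioms int_h \<mu>\<^sub>2_eq this]
    show "product_complex_measure ?S \<mu>\<^sub>1 \<mu>\<^sub>2 E = (LINT y:E|\<sigma> \<Otimes>\<^sub>M ?S. F y)"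
      by (simp add: F_def)
  qed simp
  finally show ?thesis by (simp add: f_def C_def)
qed

theorem theorem5p2:
  fixes k :: nat and Z :: "real ^ 'n \<Rightarrow> real ^ 'n \<Rightarrow> complex"
  assumes "CARD('n) \<ge> 3" and "k \<ge> 1" and "reproducing_kernel k Z"
  shows
    "(\<forall>\<mu>\<^sub>1 \<mu>\<^sub>2. (\<mu>\<^sub>1, \<mu>\<^sub>2) \<in> harmonic_measures k \<longrightarrow>
        (\<forall>r\<^sub>1\<in>{0..<1}. \<forall>r\<^sub>2\<in>{0..<1}.
          Lp_norm 1 sphere_pair_measure (dilate r\<^sub>1 r\<^sub>2 (poisson_integral_measure k Z \<mu>\<^sub>1 \<mu>\<^sub>2))
            \<le> ennreal ((real CARD('n) + 2 * real k - 2) / (real CARD('n) - 2)) *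
              total_variation_norm sphere_pair_measure
                (product_complex_measure surface_measure \<mu>\<^sub>1 \<mu>\<^sub>2)))
     \<and>
     (\<forall>(p::ennreal) g. 1 \<le> p \<longrightarrow> g \<in> Lp_harmonic p k \<longrightarrow>
        (\<forall>r\<^sub>1\<in>{0..<1}. \<forall>r\<^sub>2\<in>{0..<1}.
          Lp_norm p sphere_pair_measure (dilate r\<^sub>1 r\<^sub>2 (poisson_integral k Z g))
            \<le> ennreal ((real CARD('n) + 2 * real k - 2) / (real CARD('n) - 2)) *
              Lp_norm p sphere_pair_measure g))"
proof (intro conjI allI impI ballI)
  have dim: "DIM(real ^ 'n) = CARD('n)" by simp
  fix r\<^sub>1 r\<^sub>2 :: real
  assume r: "r\<^sub>1 \<in> {0..<1}" "r\<^sub>2 \<in> {0..<1}"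
  show "Lp_norm 1 sphere_pair_measure (dilate r\<^sub>1 r\<^sub>2 (poisson_integral_measure k Z \<mu>\<^sub>1 \<mu>\<^sub>2))
      \<le> ennreal ((real CARD('n) + 2 * real k - 2) / (real CARD('n) - 2)) *
        total_variation_norm sphere_pair_measure (product_complex_measure surface_measure \<mu>\<^sub>1 \<mu>\<^sub>2)"
    if "(\<mu>\<^sub>1, \<mu>\<^sub>2) \<in> harmonic_measures k" for \<mu>\<^sub>1 \<mu>\<^sub>2
    using Lp_norm_poisson_integral_measure[OF _ assms(3) that, unfolded dim] assms(1) r by simp
  show "Lp_norm p sphere_pair_measure (dilate r\<^sub>1 r\<^sub>2 (poisson_integral k Z g))
      \<le> ennreal ((real CARD('n) + 2 * real k - 2) / (real CARD('n) - 2)) * Lp_norm p sphere_pair_measure g"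
    if "1 \<le> p" "g \<in> Lp_harmonic p k" for p g
    using Lp_norm_poisson_integral[OF _ assms(3) that, unfolded dim] assms(1) r by simp
qed

end
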